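(* Let $X$ be a normal (irreducible) affine variety over $\mathbb{K}$ with an effective regular action of the one-dimensional torus $\mathbb{G}_m$. Assume that there is a prime divisor $D$ on $X$ that is fixed by $\mathbb{G}_m$ pointwise. Then the variety $X$ is not rigid. In particular, if $\dim X\ge 2$, then the automorphism group $\mathrm{Aut}(X)$ is not a (finite dimensional) algebraic group.
   Context: $\mathbb{K}$ is an algebraically closed field of characteristic zero; all varieties are over $\mathbb{K}$ and are irreducible. $\mathbb{G}_m$ is the one-dimensional algebraic torus and $\mathbb{G}_a=(\mathbb{K},+)$ is the additive group. A prime divisor is an irreducible closed subvariety of codimension one. An affine variety $X$ is called rigid if $X$ admits no non-trivial regular action of the group $\mathbb{G}_a$. $\mathrm{Aut}(X)$ is the group of automorphisms of the algebraic variety $X$; the statement that $\mathrm{Aut}(X)$ is not a (finite dimensional) algebraic group means that there is no structure of a (finite dimensional) algebraic group over $\mathbb{K}$ on the group $\mathrm{Aut}(X)$ for which the natural action $\mathrm{Aut}(X)\times X\to X$ is regular. *)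

theory Defs
  imports
    "HOL-Analysis.Abstract_Topology"
    "HOL-Algebra.Group_Action"
    "HOL-Computational_Algebra.Polynomial"
    "HOL-Library.Extended_Nat"
begin

section \<open>Spaces with functions\<close>

text \<open>
  Varieties are treated in the classical language of a topological space carrying a sheaf of
  \<open>'k\<close>-valued functions. Functions are total in HOL, so \<open>f \<in> Reg X U\<close> reads: the
  restriction of \<open>f\<close> to \<open>U\<close> is regular. The values of \<open>Reg X U\<close> for \<open>U\<close> not open are
  irrelevant.
\<close>

record ('a, 'k) fspace =
  Top :: "'a topology"
  Reg :: "'a set \<Rightarrow> ('a \<Rightarrow> 'k) set"

abbreviation points :: "('a, 'k) fspace \<Rightarrow> 'a set" where
  "points X \<equiv> topspace (Top X)"

definition function_sheaf :: "('a, 'k::field) fspace \<Rightarrow> bool" where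
  "function_sheaf X \<longleftrightarrow>
     (\<forall>U f g. openin (Top X) U \<longrightarrow> f \<in> Reg X U \<longrightarrow> (\<forall>x\<in>U. f x = g x) \<longrightarrow> g \<in> Reg X U) \<and>
     (\<forall>U c. openin (Top X) U \<longrightarrow> (\<lambda>_. c) \<in> Reg X U) \<and>
     (\<forall>U f g. openin (Top X) U \<longrightarrow> f \<in> Reg X U \<longrightarrow> g \<in> Reg X U \<longrightarrow>
        (\<lambda>x. f x + g x) \<in> Reg X U \<and> (\<lambda>x. f x * g x) \<in> Reg X U) \<and>
     (\<forall>U V f. openin (Top X) U \<longrightarrow> openin (Top X) V \<longrightarrow> V \<subseteq> U \<longrightarrow> f \<in> Reg X U \<longrightarrow> f \<in> Reg X V) \<and>
     (\<forall>U f. openin (Top X) U \<longrightarrow>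
        (\<forall>x\<in>U. \<exists>V. openin (Top X) V \<and> x \<in> V \<and> V \<subseteq> U \<and> f \<in> Reg X V) \<longrightarrow> f \<in> Reg X U)"

lemma function_sheaf_restrict:
  assumes X: "function_sheaf X" and U: "openin (Top X) U" and V: "openin (Top X) V"
    and f: "f \<in> Reg X U"
  shows "f \<in> Reg X (U \<inter> V)" "f \<in> Reg X (V \<inter> U)"
proof -
  have *: "\<forall>U V f. openin (Top X) U \<longrightarrow> openin (Top X) V \<longrightarrow> V \<subseteq> U \<longrightarrow> f \<in> Reg X U \<longrightarrow> f \<in> Reg X V"
    using X unfolding function_sheaf_def by (elim conjE) assumption
  show "f \<in> Reg X (U \<inter> V)"
    by (rule *[rule_format, OF U openin_Int[OF U V] _ f]) simp
  then show "f \<in> Reg X (V \<inter> U)"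
    by (simp add: Int_commute)
qed

lemma function_sheaf_mult:
  assumes X: "function_sheaf X" and U: "openin (Top X) U"
    and f: "f \<in> Reg X U" and g: "g \<in> Reg X U"
  shows "(\<lambda>x. f x * g x) \<in> Reg X U"
proof -
  have *: "\<forall>U f g. openin (Top X) U \<longrightarrow> f \<in> Reg X U \<longrightarrow> g \<in> Reg X U \<longrightarrow>
      (\<lambda>x. f x + g x) \<in> Reg X U \<and> (\<lambda>x. f x * g x) \<in> Reg X U"
    using X unfolding function_sheaf_def by (elim conjE) assumption
  show ?thesis
    using *[rule_format, OF U f g] by simp
qed

definition morphism :: "('a, 'k) fspace \<Rightarrow> ('b, 'k) fspace \<Rightarrow> ('a \<Rightarrow> 'b) \<Rightarrow> bool" where
  "morphism X Y \<phi> \<longleftrightarrow>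
     continuous_map (Top X) (Top Y) \<phi> \<and>
     (\<forall>V f. openin (Top Y) V \<longrightarrow> f \<in> Reg Y V \<longrightarrow> f \<circ> \<phi> \<in> Reg X {x \<in> points X. \<phi> x \<in> V})"

definition isomorphism :: "('a, 'k) fspace \<Rightarrow> ('b, 'k) fspace \<Rightarrow> ('a \<Rightarrow> 'b) \<Rightarrow> bool" where
  "isomorphism X Y \<phi> \<longleftrightarrow>
     bij_betw \<phi> (points X) (points Y) \<and> morphism X Y \<phi> \<and> morphism Y X (inv_into (points X) \<phi>)"

definition open_subspace :: "('a, 'k) fspace \<Rightarrow> 'a set \<Rightarrow> ('a, 'k) fspace" where
  "open_subspace X U = \<lparr>Top = subtopology (Top X) U, Reg = Reg X\<rparr>"

definition nonvanishing :: "'a set \<Rightarrow> ('a \<Rightarrow> 'k::zero) \<Rightarrow> 'a set" where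
  "nonvanishing S f = {x \<in> S. f x \<noteq> 0}"


section \<open>The Zariski structure defined by an algebra of functions\<close>

text \<open>
  \<open>R\<close> is meant to be a \<open>'k\<close>-algebra of functions on \<open>Z\<close>. Closed sets are the common zero
  sets of subsets of \<open>R\<close>; regular functions are locally fractions of elements of \<open>R\<close>.
\<close>

definition zariski_open :: "'a set \<Rightarrow> ('a \<Rightarrow> 'k::field) set \<Rightarrow> 'a set \<Rightarrow> bool" where
  "zariski_open Z R U \<longleftrightarrow> (\<exists>S\<subseteq>R. U = Z - {x \<in> Z. \<forall>f\<in>S. f x = 0})"

definition zariski_fspace :: "'a set \<Rightarrow> ('a \<Rightarrow> 'k::field) set \<Rightarrow> ('a, 'k) fspace" where
  "zariski_fspace Z R =
     \<lparr>Top = topology (zariski_open Z R),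
      Reg = (\<lambda>U. {h. \<forall>x\<in>U. \<exists>V f g. zariski_open Z R V \<and> x \<in> V \<and> V \<subseteq> U \<and> f \<in> R \<and> g \<in> R \<and>
                      (\<forall>y\<in>V. g y \<noteq> 0 \<and> h y = f y / g y)})\<rparr>"

lemma istopology_zariski_open:
  assumes "\<And>f g. f \<in> R \<Longrightarrow> g \<in> R \<Longrightarrow> (\<lambda>x. f x * g x) \<in> R"
  shows "istopology (zariski_open Z R)"
  unfolding istopology_def
proof (intro conjI allI impI)
  fix U V assume "zariski_open Z R U" "zariski_open Z R V"
  then obtain S T where S: "S \<subseteq> R" "U = Z - {x \<in> Z. \<forall>f\<in>S. f x = 0}"
    and T: "T \<subseteq> R" "V = Z - {x \<in> Z. \<forall>f\<in>T. f x = 0}"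
    unfolding zariski_open_def by auto
  let ?P = "{(\<lambda>x. f x * g x) |f g. f \<in> S \<and> g \<in> T}"
  have "?P \<subseteq> R" using S T assms by auto
  moreover have "U \<inter> V = Z - {x \<in> Z. \<forall>f\<in>?P. f x = 0}"
  proof (intro Set.set_eqI iffI)
    fix x assume "x \<in> U \<inter> V"
    then obtain f g where "x \<in> Z" "f \<in> S" "g \<in> T" "f x \<noteq> 0" "g x \<noteq> 0"
      using S T by auto
    then have "(\<lambda>x. f x * g x) \<in> ?P" "f x * g x \<noteq> 0" by auto
    with \<open>x \<in> Z\<close> show "x \<in> Z - {x \<in> Z. \<forall>f\<in>?P. f x = 0}" by force
  next
    fix x assume "x \<in> Z - {x \<in> Z. \<forall>f\<in>?P. f x = 0}"
    then obtain f g where "x \<in> Z" "f \<in> S" "g \<in> T" "f x * g x \<noteq> 0" by auto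
    then show "x \<in> U \<inter> V" using S T by auto
  qed
  ultimately show "zariski_open Z R (U \<inter> V)" unfolding zariski_open_def by blast
next
  fix \<U> assume "\<forall>U\<in>\<U>. zariski_open Z R U"
  then have "\<forall>U\<in>\<U>. \<exists>S. S \<subseteq> R \<and> U = Z - {x \<in> Z. \<forall>f\<in>S. f x = 0}"
    by (simp add: zariski_open_def)
  from bchoice[OF this] obtain S where
    S: "\<forall>U\<in>\<U>. S U \<subseteq> R \<and> U = Z - {x \<in> Z. \<forall>f\<in>S U. f x = 0}" ..
  have S': "x \<in> U \<longleftrightarrow> x \<in> Z \<and> (\<exists>f\<in>S U. f x \<noteq> 0)" if "U \<in> \<U>" for U x
  proof -
    have "U = Z - {x \<in> Z. \<forall>f\<in>S U. f x = 0}" using S that by simp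
    then have "x \<in> U \<longleftrightarrow> x \<in> Z - {x \<in> Z. \<forall>f\<in>S U. f x = 0}" by simp
    also have "\<dots> \<longleftrightarrow> x \<in> Z \<and> (\<exists>f\<in>S U. f x \<noteq> 0)" by blast
    finally show ?thesis .
  qed
  have "\<Union>\<U> = Z - {x \<in> Z. \<forall>f\<in>\<Union>(S ` \<U>). f x = 0}"
    by (rule Set.set_eqI) (simp add: S', blast)
  moreover have "\<Union>(S ` \<U>) \<subseteq> R" using S by (simp add: UN_subset_iff)
  ultimately show "zariski_open Z R (\<Union>\<U>)"
    unfolding zariski_open_def by (intro exI conjI)
qed


section \<open>Affine varieties\<close>

text \<open>Affine \<open>n\<close>-space is \<open>{..<n} \<rightarrow>\<^sub>E UNIV\<close>.\<close>

inductive_set poly_funs :: "nat \<Rightarrow> ((nat \<Rightarrow> 'k::field) \<Rightarrow> 'k) set" for n where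
  const: "(\<lambda>_. c) \<in> poly_funs n"
| coord: "i < n \<Longrightarrow> (\<lambda>x. x i) \<in> poly_funs n"
| add: "p \<in> poly_funs n \<Longrightarrow> q \<in> poly_funs n \<Longrightarrow> (\<lambda>x. p x + q x) \<in> poly_funs n"
| mult: "p \<in> poly_funs n \<Longrightarrow> q \<in> poly_funs n \<Longrightarrow> (\<lambda>x. p x * q x) \<in> poly_funs n"

definition algebraic_set :: "nat \<Rightarrow> (nat \<Rightarrow> 'k::field) set \<Rightarrow> bool" where
  "algebraic_set n Z \<longleftrightarrow> (\<exists>S\<subseteq>poly_funs n. Z = {x \<in> {..<n} \<rightarrow>\<^sub>E UNIV. \<forall>p\<in>S. p x = 0})"

text \<open>Affine, but possibly reducible.\<close>

definition affine_fspace :: "('a, 'k::field) fspace \<Rightarrow> bool" where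
  "affine_fspace X \<longleftrightarrow>
     function_sheaf X \<and>
     (\<exists>n Z \<phi>. algebraic_set n Z \<and> isomorphism X (zariski_fspace Z (poly_funs n)) \<phi>)"

definition irreducible_in :: "'a topology \<Rightarrow> 'a set \<Rightarrow> bool" where
  "irreducible_in T S \<longleftrightarrow>
     S \<subseteq> topspace T \<and> S \<noteq> {} \<and>
     (\<forall>A B. closedin T A \<longrightarrow> closedin T B \<longrightarrow> S \<subseteq> A \<union> B \<longrightarrow> S \<subseteq> A \<or> S \<subseteq> B)"

definition affine_variety :: "('a, 'k::field) fspace \<Rightarrow> bool" where
  "affine_variety X \<longleftrightarrow> affine_fspace X \<and> irreducible_in (Top X) (points X)"


section \<open>Products and algebraic varieties\<close>

definition tensor_funs ::
    "('a, 'k::field) fspace \<Rightarrow> ('b, 'k) fspace \<Rightarrow> 'a set \<Rightarrow> 'b set \<Rightarrow> ('a \<times> 'b \<Rightarrow> 'k) set" where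
  "tensor_funs X Y U V =
     {(\<lambda>(x, y). \<Sum>i<m. a i x * b i y) |m a b. \<forall>i<(m::nat). a i \<in> Reg X U \<and> b i \<in> Reg Y V}"

text \<open>
  The product of varieties: a basis of its topology is given by the loci in \<open>U \<times> V\<close>,
  with \<open>U\<close> and \<open>V\<close> open, where some \<open>g \<in> \<O>(U) \<otimes> \<O>(V)\<close> does not vanish, and
  regular functions are locally of the form \<open>f / g\<close> with \<open>f, g \<in> \<O>(U) \<otimes> \<O>(V)\<close>.
  This is finer than the product topology.
\<close>

definition prod_open ::
    "('a, 'k::field) fspace \<Rightarrow> ('b, 'k) fspace \<Rightarrow> ('a \<times> 'b) set \<Rightarrow> bool" where
  "prod_open X Y W \<longleftrightarrow>
     (\<forall>p\<in>W. \<exists>U V g. openin (Top X) U \<and> openin (Top Y) V \<and> g \<in> tensor_funs X Y U V \<and>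
        p \<in> nonvanishing (U \<times> V) g \<and> nonvanishing (U \<times> V) g \<subseteq> W)"

definition prod_fspace ::
    "('a, 'k::field) fspace \<Rightarrow> ('b, 'k) fspace \<Rightarrow> ('a \<times> 'b, 'k) fspace" where
  "prod_fspace X Y =
     \<lparr>Top = topology (prod_open X Y),
      Reg = (\<lambda>W. {h. \<forall>p\<in>W. \<exists>U V f g. openin (Top X) U \<and> openin (Top Y) V \<and>
               f \<in> tensor_funs X Y U V \<and> g \<in> tensor_funs X Y U V \<and>
               p \<in> nonvanishing (U \<times> V) g \<and> nonvanishing (U \<times> V) g \<subseteq> W \<and>
               (\<forall>q\<in>nonvanishing (U \<times> V) g. h q = f q / g q)})\<rparr>"

text \<open>
  Varieties in the general sense: separated, quasi-compact, not necessarily irreducible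
  (an algebraic group need be neither affine nor connected).
\<close>

definition algebraic_variety :: "('a, 'k::field) fspace \<Rightarrow> bool" where
  "algebraic_variety X \<longleftrightarrow>
     function_sheaf X \<and>
     (\<exists>\<U>. finite \<U> \<and> \<Union>\<U> = points X \<and>
        (\<forall>U\<in>\<U>. openin (Top X) U \<and> affine_fspace (open_subspace X U))) \<and>
     closedin (Top (prod_fspace X X)) {(x, x) |x. x \<in> points X}"

lemma tensor_funs_mult:
  assumes X: "function_sheaf X" and Y: "function_sheaf Y"
    and U: "openin (Top X) U" "openin (Top X) U'" and V: "openin (Top Y) V" "openin (Top Y) V'"
    and f: "f \<in> tensor_funs X Y U V" and g: "g \<in> tensor_funs X Y U' V'"
  shows "(\<lambda>q. f q * g q) \<in> tensor_funs X Y (U \<inter> U') (V \<inter> V')"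
proof -
  obtain m :: nat and a b where f': "f = (\<lambda>(x, y). \<Sum>i<m. a i x * b i y)"
    and ab: "\<forall>i<m. a i \<in> Reg X U \<and> b i \<in> Reg Y V"
    using f unfolding tensor_funs_def by blast
  obtain n :: nat and c d where g': "g = (\<lambda>(x, y). \<Sum>i<n. c i x * d i y)"
    and cd: "\<forall>i<n. c i \<in> Reg X U' \<and> d i \<in> Reg Y V'"
    using g unfolding tensor_funs_def by blast
  define A where "A k = (\<lambda>x. a (k div n) x * c (k mod n) x)" for k
  define B where "B k = (\<lambda>y. b (k div n) y * d (k mod n) y)" for k
  have "(\<Sum>i<m. a i x * b i y) * (\<Sum>j<n. c j x * d j y) = (\<Sum>k<m * n. A k x * B k y)" for x y
  proof -
    have "(\<Sum>i<m. a i x * b i y) * (\<Sum>j<n. c j x * d j y)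
        = (\<Sum>i<m. \<Sum>j<n. (a i x * b i y) * (c j x * d j y))"
      by (simp add: sum_product)
    also have "\<dots> = (\<Sum>i<m. \<Sum>j<n. A (j + i * n) x * B (j + i * n) y)"
      by (intro sum.cong refl) (auto simp: A_def B_def mult_ac)
    also have "\<dots> = (\<Sum>i<m. \<Sum>k\<in>{i * n..<i * n + n}. A k x * B k y)"
    proof (rule sum.cong[OF refl])
      fix i
      show "(\<Sum>j<n. A (j + i * n) x * B (j + i * n) y) = (\<Sum>k\<in>{i * n..<i * n + n}. A k x * B k y)"
        using sum.shift_bounds_nat_ivl[of "\<lambda>k. A k x * B k y" 0 "i * n" n]
        by (simp only: lessThan_atLeast0 add.commute[of "i * n" n] add_0)
    qed
    also have "\<dots> = (\<Sum>k<m * n. A k x * B k y)"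
      by (rule sum.nat_group)
    finally show ?thesis .
  qed
  then have "(\<lambda>q. f q * g q) = (\<lambda>(x, y). \<Sum>k<m * n. A k x * B k y)"
    by (auto simp: f' g')
  moreover have "A k \<in> Reg X (U \<inter> U') \<and> B k \<in> Reg Y (V \<inter> V')" if "k < m * n" for k
  proof -
    have k: "k div n < m" "k mod n < n"
      using that by (cases "n = 0"; simp add: less_mult_imp_div_less)+
    have "openin (Top X) (U \<inter> U')" "openin (Top Y) (V \<inter> V')" using U V by auto
    moreover have "a (k div n) \<in> Reg X (U \<inter> U')" "c (k mod n) \<in> Reg X (U \<inter> U')"
      using function_sheaf_restrict[OF X U(1) U(2)] function_sheaf_restrict[OF X U(2) U(1)] ab cd k
      by auto
    moreover have "b (k div n) \<in> Reg Y (V \<inter> V')" "d (k mod n) \<in> Reg Y (V \<inter> V')"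
      using function_sheaf_restrict[OF Y V(1) V(2)] function_sheaf_restrict[OF Y V(2) V(1)] ab cd k
      by auto
    ultimately show ?thesis
      unfolding A_def B_def by (intro conjI function_sheaf_mult[OF X] function_sheaf_mult[OF Y])
  qed
  ultimately show ?thesis unfolding tensor_funs_def by blast
qed

lemma istopology_prod_open:
  assumes X: "function_sheaf X" and Y: "function_sheaf Y"
  shows "istopology (prod_open X Y)"
  unfolding istopology_def
proof (intro conjI allI impI)
  fix W W' assume W: "prod_open X Y W" "prod_open X Y W'"
  show "prod_open X Y (W \<inter> W')"
    unfolding prod_open_def
  proof
    fix p assume "p \<in> W \<inter> W'"
    then have p: "p \<in> W" "p \<in> W'" by auto
    from bspec[OF W(1)[unfolded prod_open_def] p(1)] obtain U V g where
      1: "openin (Top X) U" "openin (Top Y) V" "g \<in> tensor_funs X Y U V"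
         "p \<in> nonvanishing (U \<times> V) g" "nonvanishing (U \<times> V) g \<subseteq> W"
      by (elim exE conjE)
    from bspec[OF W(2)[unfolded prod_open_def] p(2)] obtain U' V' g' where
      2: "openin (Top X) U'" "openin (Top Y) V'" "g' \<in> tensor_funs X Y U' V'"
         "p \<in> nonvanishing (U' \<times> V') g'" "nonvanishing (U' \<times> V') g' \<subseteq> W'"
      by (elim exE conjE)
    let ?h = "\<lambda>q. g q * g' q"
    have "nonvanishing ((U \<inter> U') \<times> (V \<inter> V')) ?h
        = nonvanishing (U \<times> V) g \<inter> nonvanishing (U' \<times> V') g'"
      unfolding nonvanishing_def by auto
    moreover have "?h \<in> tensor_funs X Y (U \<inter> U') (V \<inter> V')"
      using tensor_funs_mult[OF X Y 1(1) 2(1) 1(2) 2(2) 1(3) 2(3)] .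
    ultimately show "\<exists>U V g. openin (Top X) U \<and> openin (Top Y) V \<and> g \<in> tensor_funs X Y U V \<and>
        p \<in> nonvanishing (U \<times> V) g \<and> nonvanishing (U \<times> V) g \<subseteq> W \<inter> W'"
      using 1 2 by (intro exI[of _ "U \<inter> U'"] exI[of _ "V \<inter> V'"] exI[of _ ?h]) auto
  qed
next
  fix \<W> assume "\<forall>W\<in>\<W>. prod_open X Y W"
  note \<W> = bspec[OF this, unfolded prod_open_def, rule_format]
  show "prod_open X Y (\<Union>\<W>)"
    unfolding prod_open_def
  proof
    fix p assume "p \<in> \<Union>\<W>"
    then obtain W where W: "W \<in> \<W>" "p \<in> W" by blast
    from \<W>[OF W] obtain U V g where
      "openin (Top X) U" "openin (Top Y) V" "g \<in> tensor_funs X Y U V"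
      "p \<in> nonvanishing (U \<times> V) g" "nonvanishing (U \<times> V) g \<subseteq> W"
      by (elim exE conjE)
    moreover from this W have "nonvanishing (U \<times> V) g \<subseteq> \<Union>\<W>" by blast
    ultimately show "\<exists>U V g. openin (Top X) U \<and> openin (Top Y) V \<and> g \<in> tensor_funs X Y U V \<and>
        p \<in> nonvanishing (U \<times> V) g \<and> nonvanishing (U \<times> V) g \<subseteq> \<Union>\<W>"
      by (intro exI conjI)
  qed
qed


section \<open>Normality, dimension, prime divisors\<close>

text \<open>
  Elements of the function field of an irreducible variety are represented by regular functions
  \<open>h\<close> on nonempty open sets \<open>U\<close>. A variety is normal if every local ring is integrally
  closed in the function field: if \<open>h\<close> satisfies a monic equation with coefficients in the
  local ring at \<open>x\<close>, then \<open>h\<close> lies in the local ring at \<open>x\<close>. By irreducibility,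
  identities in the function field can be checked on any nonempty open set.
\<close>

definition normal_at :: "('a, 'k::field) fspace \<Rightarrow> 'a \<Rightarrow> bool" where
  "normal_at X x \<longleftrightarrow>
     (\<forall>U h V n a. openin (Top X) U \<longrightarrow> U \<noteq> {} \<longrightarrow> h \<in> Reg X U \<longrightarrow>
        openin (Top X) V \<longrightarrow> x \<in> V \<longrightarrow> (\<forall>i<(n::nat). a i \<in> Reg X V) \<longrightarrow>
        (\<forall>y\<in>U \<inter> V. h y ^ n + (\<Sum>i<n. a i y * h y ^ i) = 0) \<longrightarrow>
        (\<exists>W H. openin (Top X) W \<and> x \<in> W \<and> H \<in> Reg X W \<and> (\<forall>y\<in>U \<inter> W. H y = h y)))"

definition normal_variety :: "('a, 'k::field) fspace \<Rightarrow> bool" where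
  "normal_variety X \<longleftrightarrow> (\<forall>x\<in>points X. normal_at X x)"

definition irreducible_closed_chain :: "'a topology \<Rightarrow> nat \<Rightarrow> (nat \<Rightarrow> 'a set) \<Rightarrow> bool" where
  "irreducible_closed_chain T n C \<longleftrightarrow>
     (\<forall>i\<le>n. closedin T (C i) \<and> irreducible_in T (C i)) \<and> (\<forall>i<n. C i \<subset> C (Suc i))"

definition dimension :: "('a, 'k) fspace \<Rightarrow> enat" where
  "dimension X = Sup {enat n |n C. irreducible_closed_chain (Top X) n C}"

definition codimension :: "('a, 'k) fspace \<Rightarrow> 'a set \<Rightarrow> enat" where
  "codimension X D = Sup {enat n |n C. irreducible_closed_chain (Top X) n C \<and> C 0 = D}"

definition prime_divisor :: "('a, 'k) fspace \<Rightarrow> 'a set \<Rightarrow> bool" where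
  "prime_divisor X D \<longleftrightarrow>
     closedin (Top X) D \<and> irreducible_in (Top X) D \<and> codimension X D = 1"


section \<open>Algebraic groups and regular actions\<close>

definition algebraic_group :: "'g monoid \<Rightarrow> ('g, 'k::field) fspace \<Rightarrow> bool" where
  "algebraic_group G V \<longleftrightarrow>
     group G \<and> algebraic_variety V \<and> points V = carrier G \<and>
     morphism (prod_fspace V V) V (\<lambda>(g, h). g \<otimes>\<^bsub>G\<^esub> h) \<and>
     morphism V V (\<lambda>g. inv\<^bsub>G\<^esub> g)"

definition regular_action ::
    "'g monoid \<Rightarrow> ('g, 'k::field) fspace \<Rightarrow> ('a, 'k) fspace \<Rightarrow> ('g \<Rightarrow> 'a \<Rightarrow> 'a) \<Rightarrow> bool" where
  "regular_action G V X \<phi> \<longleftrightarrow>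
     group_action G (points X) \<phi> \<and> morphism (prod_fspace V X) X (\<lambda>(g, x). \<phi> g x)"

definition Ga_group :: "'k::field monoid" where
  "Ga_group = \<lparr>carrier = UNIV, monoid.mult = (+), one = 0\<rparr>"

definition Ga_variety :: "('k, 'k::field) fspace" where
  "Ga_variety = zariski_fspace UNIV (range poly)"

definition Gm_group :: "'k::field monoid" where
  "Gm_group = \<lparr>carrier = UNIV - {0}, monoid.mult = (*), one = 1\<rparr>"

text \<open>
  The punctured line as an open subset of the affine line; fractions of polynomials whose
  denominator does not vanish on it include the powers of \<open>1 / t\<close>.
\<close>

definition Gm_variety :: "('k, 'k::field) fspace" where
  "Gm_variety = zariski_fspace (UNIV - {0}) (range poly)"

definition rigid :: "('a, 'k::field) fspace \<Rightarrow> bool" where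
  "rigid X \<longleftrightarrow>
     \<not> (\<exists>\<phi>. regular_action Ga_group Ga_variety X \<phi> \<and> (\<exists>s. \<exists>x\<in>points X. \<phi> s x \<noteq> x))"

definition Aut_group :: "('a, 'k) fspace \<Rightarrow> ('a \<Rightarrow> 'a) monoid" where
  "Aut_group X = BijGroup (points X) \<lparr>carrier := {\<phi> \<in> Bij (points X). isomorphism X X \<phi>}\<rparr>"

definition Aut_is_algebraic_group :: "('a, 'k::field) fspace \<Rightarrow> bool" where
  "Aut_is_algebraic_group X \<longleftrightarrow>
     (\<exists>V. algebraic_group (Aut_group X) V \<and> morphism (prod_fspace V X) X (\<lambda>(\<phi>, x). \<phi> x))"

end

theory Submission
  imports Defs "HOL-Library.Function_Algebras"
begin

text \<open>
  The action of the torus grades the coordinate ring \<open>A\<close> of \<open>X\<close>: a function \<open>f\<close> has weight \<open>k\<close> if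
  \<open>f (t x) = t\<^sup>k f x\<close>. Write \<open>A\<^sub>k\<close> for the functions of weight \<open>k\<close>. At a fixed point the two sides of
  this equation can only agree for all \<open>t\<close> if \<open>k = 0\<close> or \<open>f x = 0\<close>, so every function of nonzero
  weight lies in the prime ideal \<open>P\<close> of \<open>D\<close>.

  \<^emph>\<open>All weights have the same sign.\<close> As \<open>D\<close> has codimension one, any two nonzero elements of \<open>P\<close> divide
  powers of each other after localisation at \<open>P\<close>. Suppose that a nonzero \<open>u\<close> of weight zero lies in
  \<open>P\<close>. A function of large positive weight is a combination of monomials, each of which contains a high
  power of a generator of positive weight; hence it becomes divisible by \<open>u\<close> once it is multiplied by a
  suitable \<open>v\<close> of weight zero outside \<open>P\<close>. The quotient has the same weight, so the step can be repeated:
  a function \<open>f\<close> of large weight is divisible by every power of \<open>u\<close> in the localisation, while some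
  power of \<open>u\<close> is divisible by \<open>f\<close>. This is absurd (\<open>weight_zero_meets_ideal\<close>), so no nonzero function of
  weight zero vanishes on \<open>D\<close>. Functions of opposite weights have powers whose product has weight zero and
  vanishes on \<open>D\<close>; so weights of both signs do not occur (\<open>negative_weight_vanishes\<close>). After replacing \<open>t\<close> by its
  inverse, all weights are nonnegative.

  \<^emph>\<open>The shape of the grading.\<close> Let \<open>K\<close> be the field of fractions of \<open>A\<^sub>0\<close>. For \<open>f, g\<close> of the same positive
  weight, the functions \<open>g\<^sup>l\<^sup>+\<^sup>q / f\<^sup>l\<close> with \<open>q\<close> fixed are regular up to factors of weight zero, and they have the same
  weight; so they lie in a space of finite dimension over \<open>K\<close>. Hence \<open>g / f\<close> is algebraic over \<open>K\<close>, and normality of \<open>X\<close> puts it into \<open>K\<close> (\<open>same_weight_proportional\<close>). Normality also yields a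
  function \<open>z\<close> whose weight \<open>d\<close> is the greatest common divisor of all weights. Therefore \<open>A \<subseteq> K[z]\<close>, and
  there is a nonzero \<open>a\<close> of weight zero such that \<open>a h\<close> is a multiple of \<open>z\<close> for all \<open>h\<close> of positive weight
  (\<open>slice\<close>).

  \<^emph>\<open>The additive group.\<close> The derivation \<open>a \<cdot> d/dz\<close> maps \<open>A\<close> to itself and is locally nilpotent. Its exponential
  is an action of the additive group; at general points it moves \<open>x\<close> along its torus orbit, to
  \<open>\<tau> x\<close> with \<open>\<tau>\<^sup>d = 1 + s a(x) / z(x)\<close>. It adds \<open>s a\<close> to the function \<open>z\<close>, so it is not trivial, and \<open>X\<close> is
  not rigid.

  \<^emph>\<open>The automorphism group.\<close> Under an algebraic group of automorphisms the translates of \<open>z\<close> lie in a space of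
  finite dimension. But \<open>a\<close> may be replaced by \<open>a b\<^sup>k\<close> for any \<open>b\<close> of weight zero, so all functions
  \<open>z + a b\<^sup>k\<close> are translates of \<open>z\<close>, and these are linearly independent unless \<open>b\<close> is constant. If all
  functions of weight zero are constant, then \<open>A\<close> is the polynomial ring in \<open>z\<close> and \<open>X\<close> has dimension at most
  one.

  The Nullstellensatz translates between ideals and points: it turns the codimension of \<open>D\<close> into divisibility,
  and it shows that functions which are locally fractions are globally polynomials, on \<open>X\<close> and on products.
\<close>

section \<open>The Nullstellensatz\<close>

definition subring_set :: "'r::comm_ring_1 set \<Rightarrow> bool" where
  "subring_set B \<longleftrightarrow> 1 \<in> B \<and> (\<forall>a\<in>B. \<forall>b\<in>B. a - b \<in> B \<and> a * b \<in> B)"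

definition ideal_of :: "'r::comm_ring_1 set \<Rightarrow> 'r set \<Rightarrow> bool" where
  "ideal_of R J \<longleftrightarrow> J \<subseteq> R \<and> 0 \<in> J \<and> (\<forall>a\<in>J. \<forall>b\<in>J. a + b \<in> J) \<and> (\<forall>r\<in>R. \<forall>a\<in>J. r * a \<in> J)"

definition prime_ideal_of :: "'r::comm_ring_1 set \<Rightarrow> 'r set \<Rightarrow> bool" where
  "prime_ideal_of R Q \<longleftrightarrow> ideal_of R Q \<and> 1 \<notin> Q \<and> (\<forall>a\<in>R. \<forall>b\<in>R. a * b \<in> Q \<longrightarrow> a \<in> Q \<or> b \<in> Q)"

lemma subring_setD:
  assumes "subring_set B"
  shows "1 \<in> B" "0 \<in> B" "a \<in> B \<Longrightarrow> b \<in> B \<Longrightarrow> a - b \<in> B" "a \<in> B \<Longrightarrow> b \<in> B \<Longrightarrow> a * b \<in> B"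
    "a \<in> B \<Longrightarrow> b \<in> B \<Longrightarrow> a + b \<in> B" "a \<in> B \<Longrightarrow> - a \<in> B" "a \<in> B \<Longrightarrow> a ^ k \<in> B"
proof -
  show 1: "1 \<in> B" and m: "a \<in> B \<Longrightarrow> b \<in> B \<Longrightarrow> a - b \<in> B"
    and "a \<in> B \<Longrightarrow> b \<in> B \<Longrightarrow> a * b \<in> B" for a b
    using assms by (auto simp: subring_set_def)
  show 0: "0 \<in> B" using m[OF 1 1] by simp
  show n: "a \<in> B \<Longrightarrow> - a \<in> B" for a using m[OF 0, of a] by simp
  show "a \<in> B \<Longrightarrow> b \<in> B \<Longrightarrow> a + b \<in> B" for a b using m[OF _ n, of a b] by simp
  show "a \<in> B \<Longrightarrow> a ^ k \<in> B"
    using assms 1 by (induction k) (auto simp: subring_set_def)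
qed

lemma ideal_ofD:
  assumes "ideal_of R J" "subring_set R"
  shows "a \<in> J \<Longrightarrow> a \<in> R" "0 \<in> J" "a \<in> J \<Longrightarrow> b \<in> J \<Longrightarrow> a + b \<in> J" "r \<in> R \<Longrightarrow> a \<in> J \<Longrightarrow> r * a \<in> J"
    "a \<in> J \<Longrightarrow> r \<in> R \<Longrightarrow> a * r \<in> J" "a \<in> J \<Longrightarrow> b \<in> J \<Longrightarrow> a - b \<in> J" "a \<in> J \<Longrightarrow> - a \<in> J"
proof -
  show "a \<in> J \<Longrightarrow> a \<in> R" "0 \<in> J" and 2: "a \<in> J \<Longrightarrow> b \<in> J \<Longrightarrow> a + b \<in> J"
    and 3: "r \<in> R \<Longrightarrow> a \<in> J \<Longrightarrow> r * a \<in> J" for a b r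
    using assms(1) by (auto simp: ideal_of_def)
  show "a \<in> J \<Longrightarrow> r \<in> R \<Longrightarrow> a * r \<in> J" using 3[of r a] by (simp add: mult.commute)
  have "-1 \<in> R" by (intro subring_setD(1,6)[OF assms(2)])
  then show 4: "a \<in> J \<Longrightarrow> - a \<in> J" for a using 3[of "-1" a] by simp
  show "a \<in> J \<Longrightarrow> b \<in> J \<Longrightarrow> a - b \<in> J" using 2[OF _ 4, of a b] by simp
qed

text \<open>
  An ideal \<open>Q\<close> that is maximal among the ideals which avoid \<open>S\<close> is prime: if \<open>a\<close> and \<open>b\<close> lie outside \<open>Q\<close>, then
  \<open>Q + R a\<close> and \<open>Q + R b\<close> meet \<open>S\<close>, and the product of the two elements found there would lie in \<open>Q\<close> if \<open>a b\<close> did.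
\<close>

lemma prime_ideal_containing:
  assumes R: "subring_set R" and J: "ideal_of R J" and S: "S \<subseteq> R" "1 \<in> S"
    and mult: "\<And>a b. a \<in> S \<Longrightarrow> b \<in> S \<Longrightarrow> a * b \<in> S" and disj: "J \<inter> S = {}"
  obtains Q where "prime_ideal_of R Q" "J \<subseteq> Q" "Q \<inter> S = {}"
proof -
  let ?\<A> = "{I. ideal_of R I \<and> J \<subseteq> I \<and> I \<inter> S = {}}"
  have "\<exists>Q\<in>?\<A>. \<forall>I\<in>?\<A>. Q \<subseteq> I \<longrightarrow> I = Q"
  proof (rule subset_Zorn_nonempty)
    show "?\<A> \<noteq> {}" using J disj by auto
  next
    fix \<C> assume ne: "\<C> \<noteq> {}" and ch: "subset.chain ?\<A> \<C>"
    have tot: "I \<subseteq> I' \<or> I' \<subseteq> I" if "I \<in> \<C>" "I' \<in> \<C>" for I I'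
      using ch that unfolding subset.chain_def by blast
    have in_A: "I \<in> \<C> \<Longrightarrow> I \<in> ?\<A>" for I using ch by (auto simp: subset.chain_def)
    have "a + b \<in> \<Union>\<C>" if ab: "a \<in> \<Union>\<C>" "b \<in> \<Union>\<C>" for a b
    proof -
      obtain I I' where I: "I \<in> \<C>" "a \<in> I" "I' \<in> \<C>" "b \<in> I'" using ab by auto
      with tot obtain K where "K \<in> \<C>" "a \<in> K" "b \<in> K" by blast
      then show ?thesis using in_A ideal_ofD(3)[OF _ R] by blast
    qed
    moreover have "r * a \<in> \<Union>\<C>" if "r \<in> R" "a \<in> \<Union>\<C>" for a r
      using that in_A ideal_ofD(4)[OF _ R] by blast
    moreover have "\<Union>\<C> \<subseteq> R" "0 \<in> \<Union>\<C>" using ne in_A ideal_ofD(1,2)[OF _ R] by blast+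
    ultimately have "ideal_of R (\<Union>\<C>)" unfolding ideal_of_def by blast
    moreover have "J \<subseteq> \<Union>\<C>" "\<Union>\<C> \<inter> S = {}" using ne in_A by blast+
    ultimately show "\<Union>\<C> \<in> ?\<A>" by blast
  qed
  then obtain Q where Q: "ideal_of R Q" "J \<subseteq> Q" "Q \<inter> S = {}"
    and max: "\<And>I. ideal_of R I \<Longrightarrow> I \<inter> S = {} \<Longrightarrow> Q \<subseteq> I \<Longrightarrow> I = Q" by auto
  note R' = subring_setD[OF R] and Q' = ideal_ofD[OF Q(1) R]
  have meets: "\<exists>q\<in>Q. \<exists>r\<in>R. q + r * a \<in> S" if a: "a \<in> R" "a \<notin> Q" for a
  proof (rule ccontr)
    assume no: "\<not> ?thesis"
    let ?I = "{q + r * a |q r. q \<in> Q \<and> r \<in> R}"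
    have "ideal_of R ?I"
      unfolding ideal_of_def
    proof (intro conjI ballI)
      show "?I \<subseteq> R" using a by (auto intro!: R' intro: Q'(1))
      show "0 \<in> ?I" using R'(2) Q'(2) by (intro CollectI exI[of _ 0]) auto
    next
      fix x y assume "x \<in> ?I" "y \<in> ?I"
      then obtain q r q' r' where "x = q + r * a" "y = q' + r' * a" "q \<in> Q" "r \<in> R" "q' \<in> Q" "r' \<in> R"
        by auto
      then show "x + y \<in> ?I"
        by (intro CollectI exI[of _ "q + q'"] exI[of _ "r + r'"])
          (auto simp: algebra_simps intro: R' Q')
    next
      fix s x assume s: "s \<in> R" and "x \<in> ?I"
      then obtain q r where "x = q + r * a" "q \<in> Q" "r \<in> R" by auto
      then show "s * x \<in> ?I"
        using s by (intro CollectI exI[of _ "s * q"] exI[of _ "s * r"])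
          (auto simp: algebra_simps intro: R' Q')
    qed
    moreover have "?I \<inter> S = {}" using no by auto
    moreover have "Q \<subseteq> ?I"
    proof
      fix q assume "q \<in> Q" then show "q \<in> ?I" using R'(2) by (intro CollectI exI[of _ q] exI[of _ 0]) auto
    qed
    ultimately have "?I = Q" by (rule max)
    moreover have "a \<in> ?I" using R'(1) Q'(2) by (intro CollectI exI[of _ 0] exI[of _ 1]) auto
    ultimately show False using a by simp
  qed
  have "prime_ideal_of R Q"
    unfolding prime_ideal_of_def
  proof (intro conjI ballI impI)
    show "ideal_of R Q" "1 \<notin> Q" using Q S by auto
    fix a b assume ab: "a \<in> R" "b \<in> R" "a * b \<in> Q"
    show "a \<in> Q \<or> b \<in> Q"
    proof (rule ccontr)
      assume "\<not> ?thesis"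
      then obtain q r q' r' where h: "q \<in> Q" "r \<in> R" "q + r * a \<in> S" "q' \<in> Q" "r' \<in> R" "q' + r' * b \<in> S"
        using meets ab by meson
      have "(q + r * a) * (q' + r' * b) = q * (q' + r' * b) + ((r * a) * q' + (r * r') * (a * b))"
        by (simp add: algebra_simps)
      also have "\<dots> \<in> Q"
        by (intro Q'(3) Q'(5)[OF h(1)] Q'(4)[OF _ h(4)] Q'(4)[OF _ ab(3)] R'(4)[OF h(2) ab(1)]
            R'(4)[OF h(2) h(5)] subsetD[OF S(1) h(6)])
      finally show False using mult[OF h(3,6)] Q(3) by auto
    qed
  qed
  then show ?thesis using Q that by blast
qed

definition polys_over :: "'r::comm_ring_1 set \<Rightarrow> 'r poly set" where
  "polys_over B = {f. \<forall>j. coeff f j \<in> B}"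

lemma polys_over_closed:
  assumes B: "subring_set B"
  shows "f \<in> polys_over B \<Longrightarrow> g \<in> polys_over B \<Longrightarrow> f + g \<in> polys_over B"
    and "f \<in> polys_over B \<Longrightarrow> g \<in> polys_over B \<Longrightarrow> f - g \<in> polys_over B"
    and "f \<in> polys_over B \<Longrightarrow> g \<in> polys_over B \<Longrightarrow> f * g \<in> polys_over B"
    and "c \<in> B \<Longrightarrow> monom c k \<in> polys_over B"
    and "c \<in> B \<Longrightarrow> f \<in> polys_over B \<Longrightarrow> smult c f \<in> polys_over B"
    and "c \<in> B \<Longrightarrow> [:c:] \<in> polys_over B"
    and "0 \<in> polys_over B"
    and "f \<in> polys_over B \<Longrightarrow> coeff f j \<in> B"
proof -
  note B' = subring_setD[OF B]
  have s: "(\<And>i. i \<in> S \<Longrightarrow> h i \<in> B) \<Longrightarrow> sum h S \<in> B" for h and S :: "nat set"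
    using B' by (induction S rule: infinite_finite_induct) auto
  show "f \<in> polys_over B \<Longrightarrow> g \<in> polys_over B \<Longrightarrow> f * g \<in> polys_over B"
    using B' by (auto simp: polys_over_def coeff_mult intro!: s)
qed (auto simp: polys_over_def coeff_pCons split: nat.split intro: subring_setD[OF B])

text \<open>
  Long division that multiplies the dividend by the leading coefficient of the divisor instead of dividing by it. The
  bound on the degree of the quotient is part of the claim because leading coefficients may be zero divisors, so
  that degrees cannot be read off the identity.
\<close>

lemma pseudo_division:
  assumes B: "subring_set B" and f: "f \<in> polys_over B" and q: "q \<in> polys_over B"
  shows "\<exists>k s r. s \<in> polys_over B \<and> r \<in> polys_over B \<and> smult (lead_coeff f ^ k) q = f * s + r \<and>
    (r = 0 \<or> degree r < degree f) \<and> (s = 0 \<or> degree s + degree f \<le> degree q)"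
  using q
proof (induction "degree q" arbitrary: q rule: less_induct)
  case less
  note B' = subring_setD[OF B] and C = polys_over_closed[OF B]
  show ?case
  proof (cases "q = 0 \<or> degree q < degree f")
    case True
    then show ?thesis
      using C(7) less.prems by (intro exI[of _ 0] exI[of _ 0] exI[of _ q]) auto
  next
    case False
    let ?d = "degree q - degree f" and ?c = "lead_coeff f"
    let ?m = "monom (lead_coeff q) ?d"
    let ?q = "smult ?c q - f * ?m"
    have m: "?m \<in> polys_over B" by (intro C less.prems)
    have q': "?q \<in> polys_over B"
      by (intro C m f less.prems)
    have le: "degree f + degree ?m \<le> degree q"
      using False degree_monom_le[of "lead_coeff q" ?d] by linarith
    have "degree ?q \<le> degree q"
      by (rule degree_diff_le[OF degree_smult_le]) (rule order.trans[OF degree_mult_le le])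
    moreover have "coeff ?q (degree q) = 0"
    proof -
      have "coeff (?m * f) (degree q) = lead_coeff q * ?c"
        using False by (simp add: coeff_monom_mult)
      then show ?thesis by (simp add: mult.commute)
    qed
    ultimately have lt: "?q = 0 \<or> degree ?q < degree q"
      by (metis leading_coeff_0_iff le_neq_implies_less)
    show ?thesis
    proof (cases "?q = 0")
      case True
      then show ?thesis
        using m C(7) le
        by (intro exI[of _ 1] exI[of _ ?m] exI[of _ 0]) (auto simp: algebra_simps)
    next
      case nz: False
      with lt have lt: "degree ?q < degree q" by simp
      obtain k s r where h: "s \<in> polys_over B" "r \<in> polys_over B" "smult (?c ^ k) ?q = f * s + r"
        "r = 0 \<or> degree r < degree f" "s = 0 \<or> degree s + degree f \<le> degree ?q"
        using less.hyps[OF lt q'] by blast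
      let ?s = "s + smult (?c ^ k) ?m"
      have "degree (smult (?c ^ k) ?m) + degree f \<le> degree q"
        using le degree_smult_le[of "?c ^ k" ?m] by linarith
      then have "?s = 0 \<or> degree ?s + degree f \<le> degree q"
        using h(5) lt degree_add_le_max[of s "smult (?c ^ k) ?m"] by (cases "s = 0") auto
      moreover have "smult (?c ^ Suc k) q = f * ?s + r"
        using h(3) by (simp add: algebra_simps smult_diff_right)
      moreover have "?s \<in> polys_over B"
        by (intro C h m B' f)
      ultimately show ?thesis using h by blast
    qed
  qed
qed


text \<open>
  Elimination of the generator \<open>\<xi>\<close> when it is algebraic over \<open>B\<close> modulo the prime \<open>Q\<close>. Here \<open>f\<close> plays the part
  of the minimal polynomial of \<open>\<xi>\<close>: it has least degree among the polynomials whose value lies in \<open>Q\<close> but whose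
  coefficients do not all lie in \<open>Q\<close>, so division by \<open>f\<close> leaves only remainders with coefficients in \<open>Q\<close>. A minimal
  polynomial is irreducible, hence coprime to \<open>b\<close>, whose value is not in \<open>Q\<close>; \<open>a0\<close> and \<open>v\<close> come from the resulting
  Bezout identity. At a point of \<open>B\<close> where neither the leading coefficient of \<open>f\<close> nor \<open>a0\<close> vanishes, every root of \<open>f\<close>
  is therefore a zero of \<open>Q\<close> at which \<open>b\<close> does not vanish.
\<close>

lemma generic_elimination:
  fixes \<xi> :: "'r::comm_ring_1"
  assumes B: "subring_set B" and R: "subring_set R" and BR: "\<And>g. g \<in> polys_over B \<Longrightarrow> poly g \<xi> \<in> R"
    and Q: "prime_ideal_of R Q" and b: "b \<in> polys_over B" "poly b \<xi> \<notin> Q"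
    and f0: "f0 \<in> polys_over B" "poly f0 \<xi> \<in> Q" "coeff f0 j0 \<notin> Q"
  obtains f a0 v where "f \<in> polys_over B" "poly f \<xi> \<in> Q" "lead_coeff f \<notin> Q" "degree f > 0"
    "\<And>g. g \<in> polys_over B \<Longrightarrow> poly g \<xi> \<in> Q \<Longrightarrow> \<exists>k s r. s \<in> polys_over B \<and> r \<in> polys_over B \<and>
       smult (lead_coeff f ^ k) g = f * s + r \<and> (\<forall>j. coeff r j \<in> Q)"
    "a0 \<in> B" "a0 \<notin> Q" "v \<in> polys_over B" "a0 - poly v \<xi> * poly b \<xi> \<in> Q"
proof -
  note B' = subring_setD[OF B] and R' = subring_setD[OF R] and C = polys_over_closed[OF B]
  have iQ: "ideal_of R Q" and Q1: "1 \<notin> Q"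
    and Qp: "x \<in> R \<Longrightarrow> y \<in> R \<Longrightarrow> x * y \<in> Q \<Longrightarrow> x \<in> Q \<or> y \<in> Q" for x y
    using Q by (auto simp: prime_ideal_of_def)
  note Q' = ideal_ofD[OF iQ R]
  have BinR: "c \<in> R" if "c \<in> B" for c using BR[OF C(6)[OF that]] by simp
  have powQ: "c ^ k \<notin> Q" if "c \<in> R" "c \<notin> Q" for c k
  proof (induction k)
    case (Suc k)
    then show ?case using Qp[OF that(1) R'(7)[OF that(1), of k]] that by auto
  qed (use Q1 in simp)
  have sumQ: "(\<And>i. i \<in> S \<Longrightarrow> g i \<in> Q) \<Longrightarrow> sum g S \<in> Q" for g and S :: "nat set"
    using Q' by (induction S rule: infinite_finite_induct) auto
  define F where "F = {g. g \<in> polys_over B \<and> poly g \<xi> \<in> Q \<and> (\<exists>j. coeff g j \<notin> Q)}"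
  have "f0 \<in> F" using f0 by (auto simp: F_def)
  then obtain f where f: "f \<in> F" and min_f: "\<And>g. g \<in> F \<Longrightarrow> degree f \<le> degree g"
    using ex_has_least_nat[of "\<lambda>g. g \<in> F" f0 degree] by blast
  have fB: "f \<in> polys_over B" "poly f \<xi> \<in> Q" using f by (auto simp: F_def)
  have drop: "\<exists>g'\<in>polys_over B. degree g' < degree g \<and> g = g' + monom (lead_coeff g) (degree g)"
    if "g \<in> polys_over B" "degree g > 0" for g
  proof (intro bexI[of _ "g - monom (lead_coeff g) (degree g)"] conjI)
    show "g - monom (lead_coeff g) (degree g) \<in> polys_over B" by (intro C that)
    have "degree (g - monom (lead_coeff g) (degree g)) \<le> degree g"
      by (intro degree_diff_le degree_monom_le order.refl)
    moreover have "coeff (g - monom (lead_coeff g) (degree g)) (degree g) = 0" by simp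
    ultimately show "degree (g - monom (lead_coeff g) (degree g)) < degree g"
      using that(2) by (metis degree_0 leading_coeff_0_iff le_neq_implies_less)
  qed simp
  have monomQ: "poly (monom c k) \<xi> \<in> Q" if "c \<in> B" "c \<in> Q" for c k
  proof -
    have "poly (monom 1 k) \<xi> \<in> R" by (intro BR C B')
    then show ?thesis using Q'(5)[OF that(2)] by (simp add: poly_monom)
  qed
  have lf: "lead_coeff f \<notin> Q"
  proof
    assume l: "lead_coeff f \<in> Q"
    show False
    proof (cases "degree f = 0")
      case True
      then have "coeff f j \<in> Q" for j using l Q'(2) by (cases "j = 0") (auto simp: coeff_eq_0)
      then show False using f by (auto simp: F_def)
    next
      case False
      then obtain g where g: "g \<in> polys_over B" "degree g < degree f"
        "f = g + monom (lead_coeff f) (degree f)" using drop[OF fB(1)] by auto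
      have "poly g \<xi> = poly f \<xi> - poly (monom (lead_coeff f) (degree f)) \<xi>"
        by (subst g(3)) simp
      then have "poly g \<xi> \<in> Q"
        using Q'(6)[OF fB(2) monomQ[OF C(8)[OF fB(1)] l]] by simp
      moreover have "\<exists>j. coeff g j \<notin> Q"
      proof (rule ccontr)
        assume no: "\<not> ?thesis"
        have "coeff f j \<in> Q" for j
          using no l Q' by (subst g(3)) auto
        then show False using f by (auto simp: F_def)
      qed
      ultimately have "g \<in> F" using g by (auto simp: F_def)
      then show False using min_f g(2) by fastforce
    qed
  qed
  have low: "\<forall>j. coeff r j \<in> Q"
    if "r \<in> polys_over B" "poly r \<xi> \<in> Q" "r = 0 \<or> degree r < degree f" for r
    using that min_f[of r] Q'(2) by (force simp: F_def)
  have dpos: "degree f > 0"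
  proof (rule ccontr)
    assume "\<not> ?thesis"
    then obtain c where "f = [:c:]" by (auto elim: degree_eq_zeroE)
    then show False using fB lf by simp
  qed
  have div: "\<exists>k s r. s \<in> polys_over B \<and> r \<in> polys_over B \<and>
       smult (lead_coeff f ^ k) g = f * s + r \<and> (\<forall>j. coeff r j \<in> Q)"
    if g: "g \<in> polys_over B" "poly g \<xi> \<in> Q" for g
  proof -
    obtain k s r where h: "s \<in> polys_over B" "r \<in> polys_over B" "smult (lead_coeff f ^ k) g = f * s + r"
      "r = 0 \<or> degree r < degree f"
      using pseudo_division[OF B fB(1) g(1)] by blast
    have "poly r \<xi> = poly (smult (lead_coeff f ^ k) g) \<xi> - poly f \<xi> * poly s \<xi>"
      by (simp add: h(3) del: poly_smult)
    then have "poly r \<xi> \<in> Q"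
      using Q'(6)[OF Q'(4)[OF BinR[OF B'(7)[OF C(8)[OF fB(1)]]] g(2)] Q'(5)[OF fB(2) BR[OF h(1)]]]
      by simp
    then show ?thesis using low[OF h(2) _ h(4)] h by blast
  qed
  define T where "T = {h. h \<in> polys_over B \<and> poly h \<xi> \<notin> Q \<and>
     (\<exists>v\<in>polys_over B. poly h \<xi> - poly v \<xi> * poly b \<xi> \<in> Q)}"
  have "b \<in> T" using b Q'(2) C(6)[OF B'(1)] by (auto simp: T_def intro!: bexI[of _ "[:1:]"])
  then obtain h where hT: "h \<in> T" and min_h: "\<And>g. g \<in> T \<Longrightarrow> degree h \<le> degree g"
    using ex_has_least_nat[of "\<lambda>g. g \<in> T" b degree] by blast
  then obtain v where h: "h \<in> polys_over B" "poly h \<xi> \<notin> Q" "v \<in> polys_over B"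
    "poly h \<xi> - poly v \<xi> * poly b \<xi> \<in> Q" by (auto simp: T_def)
  have T_mod: "r \<in> T" if "r \<in> polys_over B" "poly r \<xi> \<notin> Q" "w \<in> polys_over B"
    "poly r \<xi> - poly w \<xi> * poly h \<xi> \<in> Q" for r w
  proof -
    have "poly r \<xi> - poly (w * v) \<xi> * poly b \<xi> = (poly r \<xi> - poly w \<xi> * poly h \<xi>)
        + poly w \<xi> * (poly h \<xi> - poly v \<xi> * poly b \<xi>)" by (simp add: algebra_simps)
    also have "\<dots> \<in> Q" by (intro Q'(3) that Q'(4)[OF BR[OF that(3)] h(4)])
    finally show ?thesis using that(1,2) C(3)[OF that(3) h(3)] unfolding T_def by blast
  qed
  \<comment> \<open>\<open>h\<close> is a combination of \<open>b\<close> and elements of \<open>Q\<close> of least degree, as in the Euclidean algorithm. If its degree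
      were positive, it would divide \<open>f\<close> up to a constant, with a quotient of smaller degree than \<open>f\<close> and value in \<open>Q\<close>.\<close>
  have deg_h: "degree h = 0"
  proof (rule ccontr)
    assume pos: "degree h \<noteq> 0"
    have lh: "lead_coeff h \<notin> Q"
    proof
      assume l: "lead_coeff h \<in> Q"
      obtain g where g: "g \<in> polys_over B" "degree g < degree h"
        "h = g + monom (lead_coeff h) (degree h)" using drop[OF h(1)] pos by auto
      have e: "poly h \<xi> - poly g \<xi> = poly (monom (lead_coeff h) (degree h)) \<xi>"
        by (subst g(3)) simp
      have m: "poly (monom (lead_coeff h) (degree h)) \<xi> \<in> Q" by (rule monomQ[OF C(8)[OF h(1)] l])
      have "poly g \<xi> \<notin> Q"
        using Q'(3)[OF m, of "poly g \<xi>"] h(2) unfolding e[symmetric] by auto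
      moreover have "poly g \<xi> - poly [:1:] \<xi> * poly h \<xi> \<in> Q"
        using Q'(7)[OF m] unfolding e[symmetric] by simp
      ultimately have "g \<in> T" by (intro T_mod[OF g(1) _ C(6)[OF B'(1)]])
      then show False using min_h g(2) by fastforce
    qed
    have lt: "degree h < degree f"
    proof -
      obtain k s r where d: "s \<in> polys_over B" "r \<in> polys_over B" "smult (lead_coeff f ^ k) h = f * s + r"
        "r = 0 \<or> degree r < degree f"
        using pseudo_division[OF B fB(1) h(1)] by blast
      let ?c = "lead_coeff f ^ k"
      have c: "?c \<in> B" by (intro B' C fB)
      have "poly (smult ?c h) \<xi> = poly (f * s + r) \<xi>" by (simp only: d(3))
      then have e: "?c * poly h \<xi> - poly r \<xi> = poly f \<xi> * poly s \<xi>" by simp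
      have m: "poly f \<xi> * poly s \<xi> \<in> Q" by (intro Q'(5) fB BR d)
      have "?c * poly h \<xi> \<notin> Q"
        using Qp[OF BinR[OF c] BR[OF h(1)]] powQ[OF BinR[OF C(8)[OF fB(1)]] lf] h(2) by blast
      then have nr: "poly r \<xi> \<notin> Q"
        using Q'(3)[OF m, of "poly r \<xi>"] unfolding e[symmetric] by auto
      moreover have "poly r \<xi> - poly [:?c:] \<xi> * poly h \<xi> \<in> Q"
        using Q'(7)[OF m] unfolding e[symmetric] by simp
      ultimately have "r \<in> T" by (intro T_mod[OF d(2) _ C(6)[OF c]])
      moreover have "r \<noteq> 0" using nr Q'(2) by auto
      ultimately show ?thesis using min_h d(4) by fastforce
    qed
    obtain k s r where d: "s \<in> polys_over B" "r \<in> polys_over B" "smult (lead_coeff h ^ k) f = h * s + r"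
      "r = 0 \<or> degree r < degree h" "s = 0 \<or> degree s + degree h \<le> degree f"
      using pseudo_division[OF B h(1) fB(1)] by blast
    let ?c = "lead_coeff h ^ k"
    have c: "?c \<in> B" by (intro B' C h)
    have "poly (smult ?c f) \<xi> = poly (h * s + r) \<xi>" by (simp only: d(3))
    then have e: "?c * poly f \<xi> = poly r \<xi> + poly s \<xi> * poly h \<xi>" by (simp add: algebra_simps)
    have m: "?c * poly f \<xi> \<in> Q" by (intro Q'(4) fB BinR c)
    have rQ: "poly r \<xi> \<in> Q"
    proof (rule ccontr)
      assume nr: "poly r \<xi> \<notin> Q"
      have "poly r \<xi> - poly (- s) \<xi> * poly h \<xi> \<in> Q" using m unfolding e by simp
      moreover have "- s \<in> polys_over B" using C(2)[OF C(7) d(1)] by simp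
      ultimately have "r \<in> T" using T_mod[OF d(2) nr] by blast
      moreover have "r \<noteq> 0" using nr Q'(2) by auto
      ultimately show False using min_h d(4) by fastforce
    qed
    have "poly s \<xi> * poly h \<xi> = ?c * poly f \<xi> - poly r \<xi>" by (simp add: e)
    then have "poly s \<xi> * poly h \<xi> \<in> Q" using Q'(6)[OF m rQ] by simp
    then have sQ: "poly s \<xi> \<in> Q" using Qp[OF BR[OF d(1)] BR[OF h(1)]] h(2) by blast
    have "\<forall>j. coeff s j \<in> Q" by (rule low[OF d(1) sQ]) (use d(5) pos in auto)
    then have "coeff (h * s) j \<in> Q" for j
      unfolding coeff_mult by (intro sumQ Q'(4)) (auto intro: BinR C h)
    moreover have "\<forall>j. coeff r j \<in> Q" by (rule low[OF d(2) rQ]) (use d(4) lt in auto)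
    ultimately have "coeff (smult ?c f) (degree f) \<in> Q" unfolding d(3) using Q'(3) by auto
    then show False
      using Qp[OF BinR[OF c] BinR[OF C(8)[OF fB(1)]]] powQ[OF BinR[OF C(8)[OF h(1)]] lh] lf by auto
  qed
  then obtain a0 where a0: "h = [:a0:]" by (auto elim: degree_eq_zeroE)
  have "a0 \<in> B" using C(8)[OF h(1), of 0] a0 by simp
  then show ?thesis
    using that[OF fB lf dpos div] h a0 by simp
qed

lemma subring_poly_funs: "subring_set (poly_funs n :: ((nat \<Rightarrow> 'k::field) \<Rightarrow> 'k) set)"
  unfolding subring_set_def
proof (intro conjI ballI)
  show "1 \<in> (poly_funs n :: ((nat \<Rightarrow> 'k) \<Rightarrow> 'k) set)" using poly_funs.const[of 1 n] by (simp add: one_fun_def)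
  fix p q :: "(nat \<Rightarrow> 'k) \<Rightarrow> 'k" assume pq: "p \<in> poly_funs n" "q \<in> poly_funs n"
  have "(\<lambda>x. p x + (- 1) * q x) \<in> poly_funs n" by (intro poly_funs.intros pq)
  then show "p - q \<in> poly_funs n" by (simp add: fun_diff_def)
  show "p * q \<in> poly_funs n" using poly_funs.mult[OF pq] by (simp add: times_fun_def)
qed

text \<open>
  The polynomials \<open>q\<close> that clear the denominator of \<open>f / g\<close>. A function is shown to be polynomial by
  finding enough elements in such an ideal and applying the Nullstellensatz to it.
\<close>

lemma ideal_of_denominators:
  fixes e :: "'i \<Rightarrow> nat \<Rightarrow> 'k::field"
  shows "ideal_of (poly_funs n) {q \<in> poly_funs n. \<exists>w\<in>poly_funs n. \<forall>i\<in>I. q (e i) * f i = w (e i) * g i}"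
    (is "ideal_of ?P ?J")
  unfolding ideal_of_def
proof (intro conjI ballI)
  note P = subring_setD[OF subring_poly_funs[of n, where 'k = 'k]]
  show "?J \<subseteq> ?P" by auto
  show "0 \<in> ?J" using P(2) by (intro CollectI conjI bexI[of _ 0]) auto
next
  note P = subring_setD[OF subring_poly_funs[of n, where 'k = 'k]]
  fix q q' assume "q \<in> ?J" "q' \<in> ?J"
  then obtain w w' where h: "q \<in> ?P" "w \<in> ?P" "q' \<in> ?P" "w' \<in> ?P"
    "\<forall>i\<in>I. q (e i) * f i = w (e i) * g i" "\<forall>i\<in>I. q' (e i) * f i = w' (e i) * g i" by blast
  show "q + q' \<in> ?J"
    by (intro CollectI conjI bexI[of _ "w + w'"] P h) (use h(5,6) in \<open>auto simp: algebra_simps\<close>)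
next
  note P = subring_setD[OF subring_poly_funs[of n, where 'k = 'k]]
  fix r q :: "(nat \<Rightarrow> 'k) \<Rightarrow> 'k" assume r: "r \<in> ?P" and "q \<in> ?J"
  then obtain w where h: "q \<in> ?P" "w \<in> ?P" "\<forall>i\<in>I. q (e i) * f i = w (e i) * g i" by blast
  show "r * q \<in> ?J"
    by (intro CollectI conjI bexI[of _ "r * w"] P h r) (use h(3) in \<open>auto simp: mult.assoc\<close>)
qed

lemma poly_funs_depends:
  "p \<in> poly_funs n \<Longrightarrow> (\<And>i. i < n \<Longrightarrow> x i = y i) \<Longrightarrow> p x = p y"
  by (induction rule: poly_funs.induct) auto

lemma poly_funs_substitute:
  "p \<in> poly_funs n \<Longrightarrow> (\<And>i. i < n \<Longrightarrow> s i \<in> poly_funs m) \<Longrightarrow> (\<lambda>w. p (\<lambda>i. s i w)) \<in> poly_funs m"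
  by (induction rule: poly_funs.induct) (auto intro: poly_funs.intros)

lemma poly_funs_mono: "p \<in> poly_funs n \<Longrightarrow> n \<le> m \<Longrightarrow> p \<in> poly_funs m"
  by (induction rule: poly_funs.induct) (auto intro: poly_funs.intros)

lemma sum_fun_apply: "sum f S w = (\<Sum>i\<in>S. f i w)" for f :: "'i \<Rightarrow> 'a \<Rightarrow> 'b::comm_monoid_add"
  by (induction S rule: infinite_finite_induct) (auto simp: plus_fun_def zero_fun_def)

lemma power_fun_apply: "(f ^ k) w = f w ^ k" for f :: "'a \<Rightarrow> 'b::comm_semiring_1"
  by (induction k) (auto simp: times_fun_def one_fun_def)

lemma poly_fun_apply:
  fixes g :: "('a \<Rightarrow> 'k::comm_ring_1) poly"
  shows "poly g \<xi> w = (\<Sum>j\<le>degree g. coeff g j w * \<xi> w ^ j)"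
  by (simp add: poly_altdef sum_fun_apply times_fun_def power_fun_apply)

lemma poly_funs_Suc_as_poly:
  assumes "p \<in> poly_funs (Suc n)"
  shows "\<exists>g \<in> polys_over (poly_funs n). p = poly g (\<lambda>x. x n)"
  using assms
proof (induction rule: poly_funs.induct)
  note C = polys_over_closed[OF subring_poly_funs]
  {
    case (const c)
    show ?case by (intro bexI[of _ "[:\<lambda>_. c:]"] C poly_funs.const) (simp add: fun_eq_iff zero_fun_def)
  next
    case (coord i)
    show ?case
    proof (cases "i = n")
      case True
      show ?thesis
        by (intro bexI[of _ "monom 1 1"] C subring_setD[OF subring_poly_funs]) (simp add: True poly_monom)
    next
      case False
      then show ?thesis using coord
        by (intro bexI[of _ "[:\<lambda>x. x i:]"] C poly_funs.coord) (auto simp: fun_eq_iff zero_fun_def)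
    qed
  next
    case (add p q)
    then obtain g h where "g \<in> polys_over (poly_funs n)" "p = poly g (\<lambda>x. x n)"
      "h \<in> polys_over (poly_funs n)" "q = poly h (\<lambda>x. x n)" by blast
    then show ?case by (intro bexI[of _ "g + h"] C) (auto simp: plus_fun_def)
  next
    case (mult p q)
    then obtain g h where "g \<in> polys_over (poly_funs n)" "p = poly g (\<lambda>x. x n)"
      "h \<in> polys_over (poly_funs n)" "q = poly h (\<lambda>x. x n)" by blast
    then show ?case by (intro bexI[of _ "g * h"] C) (auto simp: times_fun_def)
  }
qed

lemma poly_as_poly_funs:
  assumes "g \<in> polys_over (poly_funs n)"
  shows "poly g (\<lambda>x. x n) \<in> poly_funs (Suc n)"
proof -
  note R = subring_setD[OF subring_poly_funs[of "Suc n"]]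
  have c: "coeff g j \<in> poly_funs (Suc n)" for j
    using assms by (auto simp: polys_over_def intro: poly_funs_mono)
  have x: "(\<lambda>x. x n) \<in> poly_funs (Suc n)" by (simp add: poly_funs.coord)
  have "(\<Sum>j\<in>S. coeff g j * (\<lambda>x. x n) ^ j) \<in> poly_funs (Suc n)" if "finite S" for S
    using that
  proof (induction S rule: finite_induct)
    case empty
    show ?case by (simp only: sum.empty R(2))
  next
    case (insert j S)
    have "coeff g j * (\<lambda>x. x n) ^ j \<in> poly_funs (Suc n)" by (intro R c x)
    then show ?case unfolding sum.insert[OF insert.hyps] by (rule R(5)[OF _ insert.IH])
  qed
  then show ?thesis by (simp add: poly_altdef)
qed

definition specialise :: "((nat \<Rightarrow> 'k::field) \<Rightarrow> 'k) poly \<Rightarrow> (nat \<Rightarrow> 'k) \<Rightarrow> 'k poly" where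
  "specialise g y = (\<Sum>j\<le>degree g. monom (coeff g j y) j)"

lemma coeff_specialise: "coeff (specialise g y) j = coeff g j y"
proof (cases "j \<le> degree g")
  case False
  then have "coeff g j = 0" by (simp add: coeff_eq_0)
  with False show ?thesis by (simp add: specialise_def coeff_sum zero_fun_def)
qed (simp add: specialise_def coeff_sum)

lemma poly_specialise:
  assumes "g \<in> polys_over (poly_funs n)"
  shows "poly g (\<lambda>x. x n) (y(n := z)) = poly (specialise g y) z"
proof -
  have "coeff g j (y(n := z)) = coeff g j y" for j
    by (rule poly_funs_depends[of _ n]) (use assms in \<open>auto simp: polys_over_def\<close>)
  then show ?thesis by (simp add: poly_fun_apply specialise_def poly_sum poly_monom)
qed

lemma prime_ideal_restrict:
  assumes "prime_ideal_of R Q" "subring_set R" "subring_set B" "B \<subseteq> R"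
  shows "prime_ideal_of B (Q \<inter> B)"
proof -
  have "a + b \<in> B" "a * b \<in> B" if "a \<in> B" "b \<in> B" for a b
    by (intro subring_setD[OF assms(3)] that)+
  then show ?thesis
    using assms(1,4) subring_setD(2)[OF assms(3)] unfolding prime_ideal_of_def ideal_of_def
    by (auto 0 3 simp: subset_iff)
qed

text \<open>
  Induction on the number of variables. The prime ideal restricts to one in fewer variables, which has a zero \<open>y\<close> by
  induction, and one has to choose a last coordinate for it. If the last variable is transcendental modulo \<open>Q\<close>, every element of \<open>Q\<close>
  has all its coefficients in \<open>Q\<close>, and any value outside the roots of \<open>b\<close> will do. If it is algebraic, take a root of its
  minimal polynomial at \<open>y\<close>, where \<open>y\<close> avoids the zeros of the leading coefficient and of the constant \<open>a0\<close> from
  \<open>generic_elimination\<close>.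
\<close>

theorem nullstellensatz_prime:
  fixes Q :: "((nat \<Rightarrow> 'k::{alg_closed_field, field_char_0}) \<Rightarrow> 'k) set"
  assumes "prime_ideal_of (poly_funs n) Q" "b \<in> poly_funs n" "b \<notin> Q"
  shows "\<exists>y. (\<forall>q\<in>Q. q y = 0) \<and> b y \<noteq> 0"
  using assms
proof (induction n arbitrary: Q b)
  case 0
  note R = subring_setD[OF subring_poly_funs[of 0]]
  have iQ: "ideal_of (poly_funs 0) Q" and Q1: "1 \<notin> Q" using 0(1) by (auto simp: prime_ideal_of_def)
  note Q' = ideal_ofD[OF iQ subring_poly_funs]
  have const: "p = (\<lambda>_. p (\<lambda>_. 0))" if "p \<in> poly_funs 0" for p :: "(nat \<Rightarrow> 'k) \<Rightarrow> 'k"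
    using poly_funs_depends[OF that, of _ "\<lambda>_. 0"] by (auto simp: fun_eq_iff)
  have zero: "q (\<lambda>_. 0) = 0" if q: "q \<in> Q" for q
  proof (rule ccontr)
    assume nz: "q (\<lambda>_. 0) \<noteq> 0"
    let ?r = "\<lambda>_::nat \<Rightarrow> 'k. inverse (q (\<lambda>_. 0))"
    have "?r * q = 1"
    proof
      fix y
      have e: "q y = q (\<lambda>_. 0)" using fun_cong[OF const[OF Q'(1)[OF q]], of y] by simp
      show "(?r * q) y = 1 y" unfolding times_fun_def one_fun_def e using nz by simp
    qed
    moreover have "?r * q \<in> Q" by (intro Q'(4) q poly_funs.const)
    ultimately show False using Q1 by simp
  qed
  moreover have "b (\<lambda>_. 0) \<noteq> 0"
  proof
    assume "b (\<lambda>_. 0) = 0"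
    then have "b = 0" using fun_cong[OF const[OF 0(2)]] by (auto simp: fun_eq_iff zero_fun_def)
    then show False using 0(3) Q'(2) by blast
  qed
  ultimately show ?case by blast
next
  case (Suc n)
  let ?B = "poly_funs n :: ((nat \<Rightarrow> 'k) \<Rightarrow> 'k) set" and ?R = "poly_funs (Suc n) :: ((nat \<Rightarrow> 'k) \<Rightarrow> 'k) set"
  let ?\<xi> = "\<lambda>x::nat \<Rightarrow> 'k. x n"
  note C = polys_over_closed[OF subring_poly_funs[of n]]
  have BR: "?B \<subseteq> ?R" using poly_funs_mono[of _ n "Suc n"] by auto
  have iQ: "ideal_of ?R Q" and Qp: "\<And>x y. x \<in> ?R \<Longrightarrow> y \<in> ?R \<Longrightarrow> x * y \<in> Q \<Longrightarrow> x \<in> Q \<or> y \<in> Q"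
    using Suc.prems(1) by (auto simp: prime_ideal_of_def)
  have QB: "prime_ideal_of ?B (Q \<inter> ?B)"
    by (rule prime_ideal_restrict[OF Suc.prems(1) subring_poly_funs subring_poly_funs BR])
  have as_poly: "\<exists>g\<in>polys_over ?B. q = poly g ?\<xi>" if "q \<in> Q" for q
    using poly_funs_Suc_as_poly[OF ideal_ofD(1)[OF iQ subring_poly_funs that]] .
  obtain g where g: "g \<in> polys_over ?B" "b = poly g ?\<xi>"
    using poly_funs_Suc_as_poly[OF Suc.prems(2)] by blast
  show ?case
  proof (cases "\<forall>f\<in>polys_over ?B. poly f ?\<xi> \<in> Q \<longrightarrow> (\<forall>j. coeff f j \<in> Q)")
    case True
    have "\<exists>j. coeff g j \<notin> Q"
    proof (rule ccontr)
      assume no: "\<not> ?thesis"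
      have x: "?\<xi> \<in> ?R" by (simp add: poly_funs.coord)
      have "(\<Sum>j\<in>S. coeff g j * ?\<xi> ^ j) \<in> Q" for S :: "nat set"
        using no by (induction S rule: infinite_finite_induct)
          (auto intro!: ideal_ofD[OF iQ subring_poly_funs] subring_setD[OF subring_poly_funs] x)
      then have "b \<in> Q" using g by (simp add: poly_altdef)
      then show False using Suc.prems(3) by simp
    qed
    then obtain j where j: "coeff g j \<notin> Q" by blast
    then obtain y where y: "\<forall>q\<in>Q \<inter> ?B. q y = 0" "coeff g j y \<noteq> 0"
      using Suc.IH[OF QB C(8)[OF g(1), of j]] by blast
    have "specialise g y \<noteq> 0" using y(2) coeff_specialise[of g y j] by auto
    then have "finite {z. poly (specialise g y) z = 0}" by (rule poly_roots_finite)
    then obtain z where z: "poly (specialise g y) z \<noteq> 0"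
      using ex_new_if_finite[OF infinite_UNIV_char_0] by blast
    have "q (y(n := z)) = 0" if q: "q \<in> Q" for q
    proof -
      obtain f where f: "f \<in> polys_over ?B" "q = poly f ?\<xi>" using as_poly[OF q] by blast
      then have "coeff f i y = 0" for i using True q y(1) C(8)[OF f(1), of i] by auto
      then have "specialise f y = 0" by (simp add: poly_eq_iff coeff_specialise)
      then show ?thesis using poly_specialise[OF f(1), of y z] f(2) by simp
    qed
    moreover have "b (y(n := z)) \<noteq> 0" using poly_specialise[OF g(1), of y z] g(2) z by simp
    ultimately show ?thesis by blast
  next
    case False
    then obtain f0 j0 where f0: "f0 \<in> polys_over ?B" "poly f0 ?\<xi> \<in> Q" "coeff f0 j0 \<notin> Q" by blast
    have gQ: "poly g ?\<xi> \<notin> Q" using g Suc.prems by simp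
    obtain f a0 v where f: "f \<in> polys_over ?B" "poly f ?\<xi> \<in> Q" "lead_coeff f \<notin> Q" "degree f > 0"
      and div: "\<And>h. h \<in> polys_over ?B \<Longrightarrow> poly h ?\<xi> \<in> Q \<Longrightarrow> \<exists>k s r. s \<in> polys_over ?B \<and>
         r \<in> polys_over ?B \<and> smult (lead_coeff f ^ k) h = f * s + r \<and> (\<forall>j. coeff r j \<in> Q)"
      and a0: "a0 \<in> ?B" "a0 \<notin> Q" "v \<in> polys_over ?B" "a0 - poly v ?\<xi> * poly g ?\<xi> \<in> Q"
      using generic_elimination[OF subring_poly_funs subring_poly_funs poly_as_poly_funs Suc.prems(1)
          g(1) gQ f0] by blast
    let ?c = "lead_coeff f"
    have cB: "?c \<in> ?B" by (rule C(8)[OF f(1)])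
    have "?c * a0 \<in> ?B" by (intro subring_setD[OF subring_poly_funs] cB a0)
    moreover have "?c * a0 \<notin> Q \<inter> ?B" using Qp[of ?c a0] cB a0 f(3) BR by auto
    ultimately obtain y where y: "\<forall>q\<in>Q \<inter> ?B. q y = 0" "(?c * a0) y \<noteq> 0"
      using Suc.IH[OF QB] by blast
    have cy: "?c y \<noteq> 0" and ay: "a0 y \<noteq> 0" using y(2) by (auto simp: times_fun_def)
    have "degree f \<le> degree (specialise f y)"
      using cy by (intro le_degree) (simp add: coeff_specialise)
    then have "degree (specialise f y) > 0" using f(4) by simp
    then obtain z where z: "poly (specialise f y) z = 0" using alg_closed_imp_poly_has_root by blast
    let ?w = "y(n := z)"
    have fw: "poly f ?\<xi> ?w = 0" using poly_specialise[OF f(1), of y z] z by simp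
    have zero: "q ?w = 0" if q: "q \<in> Q" for q
    proof -
      obtain h where h: "h \<in> polys_over ?B" "q = poly h ?\<xi>" using as_poly[OF q] by blast
      then obtain k s r where d: "s \<in> polys_over ?B" "r \<in> polys_over ?B"
        "smult (?c ^ k) h = f * s + r" "\<forall>j. coeff r j \<in> Q" using div[OF h(1)] q by blast
      then have "coeff r i y = 0" for i using y(1) C(8)[OF d(2), of i] by auto
      then have "specialise r y = 0" by (simp add: poly_eq_iff coeff_specialise)
      then have "poly r ?\<xi> ?w = 0" using poly_specialise[OF d(2), of y z] by simp
      moreover have "poly (smult (?c ^ k) h) ?\<xi> ?w = poly (f * s + r) ?\<xi> ?w" by (simp only: d(3))
      ultimately have "?c ?w ^ k * q ?w = 0"
        using fw h(2) by (simp add: times_fun_def plus_fun_def power_fun_apply)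
      moreover have "?c ?w = ?c y" by (rule poly_funs_depends[OF cB]) simp
      ultimately show ?thesis using cy by simp
    qed
    have "(a0 - poly v ?\<xi> * poly g ?\<xi>) ?w = 0" by (rule zero[OF a0(4)])
    moreover have "a0 ?w = a0 y" by (rule poly_funs_depends[OF a0(1)]) simp
    ultimately have "b ?w \<noteq> 0" using ay g(2) by (auto simp: times_fun_def fun_diff_def)
    then show ?thesis using zero by blast
  qed
qed

text \<open>
  If no power of \<open>f\<close> lies in \<open>J\<close>, then some prime ideal contains \<open>J\<close> and avoids all powers of \<open>f\<close>; it has a zero at which
  \<open>f\<close> does not vanish.
\<close>

theorem nullstellensatz:
  fixes J :: "((nat \<Rightarrow> 'k::{alg_closed_field, field_char_0}) \<Rightarrow> 'k) set"
  assumes J: "ideal_of (poly_funs n) J" and f: "f \<in> poly_funs n"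
    and van: "\<And>y. y \<in> {..<n} \<rightarrow>\<^sub>E UNIV \<Longrightarrow> (\<And>q. q \<in> J \<Longrightarrow> q y = 0) \<Longrightarrow> f y = 0"
  shows "\<exists>N. f ^ N \<in> J"
proof (rule ccontr)
  assume no: "\<not> ?thesis"
  note R = subring_setD[OF subring_poly_funs[of n]]
  obtain Q where Q: "prime_ideal_of (poly_funs n) Q" "J \<subseteq> Q" "Q \<inter> range (\<lambda>N. f ^ N) = {}"
  proof (rule prime_ideal_containing[OF subring_poly_funs J, of "range (\<lambda>N. f ^ N)"])
    show "range (\<lambda>N. f ^ N) \<subseteq> poly_funs n" using R(7)[OF f] by auto
    show "1 \<in> range (\<lambda>N. f ^ N)" by (metis power_0 rangeI)
    show "J \<inter> range (\<lambda>N. f ^ N) = {}" using no by auto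
  qed (auto simp: power_add[symmetric])
  have "f ^ 1 \<notin> Q" using Q(3) by blast
  then obtain y where y: "\<forall>q\<in>Q. q y = 0" "f y \<noteq> 0" using nullstellensatz_prime[OF Q(1) f] by auto
  let ?y = "restrict y {..<n}"
  have e: "p ?y = p y" if "p \<in> poly_funs n" for p by (rule poly_funs_depends[OF that]) simp
  have "q ?y = 0" if "q \<in> J" for q
    using y(1) Q(2) that e[OF ideal_ofD(1)[OF J subring_poly_funs that]] by auto
  then have "f ?y = 0" by (intro van) auto
  then show False using y(2) e[OF f] by simp
qed

section \<open>Zariski structures\<close>

definition function_algebra :: "('a \<Rightarrow> 'k::field) set \<Rightarrow> bool" where
  "function_algebra R \<longleftrightarrow> (\<forall>c. (\<lambda>_. c) \<in> R) \<and>
     (\<forall>f\<in>R. \<forall>g\<in>R. (\<lambda>x. f x + g x) \<in> R \<and> (\<lambda>x. f x * g x) \<in> R)"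

lemma function_algebraD:
  assumes "function_algebra R"
  shows "(\<lambda>_. c) \<in> R" "f \<in> R \<Longrightarrow> g \<in> R \<Longrightarrow> (\<lambda>x. f x + g x) \<in> R"
    "f \<in> R \<Longrightarrow> g \<in> R \<Longrightarrow> (\<lambda>x. f x * g x) \<in> R"
  using assms by (auto simp: function_algebra_def)

lemma function_algebra_poly_funs: "function_algebra (poly_funs n)"
  by (auto simp: function_algebra_def intro: poly_funs.intros)

lemma function_algebra_range_poly: "function_algebra (range poly)"
proof -
  have "(\<lambda>_. c) \<in> range poly" for c :: 'a
    by (rule range_eqI[of _ _ "[:c:]"]) auto
  moreover have "(\<lambda>x. poly p x + poly q x) \<in> range poly" for p q :: "'a poly"
    by (rule range_eqI[of _ _ "p + q"]) auto
  moreover have "(\<lambda>x. poly p x * poly q x) \<in> range poly" for p q :: "'a poly"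
    by (rule range_eqI[of _ _ "p * q"]) auto
  ultimately show ?thesis by (auto simp: function_algebra_def)
qed

lemma openin_zariski:
  assumes "function_algebra R"
  shows "openin (Top (zariski_fspace Z R)) U \<longleftrightarrow> zariski_open Z R U"
  using istopology_zariski_open[of R Z] function_algebraD[OF assms]
  by (simp add: zariski_fspace_def topology_inverse')

lemma zariski_open_separate:
  assumes "zariski_open Z R U" "x \<in> U"
  obtains s where "s \<in> R" "s x \<noteq> 0" "\<And>y. y \<in> Z \<Longrightarrow> y \<notin> U \<Longrightarrow> s y = 0"
  using assms unfolding zariski_open_def by auto

lemma zariski_open_principal: "f \<in> R \<Longrightarrow> zariski_open Z R {x \<in> Z. f x \<noteq> 0}"
  unfolding zariski_open_def by (intro exI[of _ "{f}"]) auto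

lemma zariski_open_subset: "zariski_open Z R U \<Longrightarrow> U \<subseteq> Z"
  unfolding zariski_open_def by auto

lemma points_zariski:
  assumes R: "function_algebra R"
  shows "points (zariski_fspace Z R) = Z"
proof -
  have "zariski_open Z R Z"
    using zariski_open_principal[OF function_algebraD(1)[OF R, of 1], of Z] by simp
  then have "openin (Top (zariski_fspace Z R)) Z" by (simp add: openin_zariski[OF R])
  moreover have "points (zariski_fspace Z R) \<subseteq> Z"
    by (rule zariski_open_subset[OF iffD1[OF openin_zariski[OF R] openin_topspace]])
  ultimately show ?thesis using openin_subset by blast
qed

lemma Reg_zariski_fraction:
  assumes "f \<in> R" "g \<in> R" "zariski_open Z R U" "\<And>x. x \<in> U \<Longrightarrow> g x \<noteq> 0 \<and> h x = f x / g x"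
  shows "h \<in> Reg (zariski_fspace Z R) U"
  using assms unfolding zariski_fspace_def by auto

text \<open>
  A fraction that represents \<open>h\<close> near \<open>x\<close> becomes an identity on all of \<open>Z\<close> when numerator and denominator are
  multiplied by a function that vanishes outside the neighbourhood.
\<close>

lemma Reg_zariski_clear_denominators:
  assumes R: "function_algebra R" and h: "h \<in> Reg (zariski_fspace Z R) U" "x \<in> U"
  obtains P Q where "P \<in> R" "Q \<in> R" "P x \<noteq> 0" "\<And>y. y \<in> Z \<Longrightarrow> P y * h y = Q y"
    "\<And>y. y \<in> Z \<Longrightarrow> y \<notin> U \<Longrightarrow> P y = 0"
proof -
  obtain V f g where V: "zariski_open Z R V" "x \<in> V" "V \<subseteq> U" and fg: "f \<in> R" "g \<in> R"
    "\<And>y. y \<in> V \<Longrightarrow> g y \<noteq> 0 \<and> h y = f y / g y"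
    using h unfolding zariski_fspace_def by auto
  obtain s where s: "s \<in> R" "s x \<noteq> 0" "\<And>y. y \<in> Z \<Longrightarrow> y \<notin> V \<Longrightarrow> s y = 0"
    using zariski_open_separate[OF V(1,2)] by blast
  show ?thesis
  proof (rule that[of "\<lambda>y. s y * g y" "\<lambda>y. s y * f y"])
    show "(\<lambda>y. s y * g y) \<in> R" "(\<lambda>y. s y * f y) \<in> R"
      using function_algebraD(3)[OF R] s fg by auto
    show "s x * g x \<noteq> 0" using s fg V by auto
    fix y assume y: "y \<in> Z"
    show "s y * g y * h y = s y * f y" using s(3)[OF y] fg(3)[of y] by (cases "y \<in> V") auto
    show "s y * g y = 0" if "y \<notin> U" using s(3)[OF y] that V by auto
  qed
qed

lemma function_sheaf_zariski:
  fixes R :: "('a \<Rightarrow> 'k::field) set"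
  assumes R: "function_algebra R"
  shows "function_sheaf (zariski_fspace Z R)"
proof -
  let ?X = "zariski_fspace Z R"
  note R' = function_algebraD[OF R]
  have inter: "zariski_open Z R (U \<inter> V)" if "zariski_open Z R U" "zariski_open Z R V" for U V
    using that openin_Int[of "Top ?X" U V] by (simp add: openin_zariski[OF R])
  have mem: "h \<in> Reg ?X U \<longleftrightarrow> (\<forall>x\<in>U. \<exists>V f g. zariski_open Z R V \<and> x \<in> V \<and> V \<subseteq> U \<and> f \<in> R \<and> g \<in> R \<and>
                      (\<forall>y\<in>V. g y \<noteq> 0 \<and> h y = f y / g y))" for h U
    by (simp add: zariski_fspace_def)
  have 1: "g \<in> Reg ?X U" if f: "f \<in> Reg ?X U" and eq: "\<forall>x\<in>U. f x = g x" for U f g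
    unfolding mem
  proof
    fix x assume "x \<in> U"
    then obtain V a b where V: "zariski_open Z R V" "x \<in> V" "V \<subseteq> U" "a \<in> R" "b \<in> R"
      "\<forall>y\<in>V. b y \<noteq> 0 \<and> f y = a y / b y" using f unfolding mem by blast
    have "b y \<noteq> 0 \<and> g y = a y / b y" if "y \<in> V" for y
      using bspec[OF V(6) that] bspec[OF eq subsetD[OF V(3) that]] by simp
    with V show "\<exists>V a b. zariski_open Z R V \<and> x \<in> V \<and> V \<subseteq> U \<and> a \<in> R \<and> b \<in> R \<and>
        (\<forall>y\<in>V. b y \<noteq> 0 \<and> g y = a y / b y)"
      by (intro exI[of _ V] exI[of _ a] exI[of _ b]) auto
  qed
  have 2: "(\<lambda>_. c) \<in> Reg ?X U" if "zariski_open Z R U" for U c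
    by (rule Reg_zariski_fraction[OF R'(1)[of c] R'(1)[of 1] that]) simp
  have 3: "(\<lambda>x. f x + g x) \<in> Reg ?X U \<and> (\<lambda>x. f x * g x) \<in> Reg ?X U"
    if "f \<in> Reg ?X U" "g \<in> Reg ?X U" for U f g
  proof -
    have "\<exists>V a b d. zariski_open Z R V \<and> x \<in> V \<and> V \<subseteq> U \<and> a \<in> R \<and> b \<in> R \<and> d \<in> R \<and>
        (\<forall>y\<in>V. d y \<noteq> 0 \<and> f y = a y / d y \<and> g y = b y / d y)" if x: "x \<in> U" for x
    proof -
      obtain V a b where V: "zariski_open Z R V" "x \<in> V" "V \<subseteq> U" "a \<in> R" "b \<in> R"
        "\<forall>y\<in>V. b y \<noteq> 0 \<and> f y = a y / b y" using \<open>f \<in> Reg ?X U\<close> x unfolding mem by blast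
      obtain W a' b' where W: "zariski_open Z R W" "x \<in> W" "W \<subseteq> U" "a' \<in> R" "b' \<in> R"
        "\<forall>y\<in>W. b' y \<noteq> 0 \<and> g y = a' y / b' y" using \<open>g \<in> Reg ?X U\<close> x unfolding mem by blast
      show ?thesis
        by (rule exI[of _ "V \<inter> W"], rule exI[of _ "\<lambda>y. a y * b' y"], rule exI[of _ "\<lambda>y. a' y * b y"],
            rule exI[of _ "\<lambda>y. b y * b' y"]) (use V W R'(3) inter in auto)
    qed
    then have *: "\<exists>V a b d. zariski_open Z R V \<and> x \<in> V \<and> V \<subseteq> U \<and> a \<in> R \<and> b \<in> R \<and> d \<in> R \<and>
        (\<forall>y\<in>V. d y \<noteq> 0 \<and> f y = a y / d y \<and> g y = b y / d y)" if x: "x \<in> U" for x using x by blast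
    show ?thesis
      unfolding mem
    proof (intro conjI ballI)
      fix x assume "x \<in> U"
      from *[OF this] obtain V a b d where V: "zariski_open Z R V" "x \<in> V" "V \<subseteq> U" "a \<in> R" "b \<in> R" "d \<in> R"
        "\<forall>y\<in>V. d y \<noteq> 0 \<and> f y = a y / d y \<and> g y = b y / d y" by (elim exE conjE)
      show "\<exists>V fa ga. zariski_open Z R V \<and> x \<in> V \<and> V \<subseteq> U \<and> fa \<in> R \<and> ga \<in> R \<and>
          (\<forall>y\<in>V. ga y \<noteq> 0 \<and> f y + g y = fa y / ga y)"
        by (rule exI[of _ V], rule exI[of _ "\<lambda>y. a y + b y"], rule exI[of _ d])
          (use V R'(2) in \<open>auto simp: add_divide_distrib\<close>)
      show "\<exists>V fa ga. zariski_open Z R V \<and> x \<in> V \<and> V \<subseteq> U \<and> fa \<in> R \<and> ga \<in> R \<and>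
          (\<forall>y\<in>V. ga y \<noteq> 0 \<and> f y * g y = fa y / ga y)"
        by (rule exI[of _ V], rule exI[of _ "\<lambda>y. a y * b y"], rule exI[of _ "\<lambda>y. d y * d y"])
          (use V R'(3) in auto)
    qed
  qed
  have 4: "f \<in> Reg ?X V" if V: "zariski_open Z R V" and VU: "V \<subseteq> U" and f: "f \<in> Reg ?X U" for U V f
    unfolding mem
  proof
    fix x assume "x \<in> V"
    then obtain W a b where W: "zariski_open Z R W" "x \<in> W" "W \<subseteq> U" "a \<in> R" "b \<in> R"
      "\<forall>y\<in>W. b y \<noteq> 0 \<and> f y = a y / b y" using f VU unfolding mem by blast
    then show "\<exists>W a b. zariski_open Z R W \<and> x \<in> W \<and> W \<subseteq> V \<and> a \<in> R \<and> b \<in> R \<and>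
        (\<forall>y\<in>W. b y \<noteq> 0 \<and> f y = a y / b y)"
      using V \<open>x \<in> V\<close> inter[of W V] by (intro exI[of _ "W \<inter> V"] exI[of _ a] exI[of _ b]) auto
  qed
  have 5: "f \<in> Reg ?X U"
    if loc: "\<forall>x\<in>U. \<exists>V. zariski_open Z R V \<and> x \<in> V \<and> V \<subseteq> U \<and> f \<in> Reg ?X V" for U f
    unfolding mem
  proof
    fix x assume "x \<in> U"
    then obtain V where V: "x \<in> V" "V \<subseteq> U" "f \<in> Reg ?X V" using loc by blast
    then obtain W a b where "zariski_open Z R W" "x \<in> W" "W \<subseteq> V" "a \<in> R" "b \<in> R"
      "\<forall>y\<in>W. b y \<noteq> 0 \<and> f y = a y / b y" unfolding mem by blast
    then show "\<exists>W a b. zariski_open Z R W \<and> x \<in> W \<and> W \<subseteq> U \<and> a \<in> R \<and> b \<in> R \<and>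
        (\<forall>y\<in>W. b y \<noteq> 0 \<and> f y = a y / b y)"
      using V(2) by (intro exI[of _ W] exI[of _ a] exI[of _ b]) auto
  qed
  show ?thesis
    unfolding function_sheaf_def openin_zariski[OF R]
  proof (intro conjI allI impI)
    fix U V f g c
    show "zariski_open Z R U \<Longrightarrow> f \<in> Reg ?X U \<Longrightarrow> \<forall>x\<in>U. f x = g x \<Longrightarrow> g \<in> Reg ?X U"
      by (rule 1)
    show "zariski_open Z R U \<Longrightarrow> (\<lambda>_. c) \<in> Reg ?X U"
      by (rule 2)
    show "f \<in> Reg ?X U \<Longrightarrow> g \<in> Reg ?X U \<Longrightarrow> (\<lambda>x. f x + g x) \<in> Reg ?X U"
      by (rule 3[THEN conjunct1])
    show "f \<in> Reg ?X U \<Longrightarrow> g \<in> Reg ?X U \<Longrightarrow> (\<lambda>x. f x * g x) \<in> Reg ?X U"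
      by (rule 3[THEN conjunct2])
    show "zariski_open Z R V \<Longrightarrow> V \<subseteq> U \<Longrightarrow> f \<in> Reg ?X U \<Longrightarrow> f \<in> Reg ?X V"
      by (rule 4)
    show "\<forall>x\<in>U. \<exists>V. zariski_open Z R V \<and> x \<in> V \<and> V \<subseteq> U \<and> f \<in> Reg ?X V \<Longrightarrow> f \<in> Reg ?X U"
      by (rule 5)
  qed
qed

section \<open>Charts\<close>

text \<open>
  Regular functions are locally fractions of polynomials in the coordinates \<open>c\<close>, with the denominator multiplied by a
  function that vanishes outside \<open>U\<close>. For \<open>h = 0\<close> this says that the complement of \<open>U\<close> is cut out by polynomials.
\<close>

definition fraction_chart :: "('a, 'k::field) fspace \<Rightarrow> nat \<Rightarrow> ('a \<Rightarrow> nat \<Rightarrow> 'k) \<Rightarrow> bool" where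
  "fraction_chart Y n c \<longleftrightarrow> (\<forall>U h y. openin (Top Y) U \<longrightarrow> h \<in> Reg Y U \<longrightarrow> y \<in> U \<longrightarrow>
     (\<exists>P\<in>poly_funs n. \<exists>Q\<in>poly_funs n. P (c y) \<noteq> 0 \<and>
        (\<forall>x\<in>points Y. P (c x) * h x = Q (c x)) \<and> (\<forall>x\<in>points Y - U. P (c x) = 0)))"

text \<open>
  The image of the coordinates \<open>c\<close> is closed in the open set \<open>q \<noteq> 0\<close> of affine space. With \<open>q = 1\<close> this
  describes affine varieties; with \<open>q\<close> the coordinate of the line it describes the torus.
\<close>

definition chart_off :: "('a, 'k::field) fspace \<Rightarrow> nat \<Rightarrow> ('a \<Rightarrow> nat \<Rightarrow> 'k) \<Rightarrow> ((nat \<Rightarrow> 'k) \<Rightarrow> 'k) \<Rightarrow> bool" where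
  "chart_off Y n c q \<longleftrightarrow> q \<in> poly_funs n \<and> fraction_chart Y n c \<and>
     (\<forall>y\<in>points Y. c y \<in> {..<n} \<rightarrow>\<^sub>E UNIV \<and> q (c y) \<noteq> 0) \<and>
     (\<forall>w\<in>{..<n} \<rightarrow>\<^sub>E UNIV. w \<notin> c ` points Y \<longrightarrow> q w \<noteq> 0 \<longrightarrow>
        (\<exists>p\<in>poly_funs n. p w \<noteq> 0 \<and> (\<forall>y\<in>points Y. p (c y) = 0)))"

lemma fraction_chartD:
  assumes "fraction_chart Y n c" "openin (Top Y) U" "h \<in> Reg Y U" "y \<in> U"
  obtains P Q where "P \<in> poly_funs n" "Q \<in> poly_funs n" "P (c y) \<noteq> 0"
    "\<And>x. x \<in> points Y \<Longrightarrow> P (c x) * h x = Q (c x)" "\<And>x. x \<in> points Y \<Longrightarrow> x \<notin> U \<Longrightarrow> P (c x) = 0"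
proof -
  have "\<exists>P\<in>poly_funs n. \<exists>Q\<in>poly_funs n. P (c y) \<noteq> 0 \<and>
      (\<forall>x\<in>points Y. P (c x) * h x = Q (c x)) \<and> (\<forall>x\<in>points Y - U. P (c x) = 0)"
    using assms(1)[unfolded fraction_chart_def, THEN spec, THEN spec, THEN spec, THEN mp, THEN mp, THEN mp,
        OF assms(2-4)] .
  then obtain P Q where "P \<in> poly_funs n" "Q \<in> poly_funs n" "P (c y) \<noteq> 0"
    "\<forall>x\<in>points Y. P (c x) * h x = Q (c x)" "\<forall>x\<in>points Y - U. P (c x) = 0" by (elim bexE conjE)
  then show ?thesis using that[of P Q] by auto
qed

lemma function_sheafD:
  assumes "function_sheaf X"
  shows "openin (Top X) U \<Longrightarrow> f \<in> Reg X U \<Longrightarrow> (\<And>x. x \<in> U \<Longrightarrow> f x = g x) \<Longrightarrow> g \<in> Reg X U"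
    and "openin (Top X) U \<Longrightarrow> (\<lambda>_. a) \<in> Reg X U"
    and "openin (Top X) U \<Longrightarrow> openin (Top X) V \<Longrightarrow> V \<subseteq> U \<Longrightarrow> f \<in> Reg X U \<Longrightarrow> f \<in> Reg X V"
    and "openin (Top X) U \<Longrightarrow> (\<And>x. x \<in> U \<Longrightarrow> \<exists>V. openin (Top X) V \<and> x \<in> V \<and> V \<subseteq> U \<and> f \<in> Reg X V) \<Longrightarrow>
       f \<in> Reg X U"
proof -
  note X = assms[unfolded function_sheaf_def]
  have 1: "\<forall>U f g. openin (Top X) U \<longrightarrow> f \<in> Reg X U \<longrightarrow> (\<forall>x\<in>U. f x = g x) \<longrightarrow> g \<in> Reg X U"
    using X by (elim conjE) assumption
  have 2: "\<forall>U c. openin (Top X) U \<longrightarrow> (\<lambda>_. c) \<in> Reg X U"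
    using X by (elim conjE) assumption
  have 3: "\<forall>U V f. openin (Top X) U \<longrightarrow> openin (Top X) V \<longrightarrow> V \<subseteq> U \<longrightarrow> f \<in> Reg X U \<longrightarrow> f \<in> Reg X V"
    using X by (elim conjE) assumption
  have 4: "\<forall>U f. openin (Top X) U \<longrightarrow>
        (\<forall>x\<in>U. \<exists>V. openin (Top X) V \<and> x \<in> V \<and> V \<subseteq> U \<and> f \<in> Reg X V) \<longrightarrow> f \<in> Reg X U"
    using X by (elim conjE) assumption
  show "openin (Top X) U \<Longrightarrow> f \<in> Reg X U \<Longrightarrow> (\<And>x. x \<in> U \<Longrightarrow> f x = g x) \<Longrightarrow> g \<in> Reg X U"
    by (rule 1[rule_format])
  show "openin (Top X) U \<Longrightarrow> (\<lambda>_. a) \<in> Reg X U"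
    by (rule 2[rule_format])
  show "openin (Top X) U \<Longrightarrow> openin (Top X) V \<Longrightarrow> V \<subseteq> U \<Longrightarrow> f \<in> Reg X U \<Longrightarrow> f \<in> Reg X V"
    by (rule 3[rule_format])
  show "openin (Top X) U \<Longrightarrow> (\<And>x. x \<in> U \<Longrightarrow> \<exists>V. openin (Top X) V \<and> x \<in> V \<and> V \<subseteq> U \<and> f \<in> Reg X V) \<Longrightarrow>
       f \<in> Reg X U"
    by (rule 4[rule_format])
qed

lemma fraction_chart_separates:
  assumes "function_sheaf Y" "fraction_chart Y n c" "openin (Top Y) U" "y \<in> U"
  obtains P where "P \<in> poly_funs n" "P (c y) \<noteq> 0" "\<And>x. x \<in> points Y \<Longrightarrow> x \<notin> U \<Longrightarrow> P (c x) = 0"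
  by (rule fraction_chartD[OF assms(2,3) function_sheafD(2)[OF assms(1,3)] assms(4)]) (rule that)

lemma affine_chart:
  assumes iso: "isomorphism X (zariski_fspace Z (poly_funs n)) \<phi>" and X: "function_sheaf X"
    and Z: "algebraic_set n Z"
  shows "bij_betw \<phi> (points X) Z" "chart_off X n \<phi> (\<lambda>_. 1)"
    and "p \<in> poly_funs n \<Longrightarrow> openin (Top X) {x \<in> points X. p (\<phi> x) \<noteq> 0}"
    and "p \<in> poly_funs n \<Longrightarrow> q \<in> poly_funs n \<Longrightarrow>
      (\<lambda>x. p (\<phi> x) / q (\<phi> x)) \<in> Reg X {x \<in> points X. q (\<phi> x) \<noteq> 0}"
    and "p \<in> poly_funs n \<Longrightarrow> (\<lambda>x. p (\<phi> x)) \<in> Reg X (points X)"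
proof -
  let ?A = "zariski_fspace Z (poly_funs n)"
  note R = function_algebra_poly_funs[of n]
  have pts: "points ?A = Z" by (rule points_zariski[OF R])
  show bij: "bij_betw \<phi> (points X) Z" using iso pts by (simp add: isomorphism_def)
  have mor: "morphism X ?A \<phi>" and inv: "morphism ?A X (inv_into (points X) \<phi>)"
    using iso by (auto simp: isomorphism_def)
  let ?i = "inv_into (points X) \<phi>"
  have in_Z: "\<phi> x \<in> Z" if "x \<in> points X" for x using bij that by (auto simp: bij_betw_def)
  have phi_inv: "?i (\<phi> x) = x" if "x \<in> points X" for x
    using bij that by (simp add: bij_betw_def)
  show op: "openin (Top X) {x \<in> points X. p (\<phi> x) \<noteq> 0}" if "p \<in> poly_funs n" for p
  proof -
    have "openin (Top ?A) {x \<in> Z. p x \<noteq> 0}"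
      using that by (simp add: openin_zariski[OF R] zariski_open_principal)
    then have "openin (Top X) {x \<in> points X. \<phi> x \<in> {x \<in> Z. p x \<noteq> 0}}"
      using mor by (intro openin_continuous_map_preimage) (auto simp: morphism_def)
    also have "{x \<in> points X. \<phi> x \<in> {x \<in> Z. p x \<noteq> 0}} = {x \<in> points X. p (\<phi> x) \<noteq> 0}"
      using in_Z by auto
    finally show ?thesis .
  qed
  show fr: "(\<lambda>x. p (\<phi> x) / q (\<phi> x)) \<in> Reg X {x \<in> points X. q (\<phi> x) \<noteq> 0}"
    if "p \<in> poly_funs n" "q \<in> poly_funs n" for p q
  proof -
    let ?V = "{x \<in> Z. q x \<noteq> 0}"
    have V: "zariski_open Z (poly_funs n) ?V" by (rule zariski_open_principal[OF that(2)])
    have "(\<lambda>x. p x / q x) \<in> Reg ?A ?V" by (rule Reg_zariski_fraction[OF that V]) simp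
    then have "(\<lambda>x. p x / q x) \<circ> \<phi> \<in> Reg X {x \<in> points X. \<phi> x \<in> ?V}"
      using mor V unfolding morphism_def openin_zariski[OF R] by blast
    also have "{x \<in> points X. \<phi> x \<in> ?V} = {x \<in> points X. q (\<phi> x) \<noteq> 0}" using in_Z by auto
    finally show ?thesis by (simp add: o_def)
  qed
  show "(\<lambda>x. p (\<phi> x)) \<in> Reg X (points X)" if "p \<in> poly_funs n"
    using fr[OF that poly_funs.const[of 1 n]] by simp
  have fc: "fraction_chart X n \<phi>"
    unfolding fraction_chart_def
  proof (intro allI impI)
    fix U h y assume U: "openin (Top X) U" and h: "h \<in> Reg X U" and y: "y \<in> U"
    let ?U = "{z \<in> Z. ?i z \<in> U}"
    have UX: "U \<subseteq> points X" using U by (rule openin_subset)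
    have hi: "h \<circ> ?i \<in> Reg ?A ?U" using inv U h pts by (auto simp: morphism_def)
    have "\<phi> y \<in> ?U" using y UX in_Z phi_inv by auto
    from Reg_zariski_clear_denominators[OF R hi this] obtain P Q where
      PQ: "P \<in> poly_funs n" "Q \<in> poly_funs n" "P (\<phi> y) \<noteq> 0"
      "\<And>z. z \<in> Z \<Longrightarrow> P z * (h \<circ> ?i) z = Q z" "\<And>z. z \<in> Z \<Longrightarrow> z \<notin> ?U \<Longrightarrow> P z = 0" by blast
    have "P (\<phi> x) * h x = Q (\<phi> x)" "x \<notin> U \<Longrightarrow> P (\<phi> x) = 0" if "x \<in> points X" for x
      using PQ(4,5)[OF in_Z[OF that]] phi_inv[OF that] by auto
    then show "\<exists>P\<in>poly_funs n. \<exists>Q\<in>poly_funs n. P (\<phi> y) \<noteq> 0 \<and>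
        (\<forall>x\<in>points X. P (\<phi> x) * h x = Q (\<phi> x)) \<and> (\<forall>x\<in>points X - U. P (\<phi> x) = 0)"
      using PQ by blast
  qed
  obtain S where S: "S \<subseteq> poly_funs n" "Z = {x \<in> {..<n} \<rightarrow>\<^sub>E UNIV. \<forall>p\<in>S. p x = 0}"
    using Z by (auto simp: algebraic_set_def)
  have im: "\<phi> ` points X = Z" using bij by (simp add: bij_betw_def)
  show "chart_off X n \<phi> (\<lambda>_. 1)"
    unfolding chart_off_def im
  proof (intro conjI ballI impI)
    fix w assume "w \<in> {..<n} \<rightarrow>\<^sub>E (UNIV :: 'b set)" "w \<notin> Z"
    then obtain p where "p \<in> S" "p w \<noteq> 0" using S by auto
    moreover have "\<forall>y\<in>points X. p (\<phi> y) = 0" using in_Z S \<open>p \<in> S\<close> by auto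
    ultimately show "\<exists>p\<in>poly_funs n. p w \<noteq> 0 \<and> (\<forall>y\<in>points X. p (\<phi> y) = 0)" using S by blast
  next
    fix y assume "y \<in> points X"
    then show "\<phi> y \<in> {..<n} \<rightarrow>\<^sub>E UNIV" using in_Z S by blast
  qed (use fc in \<open>auto intro: poly_funs.intros\<close>)
qed

section \<open>Products\<close>

lemma openin_prod_fspace:
  assumes "function_sheaf Y" "function_sheaf X"
  shows "openin (Top (prod_fspace Y X)) W \<longleftrightarrow> prod_open Y X W"
  using istopology_prod_open[OF assms] by (simp add: prod_fspace_def topology_inverse')

lemma const_tensor_funs:
  assumes "function_sheaf Y" "function_sheaf X" "openin (Top Y) U" "openin (Top X) V"
  shows "(\<lambda>_. a) \<in> tensor_funs Y X U V"
  unfolding tensor_funs_def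
  using function_sheafD(2)[OF assms(1,3), of a] function_sheafD(2)[OF assms(2,4), of 1]
  by (intro CollectI exI[of _ 1] exI[of _ "\<lambda>_ _. a"] exI[of _ "\<lambda>_ _. 1"]) (simp add: fun_eq_iff)

lemma points_prod_fspace:
  assumes Y: "function_sheaf Y" and X: "function_sheaf X"
  shows "points (prod_fspace Y X) = points Y \<times> points X"
proof
  have "prod_open Y X (points Y \<times> points X)"
    unfolding prod_open_def
  proof
    fix p assume "p \<in> points Y \<times> points X"
    then show "\<exists>U V g. openin (Top Y) U \<and> openin (Top X) V \<and> g \<in> tensor_funs Y X U V \<and>
        p \<in> nonvanishing (U \<times> V) g \<and> nonvanishing (U \<times> V) g \<subseteq> points Y \<times> points X"
      using const_tensor_funs[OF Y X openin_topspace openin_topspace, of 1]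
      by (intro exI[of _ "points Y"] exI[of _ "points X"] exI[of _ "\<lambda>_. 1"]) (auto simp: nonvanishing_def)
  qed
  then show "points Y \<times> points X \<subseteq> points (prod_fspace Y X)"
    by (intro openin_subset) (simp add: openin_prod_fspace[OF Y X])
  have op: "prod_open Y X (points (prod_fspace Y X))"
    by (rule iffD1[OF openin_prod_fspace[OF Y X] openin_topspace])
  show "points (prod_fspace Y X) \<subseteq> points Y \<times> points X"
  proof
    fix p assume "p \<in> points (prod_fspace Y X)"
    from bspec[OF op[unfolded prod_open_def] this] obtain U V g where
      "openin (Top Y) U" "openin (Top X) V" "g \<in> tensor_funs Y X U V" "p \<in> nonvanishing (U \<times> V) g"
      "nonvanishing (U \<times> V) g \<subseteq> points (prod_fspace Y X)" by (elim exE conjE)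
    then show "p \<in> points Y \<times> points X"
      using openin_subset[of "Top Y" U] openin_subset[of "Top X" V] by (auto simp: nonvanishing_def)
  qed
qed

text \<open>
  The value \<open>undefined\<close> from index \<open>m + n\<close> on makes this a point of affine \<open>(m + n)\<close>-space.
\<close>

definition join_coords :: "nat \<Rightarrow> nat \<Rightarrow> (nat \<Rightarrow> 'k) \<Rightarrow> (nat \<Rightarrow> 'k) \<Rightarrow> nat \<Rightarrow> 'k" where
  "join_coords m n y x = (\<lambda>i. if i < m then y i else if i < m + n then x (i - m) else undefined)"

lemma poly_funs_left:
  assumes "p \<in> poly_funs m"
  shows "p \<in> poly_funs (m + n)" "p (join_coords m n y x) = p y"
  using poly_funs_mono[OF assms, of "m + n"] poly_funs_depends[OF assms, of "join_coords m n y x" y]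
  by (auto simp: join_coords_def)

lemma poly_funs_right:
  assumes "p \<in> poly_funs n"
  shows "(\<lambda>w. p (\<lambda>i. w (i + m))) \<in> poly_funs (m + n)"
    "p (\<lambda>i. join_coords m n y x (i + m)) = p x"
proof -
  show "(\<lambda>w. p (\<lambda>i. w (i + m))) \<in> poly_funs (m + n)"
    by (rule poly_funs_substitute[OF assms, of "\<lambda>i w. w (i + m)"]) (auto intro: poly_funs.intros)
  show "p (\<lambda>i. join_coords m n y x (i + m)) = p x"
    by (rule poly_funs_depends[OF assms]) (simp add: join_coords_def)
qed

lemma sum_append:
  fixes u v :: "nat \<Rightarrow> 'b::comm_monoid_add"
  shows "(\<Sum>j<k + l. if j < k then u j else v (j - k)) = (\<Sum>j<k. u j) + (\<Sum>j<l. v j)"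
proof (induction l)
  case 0
  show ?case by (auto intro: sum.cong)
qed (simp add: add.assoc)

definition is_tensor :: "nat \<Rightarrow> nat \<Rightarrow> ((nat \<Rightarrow> 'k::field) \<Rightarrow> (nat \<Rightarrow> 'k) \<Rightarrow> 'k) \<Rightarrow> bool" where
  "is_tensor m n F \<longleftrightarrow> (\<exists>(k::nat) a b. (\<forall>j<k. a j \<in> poly_funs m \<and> b j \<in> poly_funs n) \<and>
     (\<forall>y x. F y x = (\<Sum>j<k. a j y * b j x)))"

lemma is_tensor_simple:
  "a \<in> poly_funs m \<Longrightarrow> b \<in> poly_funs n \<Longrightarrow> is_tensor m n (\<lambda>y x. a y * b x)"
  unfolding is_tensor_def by (intro exI[of _ 1] exI[of _ "\<lambda>_. a"] exI[of _ "\<lambda>_. b"]) simp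

lemma is_tensor_add:
  assumes "is_tensor m n F" "is_tensor m n G"
  shows "is_tensor m n (\<lambda>y x. F y x + G y x)"
proof -
  obtain k :: nat and a b where 1: "\<forall>j<k. a j \<in> poly_funs m \<and> b j \<in> poly_funs n" "\<forall>y x. F y x = (\<Sum>j<k. a j y * b j x)"
    using assms(1) unfolding is_tensor_def by blast
  obtain l :: nat and c d where 2: "\<forall>j<l. c j \<in> poly_funs m \<and> d j \<in> poly_funs n" "\<forall>y x. G y x = (\<Sum>j<l. c j y * d j x)"
    using assms(2) unfolding is_tensor_def by blast
  let ?a = "\<lambda>j. if j < k then a j else c (j - k)" and ?b = "\<lambda>j. if j < k then b j else d (j - k)"
  have "F y x + G y x = (\<Sum>j<k + l. ?a j y * ?b j x)" for y x
  proof -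
    have "(\<Sum>j<k + l. ?a j y * ?b j x) =
        (\<Sum>j<k + l. if j < k then a j y * b j x else c (j - k) y * d (j - k) x)"
      by (rule sum.cong) auto
    then show ?thesis
      using sum_append[where k = k and l = l and u = "\<lambda>j. a j y * b j x" and v = "\<lambda>j. c j y * d j x"] 1 2
      by simp
  qed
  then show ?thesis unfolding is_tensor_def using 1 2
    by (intro exI[of _ "k + l"] exI[of _ ?a] exI[of _ ?b]) auto
qed

lemma is_tensor_zero: "is_tensor m n (\<lambda>y x. 0)"
  using is_tensor_simple[OF poly_funs.const[of 0] poly_funs.const[of 0]] by simp

lemma is_tensor_sum: "(\<And>i. i \<in> S \<Longrightarrow> is_tensor m n (F i)) \<Longrightarrow> is_tensor m n (\<lambda>y x. \<Sum>i\<in>S. F i y x)"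
  by (induction S rule: infinite_finite_induct) (simp_all add: is_tensor_zero is_tensor_add)

lemma is_tensor_mult:
  assumes "is_tensor m n F" "is_tensor m n G"
  shows "is_tensor m n (\<lambda>y x. F y x * G y x)"
proof -
  obtain k :: nat and a b where 1: "\<forall>j<k. a j \<in> poly_funs m \<and> b j \<in> poly_funs n" "\<forall>y x. F y x = (\<Sum>j<k. a j y * b j x)"
    using assms(1) unfolding is_tensor_def by blast
  obtain l :: nat and c d where 2: "\<forall>j<l. c j \<in> poly_funs m \<and> d j \<in> poly_funs n" "\<forall>y x. G y x = (\<Sum>j<l. c j y * d j x)"
    using assms(2) unfolding is_tensor_def by blast
  have "is_tensor m n (\<lambda>y x. \<Sum>i<k. \<Sum>j<l. (a i y * c j y) * (b i x * d j x))"
    using 1(1) 2(1) by (intro is_tensor_sum is_tensor_simple poly_funs.mult) auto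
  moreover have "F y x * G y x = (\<Sum>i<k. \<Sum>j<l. (a i y * c j y) * (b i x * d j x))" for y x
    using 1(2) 2(2) by (simp add: sum_product mult_ac)
  ultimately show ?thesis by simp
qed

lemma poly_funs_join_is_tensor:
  "F \<in> poly_funs (m + n) \<Longrightarrow> is_tensor m n (\<lambda>y x. F (join_coords m n y x))"
proof (induction rule: poly_funs.induct)
  case (const c)
  show ?case using is_tensor_simple[OF poly_funs.const[of c] poly_funs.const[of 1]] by simp
next
  case (coord i)
  show ?case
  proof (cases "i < m")
    case True
    then show ?thesis
      using is_tensor_simple[OF poly_funs.coord[of i m] poly_funs.const[of 1]]
      by (simp add: join_coords_def)
  next
    case False
    then show ?thesis
      using is_tensor_simple[OF poly_funs.const[of 1 m] poly_funs.coord[of "i - m" n]] coord less_diff_conv2[of m i n]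
      by (simp add: join_coords_def)
  qed
qed (simp_all add: is_tensor_add is_tensor_mult)

text \<open>
  Each of the finitely many functions in a tensor has its own denominators; the products of these, one for each
  factor, serve as common denominators.
\<close>

lemma tensor_funs_clear_denominators:
  fixes Y :: "('b, 'k::field) fspace" and X :: "('a, 'k) fspace"
  assumes cY: "fraction_chart Y m c" and cX: "fraction_chart X n e"
    and U: "openin (Top Y) U" "y \<in> U" and V: "openin (Top X) V" "x \<in> V"
    and t: "t \<in> tensor_funs Y X U V"
  shows "\<exists>P\<in>poly_funs m. \<exists>R\<in>poly_funs n. \<exists>F\<in>poly_funs (m + n). P (c y) \<noteq> 0 \<and> R (e x) \<noteq> 0 \<and>
    (\<forall>y'\<in>points Y. \<forall>x'\<in>points X. P (c y') * R (e x') * t (y', x') = F (join_coords m n (c y') (e x')))"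
proof -
  obtain k :: nat and a b where t': "t = (\<lambda>(y, x). \<Sum>i<k. a i y * b i x)"
    and ab: "\<forall>i<k. a i \<in> Reg Y U \<and> b i \<in> Reg X V"
    using t unfolding tensor_funs_def by blast
  have "\<exists>P\<in>poly_funs m. \<exists>R\<in>poly_funs n. \<exists>F\<in>poly_funs (m + n). P (c y) \<noteq> 0 \<and> R (e x) \<noteq> 0 \<and>
    (\<forall>y'\<in>points Y. \<forall>x'\<in>points X. P (c y') * R (e x') * (\<Sum>i<l. a i y' * b i x') = F (join_coords m n (c y') (e x')))"
    if "l \<le> k" for l
    using that
  proof (induction l)
    case 0
    then show ?case
      by (intro bexI[of _ "\<lambda>_. 1"] bexI[of _ "\<lambda>_. 0"]) (auto intro: poly_funs.const)
  next
    case (Suc l)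
    from Suc.IH[OF Suc_leD[OF Suc.prems]]
    obtain P R F where IH: "P \<in> poly_funs m" "R \<in> poly_funs n" "F \<in> poly_funs (m + n)"
      "P (c y) \<noteq> 0" "R (e x) \<noteq> 0"
      "\<forall>y'\<in>points Y. \<forall>x'\<in>points X.
         P (c y') * R (e x') * (\<Sum>i<l. a i y' * b i x') = F (join_coords m n (c y') (e x'))"
      by (elim bexE conjE)
    have l: "a l \<in> Reg Y U" "b l \<in> Reg X V" using ab Suc.prems by auto
    obtain P1 Q1 where 1: "P1 \<in> poly_funs m" "Q1 \<in> poly_funs m" "P1 (c y) \<noteq> 0"
      "\<And>x. x \<in> points Y \<Longrightarrow> P1 (c x) * a l x = Q1 (c x)"
      by (rule fraction_chartD[OF cY U(1) l(1) U(2)]) (rule that)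
    obtain P2 Q2 where 2: "P2 \<in> poly_funs n" "Q2 \<in> poly_funs n" "P2 (e x) \<noteq> 0"
      "\<And>x. x \<in> points X \<Longrightarrow> P2 (e x) * b l x = Q2 (e x)"
      by (rule fraction_chartD[OF cX V(1) l(2) V(2)]) (rule that)
    let ?r = "\<lambda>p w. p (\<lambda>i. w (i + m))"
    let ?F = "\<lambda>w. (P1 w * ?r P2 w) * F w + (P w * ?r R w) * (Q1 w * ?r Q2 w)"
    have "?F \<in> poly_funs (m + n)"
      by (intro poly_funs.add poly_funs.mult poly_funs_left(1) poly_funs_right(1) IH 1 2)
    moreover have "(P (c y') * P1 (c y')) * (R (e x') * P2 (e x')) * (\<Sum>i<Suc l. a i y' * b i x')
        = ?F (join_coords m n (c y') (e x'))" if "y' \<in> points Y" "x' \<in> points X" for y' x'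
    proof -
      have "(P (c y') * P1 (c y')) * (R (e x') * P2 (e x')) * (\<Sum>i<Suc l. a i y' * b i x')
        = (P1 (c y') * P2 (e x')) * (P (c y') * R (e x') * (\<Sum>i<l. a i y' * b i x'))
          + (P (c y') * R (e x')) * ((P1 (c y') * a l y') * (P2 (e x') * b l x'))"
        by (simp add: algebra_simps)
      also have "\<dots> = ?F (join_coords m n (c y') (e x'))"
        using IH(1,2) 1(1,2) 2(1,2)
        by (simp only: IH(6)[rule_format, OF that] 1(4)[OF that(1)] 2(4)[OF that(2)] poly_funs_left(2) poly_funs_right(2))
      finally show ?thesis .
    qed
    moreover have "(\<lambda>w. P w * P1 w) \<in> poly_funs m" "(\<lambda>w. R w * P2 w) \<in> poly_funs n"
      by (intro poly_funs.mult IH 1 2)+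
    ultimately show ?case using IH(4,5) 1(3) 2(3)
      by (intro bexI[of _ "\<lambda>w. P w * P1 w"] bexI[of _ "\<lambda>w. R w * P2 w"] bexI[of _ ?F]) simp_all
  qed
  from this[of k] show ?thesis by (simp add: t')
qed

lemma chart_off_separates:
  assumes "chart_off Y n c q" "w \<in> {..<n} \<rightarrow>\<^sub>E UNIV" "w \<notin> c ` points Y" "q w \<noteq> 0"
  obtains p where "p \<in> poly_funs n" "p w \<noteq> 0" "\<forall>y\<in>points Y. p (c y) = 0"
  using assms(1)[unfolded chart_off_def, THEN conjunct2, THEN conjunct2, THEN conjunct2, THEN bspec,
      OF assms(2), THEN mp, OF assms(3), THEN mp, OF assms(4)]
  by (elim bexE conjE) (rule that)

text \<open>
  The polynomials \<open>G\<close> for which \<open>G h\<close> is a polynomial form an ideal. Near every point of the product \<open>h\<close> is a fraction, so the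
  ideal has no zero on the product, and it contains the equations of the product. Hence it has no zero with \<open>q \<noteq> 0\<close>, and by
  the Nullstellensatz it contains a power of \<open>q\<close>.
\<close>

theorem regular_on_product:
  fixes Y :: "('b, 'k::{alg_closed_field, field_char_0}) fspace" and X :: "('a, 'k) fspace"
  assumes Y: "function_sheaf Y" "chart_off Y m c q" and X: "function_sheaf X" "chart_off X n e (\<lambda>_. 1)"
    and h: "\<And>p. p \<in> points Y \<times> points X \<Longrightarrow> \<exists>U V f g. openin (Top Y) U \<and> openin (Top X) V \<and>
      f \<in> tensor_funs Y X U V \<and> g \<in> tensor_funs Y X U V \<and> p \<in> nonvanishing (U \<times> V) g \<and>
      (\<forall>p'\<in>nonvanishing (U \<times> V) g. h p' = f p' / g p')"
  shows "\<exists>N k a b. (\<forall>j<(k::nat). a j \<in> poly_funs m \<and> b j \<in> poly_funs n) \<and>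
    (\<forall>y\<in>points Y. \<forall>x\<in>points X. q (c y) ^ N * h (y, x) = (\<Sum>j<k. a j (c y) * b j (e x)))"
proof -
  let ?j = "\<lambda>y x. join_coords m n (c y) (e x)"
  have cY: "fraction_chart Y m c" and q: "q \<in> poly_funs m" and cX: "fraction_chart X n e"
    using Y(2) X(2) by (auto simp: chart_off_def)
  define J where "J = {G \<in> poly_funs (m + n). \<exists>F\<in>poly_funs (m + n).
    \<forall>y\<in>points Y. \<forall>x\<in>points X. G (?j y x) * h (y, x) = F (?j y x)}"
  have "J = {G \<in> poly_funs (m + n). \<exists>F\<in>poly_funs (m + n). \<forall>p\<in>points Y \<times> points X.
      G ((\<lambda>(y, x). ?j y x) p) * h p = F ((\<lambda>(y, x). ?j y x) p) * 1}"
    unfolding J_def by simp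
  then have J: "ideal_of (poly_funs (m + n)) J" by (simp only: ideal_of_denominators)
  have zero_in_J: "p \<in> J" if "p \<in> poly_funs (m + n)" "\<And>y x. y \<in> points Y \<Longrightarrow> x \<in> points X \<Longrightarrow> p (?j y x) = 0" for p
    unfolding J_def using that subring_setD(2)[OF subring_poly_funs, of "m + n"]
    by (intro CollectI conjI bexI[of _ 0]) auto
  have nonzero_in_J: "\<exists>G\<in>J. G (?j y x) \<noteq> 0" if y: "y \<in> points Y" and x: "x \<in> points X" for y x
  proof -
    have "(y, x) \<in> points Y \<times> points X" using y x by simp
    from h[OF this] obtain U V f g where 1: "openin (Top Y) U" "openin (Top X) V"
      "f \<in> tensor_funs Y X U V" "g \<in> tensor_funs Y X U V" "(y, x) \<in> nonvanishing (U \<times> V) g"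
      "\<forall>p'\<in>nonvanishing (U \<times> V) g. h p' = f p' / g p'" by (elim exE conjE)
    have yU: "y \<in> U" and xV: "x \<in> V" and g0: "g (y, x) \<noteq> 0" using 1(5) by (auto simp: nonvanishing_def)
    obtain PU where PU: "PU \<in> poly_funs m" "PU (c y) \<noteq> 0" "\<And>x. x \<in> points Y \<Longrightarrow> x \<notin> U \<Longrightarrow> PU (c x) = 0"
      by (rule fraction_chart_separates[OF Y(1) cY 1(1) yU]) (rule that)
    obtain PV where PV: "PV \<in> poly_funs n" "PV (e x) \<noteq> 0" "\<And>y. y \<in> points X \<Longrightarrow> y \<notin> V \<Longrightarrow> PV (e y) = 0"
      by (rule fraction_chart_separates[OF X(1) cX 1(2) xV]) (rule that)
    obtain Pf Rf Ff where f: "Pf \<in> poly_funs m" "Rf \<in> poly_funs n" "Ff \<in> poly_funs (m + n)"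
      "Pf (c y) \<noteq> 0" "Rf (e x) \<noteq> 0"
      "\<forall>y\<in>points Y. \<forall>x\<in>points X. Pf (c y) * Rf (e x) * f (y, x) = Ff (?j y x)"
      using tensor_funs_clear_denominators[OF cY cX 1(1) yU 1(2) xV 1(3)] by (elim bexE conjE)
    obtain Pg Rg Fg where g: "Pg \<in> poly_funs m" "Rg \<in> poly_funs n" "Fg \<in> poly_funs (m + n)"
      "Pg (c y) \<noteq> 0" "Rg (e x) \<noteq> 0"
      "\<forall>y\<in>points Y. \<forall>x\<in>points X. Pg (c y) * Rg (e x) * g (y, x) = Fg (?j y x)"
      using tensor_funs_clear_denominators[OF cY cX 1(1) yU 1(2) xV 1(4)] by (elim bexE conjE)
    let ?r = "\<lambda>p w. p (\<lambda>i. w (i + m))"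
    \<comment> \<open>The factors \<open>PU\<close>, \<open>PV\<close> and the second \<open>Fg\<close> make both sides of \<open>G h = F\<close> vanish wherever \<open>h\<close> is not
        known to be \<open>f / g\<close>.\<close>
    let ?G = "\<lambda>w. (PU w * ?r PV w) * ((Pf w * ?r Rf w) * (Fg w * Fg w))"
    let ?F = "\<lambda>w. (PU w * ?r PV w) * ((Pg w * ?r Rg w) * (Ff w * Fg w))"
    have pG: "?G \<in> poly_funs (m + n)" and pF: "?F \<in> poly_funs (m + n)"
      by (intro poly_funs.mult poly_funs_left(1) poly_funs_right(1) f g PU PV)+
    note ev = poly_funs_left(2)[OF PU(1)] poly_funs_left(2)[OF f(1)] poly_funs_left(2)[OF g(1)]
      poly_funs_right(2)[OF PV(1)] poly_funs_right(2)[OF f(2)] poly_funs_right(2)[OF g(2)]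
    have "?G (?j y' x') * h (y', x') = ?F (?j y' x')" if y': "y' \<in> points Y" and x': "x' \<in> points X" for y' x'
    proof (cases "y' \<in> U \<and> x' \<in> V \<and> g (y', x') \<noteq> 0")
      case True
      then have "h (y', x') = f (y', x') / g (y', x')" using 1(6) by (auto simp: nonvanishing_def)
      with True have hg: "g (y', x') * h (y', x') = f (y', x')" by simp
      have "?G (?j y' x') * h (y', x') = (PU (c y') * PV (e x')) * ((Pf (c y') * Rf (e x')) *
          ((Pg (c y') * Rg (e x')) * (g (y', x') * h (y', x')) * Fg (?j y' x')))"
        by (simp only: ev g(6)[rule_format, OF y' x', symmetric] mult_ac)
      also have "\<dots> = ?F (?j y' x')"
        by (simp only: hg ev f(6)[rule_format, OF y' x', symmetric] mult_ac)
      finally show ?thesis .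
    next
      case False
      then have "PU (c y') = 0 \<or> PV (e x') = 0 \<or> Fg (?j y' x') = 0"
        using PU(3)[OF y'] PV(3)[OF x'] g(6)[rule_format, OF y' x'] by auto
      then show ?thesis by (auto simp: ev)
    qed
    then have GJ: "?G \<in> J" unfolding J_def by (intro CollectI conjI pG bexI[OF _ pF] ballI)
    have "Fg (?j y x) \<noteq> 0" using g(4,5) g0 by (simp add: g(6)[rule_format, OF y x, symmetric])
    then have "?G (?j y x) \<noteq> 0" using PU(2) PV(2) f(4,5) by (simp add: ev)
    then show ?thesis by (rule bexI[OF _ GJ])
  qed
  have "\<exists>N. q ^ N \<in> J"
  proof (rule nullstellensatz[OF J poly_funs_left(1)[OF q]])
    fix w :: "nat \<Rightarrow> 'k" assume w: "w \<in> {..<m + n} \<rightarrow>\<^sub>E UNIV" and van: "\<And>G. G \<in> J \<Longrightarrow> G w = 0"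
    show "q w = 0"
    proof (rule ccontr)
      assume qw: "q w \<noteq> 0"
      let ?y = "restrict w {..<m}" and ?x = "restrict (\<lambda>i. w (i + m)) {..<n}"
      have wj: "w = join_coords m n ?y ?x"
        using w by (auto simp: join_coords_def fun_eq_iff PiE_def extensional_def)
      have qy: "q ?y \<noteq> 0" using qw wj poly_funs_left(2)[OF q, of n ?y ?x] by simp
      have "?y \<in> c ` points Y"
      proof (rule ccontr)
        assume no: "?y \<notin> c ` points Y"
        have y_ext: "?y \<in> {..<m} \<rightarrow>\<^sub>E UNIV" by auto
        obtain p where p: "p \<in> poly_funs m" "p ?y \<noteq> 0" "\<forall>y\<in>points Y. p (c y) = 0"
          by (rule chart_off_separates[OF Y(2) y_ext no qy])
        have "p \<in> J" using zero_in_J[OF poly_funs_left(1)[OF p(1)]] p(3) poly_funs_left(2)[OF p(1)] by simp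
        then have "p w = 0" by (rule van)
        then show False using p(2) wj poly_funs_left(2)[OF p(1), of n ?y ?x] by simp
      qed
      moreover have "?x \<in> e ` points X"
      proof (rule ccontr)
        assume no: "?x \<notin> e ` points X"
        have x_ext: "?x \<in> {..<n} \<rightarrow>\<^sub>E UNIV" by auto
        obtain p where p: "p \<in> poly_funs n" "p ?x \<noteq> 0" "\<forall>y\<in>points X. p (e y) = 0"
          by (rule chart_off_separates[OF X(2) x_ext no one_neq_zero])
        have "(\<lambda>w. p (\<lambda>i. w (i + m))) \<in> J"
          using zero_in_J[OF poly_funs_right(1)[OF p(1)]] p(3) poly_funs_right(2)[OF p(1)] by simp
        then show False using van[of "\<lambda>w. p (\<lambda>i. w (i + m))"] p(2) wj poly_funs_right(2)[OF p(1), of m ?y ?x] by simp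
      qed
      ultimately obtain y x where "y \<in> points Y" "x \<in> points X" "w = ?j y x" using wj by auto
      then show False using nonzero_in_J van by blast
    qed
  qed
  then obtain N F where F: "q ^ N \<in> poly_funs (m + n)" "F \<in> poly_funs (m + n)"
    "\<forall>y\<in>points Y. \<forall>x\<in>points X. (q ^ N) (?j y x) * h (y, x) = F (?j y x)"
    unfolding J_def by (elim exE CollectE conjE bexE)
  obtain k :: nat and a b where "\<forall>j<k. a j \<in> poly_funs m \<and> b j \<in> poly_funs n"
    "\<forall>y x. F (join_coords m n y x) = (\<Sum>j<k. a j y * b j x)"
    using poly_funs_join_is_tensor[OF F(2)] unfolding is_tensor_def by blast
  moreover have "(q ^ N) (?j y x) = q (c y) ^ N" for y x
    using poly_funs_left(2)[OF q] by (simp add: power_fun_apply)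
  ultimately show ?thesis using F(3)
    by (intro exI[of _ N] exI[of _ k] exI[of _ a] exI[of _ b]) auto
qed

section \<open>Algebras with a torus action\<close>

text \<open>
  After multiplication by a power of \<open>t\<close> this is a polynomial with infinitely many roots.
\<close>

lemma laurent_polynomial_zero:
  fixes a :: "int \<Rightarrow> 'k::field_char_0"
  assumes S: "finite S" and zero: "\<And>t. t \<noteq> 0 \<Longrightarrow> (\<Sum>k\<in>S. t powi k * a k) = 0" and k: "k \<in> S"
  shows "a k = 0"
proof -
  obtain M :: nat where M: "\<And>k. k \<in> S \<Longrightarrow> - int M \<le> k"
  proof -
    define B where "B = Max ((\<lambda>k. nat (- k)) ` S)"
    have "nat (- k) \<le> B" if "k \<in> S" for k using that S by (simp add: B_def)
    then show ?thesis using that[of B] by (smt (verit) nat_le_iff)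
  qed
  let ?e = "\<lambda>k. nat (k + int M)"
  define p where "p = (\<Sum>k\<in>S. monom (a k) (?e k))"
  have root: "poly p t = 0" if t: "t \<noteq> 0" for t :: 'k
  proof -
    have "poly p t = (\<Sum>k\<in>S. t ^ M * (t powi k * a k))"
      unfolding p_def poly_sum poly_monom
    proof (rule sum.cong[OF refl])
      fix k assume "k \<in> S"
      then have "0 \<le> k + int M" using M[of k] by simp
      then have "t ^ ?e k = t powi (k + int M)" by (simp add: power_int_def)
      also have "\<dots> = t powi k * t ^ M" using t by (simp add: power_int_add)
      finally show "a k * t ^ ?e k = t ^ M * (t powi k * a k)" by simp
    qed
    also have "\<dots> = 0" using zero[OF t] by (simp add: sum_distrib_left[symmetric])
    finally show ?thesis .
  qed
  have "p = 0"
  proof (rule ccontr)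
    assume "p \<noteq> 0"
    then have "finite {t. poly p t = 0}" by (rule poly_roots_finite)
    moreover have "UNIV - {0} \<subseteq> {t. poly p t = 0}" using root by auto
    ultimately have "finite (UNIV - {0 :: 'k})" by (rule finite_subset[rotated])
    then show False using infinite_UNIV_char_0[where 'a = 'k] by simp
  qed
  then have "0 = coeff p (?e k)" by simp
  also have "\<dots> = (\<Sum>l\<in>S. if l = k then a l else 0)"
    unfolding p_def coeff_sum
  proof (rule sum.cong[OF refl])
    fix l assume "l \<in> S"
    then have "?e l = ?e k \<longleftrightarrow> l = k" using M[of l] M[OF k] by auto
    then show "coeff (monom (a l) (?e l)) (?e k) = (if l = k then a l else 0)" by simp
  qed
  also have "\<dots> = a k" using S k by simp
  finally show ?thesis by simp
qed

text \<open>
  The coordinate ring of an irreducible variety with a torus action. Only the values on the point set \<open>E\<close> count: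
  elements of \<open>A\<close> are compared there (\<open>cong\<close>), and "zero" means zero on \<open>E\<close>. The last assumption says that the
  action is algebraic: along the orbit of \<open>x\<close> a function is a Laurent polynomial in \<open>t\<close> with coefficients in \<open>A\<close>.
\<close>

locale weighted_algebra =
  fixes E :: "'a set" and A :: "('a \<Rightarrow> 'k::{alg_closed_field, field_char_0}) set"
    and act :: "'k \<Rightarrow> 'a \<Rightarrow> 'a"
  assumes nonempty: "E \<noteq> {}"
    and const_in: "(\<lambda>_. \<kappa>) \<in> A"
    and add_in: "f \<in> A \<Longrightarrow> g \<in> A \<Longrightarrow> (\<lambda>x. f x + g x) \<in> A"
    and mult_in: "f \<in> A \<Longrightarrow> g \<in> A \<Longrightarrow> (\<lambda>x. f x * g x) \<in> A"
    and cong: "f \<in> A \<Longrightarrow> (\<And>x. x \<in> E \<Longrightarrow> f x = g x) \<Longrightarrow> g \<in> A"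
    and dom: "f \<in> A \<Longrightarrow> g \<in> A \<Longrightarrow> (\<And>x. x \<in> E \<Longrightarrow> f x * g x = 0) \<Longrightarrow>
       (\<forall>x\<in>E. f x = 0) \<or> (\<forall>x\<in>E. g x = 0)"
    and act_in: "t \<noteq> 0 \<Longrightarrow> x \<in> E \<Longrightarrow> act t x \<in> E"
    and act_one: "x \<in> E \<Longrightarrow> act 1 x = x"
    and act_act: "s \<noteq> 0 \<Longrightarrow> t \<noteq> 0 \<Longrightarrow> x \<in> E \<Longrightarrow> act s (act t x) = act (s * t) x"
    and weights: "f \<in> A \<Longrightarrow> \<exists>S F. finite S \<and> (\<forall>k. F k \<in> A) \<and>
       (\<forall>t x. t \<noteq> 0 \<longrightarrow> x \<in> E \<longrightarrow> f (act t x) = (\<Sum>k\<in>S. t powi k * F k x))"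
begin

definition vanishes :: "('a \<Rightarrow> 'k) \<Rightarrow> bool" where
  "vanishes f \<longleftrightarrow> (\<forall>x\<in>E. f x = 0)"

definition homog :: "int \<Rightarrow> ('a \<Rightarrow> 'k) set" where
  "homog k = {f \<in> A. \<forall>t x. t \<noteq> 0 \<longrightarrow> x \<in> E \<longrightarrow> f (act t x) = t powi k * f x}"

lemma diff: "f \<in> A \<Longrightarrow> g \<in> A \<Longrightarrow> (\<lambda>x. f x - g x) \<in> A"
  using add_in[OF _ mult_in[OF const_in[of "- 1"]], of f g] by simp

lemma power: "f \<in> A \<Longrightarrow> (\<lambda>x. f x ^ n) \<in> A"
  by (induction n) (simp_all add: const_in mult_in)

lemma sum_in: "(\<And>i. i \<in> S \<Longrightarrow> F i \<in> A) \<Longrightarrow> (\<lambda>x. \<Sum>i\<in>S. F i x) \<in> A"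
  by (induction S rule: infinite_finite_induct) (simp_all add: const_in add_in)

lemma prod_in: "(\<And>i. i \<in> S \<Longrightarrow> F i \<in> A) \<Longrightarrow> (\<lambda>x. \<Prod>i\<in>S. F i x) \<in> A"
  by (induction S rule: infinite_finite_induct) (simp_all add: const_in mult_in)

lemma vanishes_mult:
  "f \<in> A \<Longrightarrow> g \<in> A \<Longrightarrow> vanishes (\<lambda>x. f x * g x) \<longleftrightarrow> vanishes f \<or> vanishes g"
  using dom[of f g] by (auto simp: vanishes_def)

lemma vanishes_power: "f \<in> A \<Longrightarrow> vanishes (\<lambda>x. f x ^ n) \<Longrightarrow> vanishes f"
proof (induction n)
  case 0
  then show ?case using nonempty by (auto simp: vanishes_def)
next
  case (Suc n)
  then show ?case using vanishes_mult[OF Suc.prems(1) power[OF Suc.prems(1)], of n] by auto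
qed

lemma cancel:
  assumes "f \<in> A" "g \<in> A" "h \<in> A" "\<not> vanishes f" "\<And>x. x \<in> E \<Longrightarrow> f x * g x = f x * h x" "x \<in> E"
  shows "g x = h x"
proof -
  have "vanishes (\<lambda>x. f x * (g x - h x))" using assms(5) by (simp add: vanishes_def algebra_simps)
  then have "vanishes (\<lambda>x. g x - h x)"
    using vanishes_mult[OF assms(1) diff[OF assms(2,3)]] assms(4) by blast
  then show ?thesis using assms(6) by (simp add: vanishes_def)
qed

lemma homogI: "f \<in> A \<Longrightarrow> (\<And>t x. t \<noteq> 0 \<Longrightarrow> x \<in> E \<Longrightarrow> f (act t x) = t powi k * f x) \<Longrightarrow> f \<in> homog k"
  by (simp add: homog_def)

lemma homogD: "f \<in> homog k \<Longrightarrow> f \<in> A" "f \<in> homog k \<Longrightarrow> t \<noteq> 0 \<Longrightarrow> x \<in> E \<Longrightarrow> f (act t x) = t powi k * f x"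
  by (auto simp: homog_def)

lemma homog_cong: "f \<in> homog k \<Longrightarrow> (\<And>x. x \<in> E \<Longrightarrow> f x = g x) \<Longrightarrow> g \<in> homog k"
  using cong[of f g] act_in by (auto simp: homog_def)

lemma homog_const: "(\<lambda>_. \<kappa>) \<in> homog 0"
  by (simp add: homog_def const_in)

lemma homog_vanishes: "vanishes f \<Longrightarrow> f \<in> homog k"
  by (intro homog_cong[of "\<lambda>_. 0" k f] homogI const_in) (auto simp: vanishes_def)

lemma homog_add: "f \<in> homog k \<Longrightarrow> g \<in> homog k \<Longrightarrow> (\<lambda>x. f x + g x) \<in> homog k"
  by (auto simp: homog_def add_in algebra_simps)

lemma homog_mult: "f \<in> homog k \<Longrightarrow> g \<in> homog l \<Longrightarrow> (\<lambda>x. f x * g x) \<in> homog (k + l)"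
  by (auto simp: homog_def mult_in power_int_add)

lemma homog_mult0: "f \<in> homog 0 \<Longrightarrow> g \<in> homog l \<Longrightarrow> (\<lambda>x. f x * g x) \<in> homog l"
  using homog_mult[of f 0 g l] by simp

lemma homog_power: "f \<in> homog k \<Longrightarrow> (\<lambda>x. f x ^ n) \<in> homog (int n * k)"
proof (induction n)
  case (Suc n)
  then show ?case using homog_mult[OF Suc.prems Suc.IH[OF Suc.prems]] by (simp add: algebra_simps)
qed (simp add: homog_const)

lemma homog_power0: "f \<in> homog 0 \<Longrightarrow> (\<lambda>x. f x ^ n) \<in> homog 0"
  using homog_power[of f 0 n] by simp

lemma homog_sum: "(\<And>i. i \<in> S \<Longrightarrow> F i \<in> homog k) \<Longrightarrow> (\<lambda>x. \<Sum>i\<in>S. F i x) \<in> homog k"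
proof (induction S rule: infinite_finite_induct)
  case (insert i S)
  then show ?case by (simp add: homog_add)
qed (simp_all add: homog_vanishes vanishes_def)

lemma homog_prod: "(\<And>i. i \<in> S \<Longrightarrow> F i \<in> homog (w i)) \<Longrightarrow> (\<lambda>x. \<Prod>i\<in>S. F i x) \<in> homog (\<Sum>i\<in>S. w i)"
proof (induction S rule: infinite_finite_induct)
  case (insert i S)
  then show ?case by (simp add: homog_mult)
qed (simp_all add: homog_const)

subsection \<open>Homogeneous components\<close>

text \<open>
  The weight components of \<open>f\<close>. Some choice of coefficients is needed since Laurent expansions are determined on \<open>E\<close> only;
  outside the finite support the components are zero everywhere, so that sums over different supports agree.
\<close>

definition part :: "('a \<Rightarrow> 'k) \<Rightarrow> int \<Rightarrow> 'a \<Rightarrow> 'k" where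
  "part f = (SOME F. (\<forall>k. F k \<in> A) \<and> (\<exists>S. finite S \<and> (\<forall>k. k \<notin> S \<longrightarrow> F k = (\<lambda>_. 0)) \<and>
     (\<forall>t x. t \<noteq> 0 \<longrightarrow> x \<in> E \<longrightarrow> f (act t x) = (\<Sum>k\<in>S. t powi k * F k x))))"

lemma part_spec:
  assumes "f \<in> A"
  shows part_in: "part f k \<in> A"
    and part_act: "\<exists>S. finite S \<and> (\<forall>k. k \<notin> S \<longrightarrow> part f k = (\<lambda>_. 0)) \<and>
       (\<forall>t x. t \<noteq> 0 \<longrightarrow> x \<in> E \<longrightarrow> f (act t x) = (\<Sum>k\<in>S. t powi k * part f k x))"
proof -
  let ?P = "\<lambda>F. (\<forall>k. F k \<in> A) \<and> (\<exists>S. finite S \<and> (\<forall>k. k \<notin> S \<longrightarrow> F k = (\<lambda>_. 0)) \<and>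
     (\<forall>t x. t \<noteq> 0 \<longrightarrow> x \<in> E \<longrightarrow> f (act t x) = (\<Sum>k\<in>S. t powi k * F k x)))"
  obtain S F where "finite S" and SF: "\<forall>k. F k \<in> A"
    "\<forall>t x. t \<noteq> 0 \<longrightarrow> x \<in> E \<longrightarrow> f (act t x) = (\<Sum>k\<in>S. t powi k * F k x)"
    using weights[OF assms] by (elim exE conjE)
  have "?P (\<lambda>k. if k \<in> S then F k else (\<lambda>_. 0))"
  proof (intro conjI allI exI[of _ S] impI)
    fix t :: 'k and x assume "t \<noteq> 0" "x \<in> E"
    then have "f (act t x) = (\<Sum>k\<in>S. t powi k * F k x)" using SF(2) by simp
    also have "\<dots> = (\<Sum>k\<in>S. t powi k * (if k \<in> S then F k else (\<lambda>_. 0)) x)"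
      by (rule sum.cong) auto
    finally show "f (act t x) = (\<Sum>k\<in>S. t powi k * (if k \<in> S then F k else (\<lambda>_. 0)) x)" .
  qed (use \<open>finite S\<close> SF(1) const_in in auto)
  then have *: "?P (part f)" unfolding part_def by (rule someI[of ?P])
  then show "part f k \<in> A" by blast
  from * show "\<exists>S. finite S \<and> (\<forall>k. k \<notin> S \<longrightarrow> part f k = (\<lambda>_. 0)) \<and>
       (\<forall>t x. t \<noteq> 0 \<longrightarrow> x \<in> E \<longrightarrow> f (act t x) = (\<Sum>k\<in>S. t powi k * part f k x))" by (rule conjunct2)
qed

lemma part_support:
  assumes "f \<in> A"
  obtains S where "finite S" "\<And>k. k \<notin> S \<Longrightarrow> part f k = (\<lambda>_. 0)"
    "\<And>t x. t \<noteq> 0 \<Longrightarrow> x \<in> E \<Longrightarrow> f (act t x) = (\<Sum>k\<in>S. t powi k * part f k x)"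
    "\<And>x. x \<in> E \<Longrightarrow> f x = (\<Sum>k\<in>S. part f k x)"
proof -
  obtain S where S: "finite S" "\<forall>k. k \<notin> S \<longrightarrow> part f k = (\<lambda>_. 0)"
    "\<forall>t x. t \<noteq> 0 \<longrightarrow> x \<in> E \<longrightarrow> f (act t x) = (\<Sum>k\<in>S. t powi k * part f k x)"
    using part_act[OF assms] by (elim exE conjE)
  have "f x = (\<Sum>k\<in>S. part f k x)" if "x \<in> E" for x
    using S(3)[rule_format, OF one_neq_zero that] act_one[OF that] by simp
  with S show ?thesis using that[of S] by blast
qed

text \<open>
  The coefficients \<open>a\<close> are numbers, as expansions are compared on one orbit at a time.
\<close>

lemma part_unique:
  assumes f: "f \<in> A" and T: "finite T" "\<And>k. k \<notin> T \<Longrightarrow> a k = 0" and x: "x \<in> E"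
    and eq: "\<And>t. t \<noteq> 0 \<Longrightarrow> f (act t x) = (\<Sum>k\<in>T. t powi k * a k)"
  shows "part f k x = a k"
proof -
  obtain S where S: "finite S" "\<And>k. k \<notin> S \<Longrightarrow> part f k = (\<lambda>_. 0)"
    "\<And>t x. t \<noteq> 0 \<Longrightarrow> x \<in> E \<Longrightarrow> f (act t x) = (\<Sum>k\<in>S. t powi k * part f k x)"
    by (rule part_support[OF f]) (rule that)
  show ?thesis
  proof (cases "k \<in> S \<union> T")
    case True
    have "(\<Sum>k\<in>S \<union> T. t powi k * (part f k x - a k)) = 0" if t: "t \<noteq> 0" for t :: 'k
    proof -
      have "(\<Sum>k\<in>S \<union> T. t powi k * part f k x) = (\<Sum>k\<in>S. t powi k * part f k x)"
        using S T by (intro sum.mono_neutral_right) auto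
      moreover have "(\<Sum>k\<in>S \<union> T. t powi k * a k) = (\<Sum>k\<in>T. t powi k * a k)"
        using S T by (intro sum.mono_neutral_right) auto
      ultimately show ?thesis
        using S(3)[OF t x] eq[OF t] by (simp add: right_diff_distrib sum_subtractf)
    qed
    from laurent_polynomial_zero[OF _ this True] show ?thesis using S(1) T(1) by simp
  next
    case False
    then show ?thesis using S(2) T(2) by simp
  qed
qed

lemma part_homog:
  assumes f: "f \<in> A"
  shows "part f k \<in> homog k"
proof (rule homogI)
  show "part f k \<in> A" by (rule part_in[OF f])
  fix t :: 'k and x assume t: "t \<noteq> 0" and x: "x \<in> E"
  obtain S where S: "finite S" "\<And>k. k \<notin> S \<Longrightarrow> part f k = (\<lambda>_. 0)"
    "\<And>t x. t \<noteq> 0 \<Longrightarrow> x \<in> E \<Longrightarrow> f (act t x) = (\<Sum>k\<in>S. t powi k * part f k x)"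
    by (rule part_support[OF f]) (rule that)
  show "part f k (act t x) = t powi k * part f k x"
  proof (rule part_unique[OF f S(1) _ act_in[OF t x]])
    fix s :: 'k assume s: "s \<noteq> 0"
    show "f (act s (act t x)) = (\<Sum>k\<in>S. s powi k * (t powi k * part f k x))"
      using S(3)[of "s * t" x] s t x by (simp add: act_act power_int_mult_distrib mult.assoc)
  qed (simp add: S(2))
qed

lemma part_cong:
  assumes f: "f \<in> A" and eq: "\<And>x. x \<in> E \<Longrightarrow> f x = g x" and x: "x \<in> E"
  shows "part g k x = part f k x"
proof -
  obtain S where S: "finite S" "\<And>k. k \<notin> S \<Longrightarrow> part f k = (\<lambda>_. 0)"
    "\<And>t x. t \<noteq> 0 \<Longrightarrow> x \<in> E \<Longrightarrow> f (act t x) = (\<Sum>k\<in>S. t powi k * part f k x)"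
    by (rule part_support[OF f]) (rule that)
  show ?thesis
  proof (rule part_unique[OF cong[OF f eq] S(1) _ x])
    fix t :: 'k assume t: "t \<noteq> 0"
    show "g (act t x) = (\<Sum>k\<in>S. t powi k * part f k x)"
      using S(3)[OF t x] eq[OF act_in[OF t x]] by simp
  qed (simp_all add: S(2))
qed

lemma part_add:
  assumes f: "f \<in> A" and g: "g \<in> A" and x: "x \<in> E"
  shows "part (\<lambda>x. f x + g x) k x = part f k x + part g k x"
proof -
  obtain S where S: "finite S" "\<And>k. k \<notin> S \<Longrightarrow> part f k = (\<lambda>_. 0)"
    "\<And>t x. t \<noteq> 0 \<Longrightarrow> x \<in> E \<Longrightarrow> f (act t x) = (\<Sum>k\<in>S. t powi k * part f k x)"
    by (rule part_support[OF f]) (rule that)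
  obtain T where T: "finite T" "\<And>k. k \<notin> T \<Longrightarrow> part g k = (\<lambda>_. 0)"
    "\<And>t x. t \<noteq> 0 \<Longrightarrow> x \<in> E \<Longrightarrow> g (act t x) = (\<Sum>k\<in>T. t powi k * part g k x)"
    by (rule part_support[OF g]) (rule that)
  show ?thesis
  proof (rule part_unique[OF add_in[OF f g] _ _ x, of "S \<union> T"])
    fix t :: 'k assume t: "t \<noteq> 0"
    have "(\<Sum>k\<in>S. t powi k * part f k x) = (\<Sum>k\<in>S \<union> T. t powi k * part f k x)"
      using S(1,2) T(1) by (intro sum.mono_neutral_left) auto
    moreover have "(\<Sum>k\<in>T. t powi k * part g k x) = (\<Sum>k\<in>S \<union> T. t powi k * part g k x)"
      using T(1,2) S(1) by (intro sum.mono_neutral_left) auto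
    ultimately show "f (act t x) + g (act t x) = (\<Sum>k\<in>S \<union> T. t powi k * (part f k x + part g k x))"
      using S(3)[OF t x] T(3)[OF t x] by (simp add: distrib_left sum.distrib)
  qed (use S T in auto)
qed

lemma part_mult_homog:
  assumes h: "h \<in> homog d" and f: "f \<in> A" and x: "x \<in> E"
  shows "part (\<lambda>x. h x * f x) k x = h x * part f (k - d) x"
proof -
  obtain S where S: "finite S" "\<And>k. k \<notin> S \<Longrightarrow> part f k = (\<lambda>_. 0)"
    "\<And>t x. t \<noteq> 0 \<Longrightarrow> x \<in> E \<Longrightarrow> f (act t x) = (\<Sum>k\<in>S. t powi k * part f k x)"
    by (rule part_support[OF f]) (rule that)
  show ?thesis
  proof (rule part_unique[OF mult_in[OF homogD(1)[OF h] f] _ _ x, of "(\<lambda>k. k + d) ` S"])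
    fix t :: 'k assume t: "t \<noteq> 0"
    have "(\<Sum>k\<in>(\<lambda>k. k + d) ` S. t powi k * (h x * part f (k - d) x))
        = (\<Sum>k\<in>S. t powi (k + d) * (h x * part f k x))"
      by (subst sum.reindex) (auto simp: inj_on_def)
    also have "\<dots> = (t powi d * h x) * (\<Sum>k\<in>S. t powi k * part f k x)"
      using t by (simp add: power_int_add sum_distrib_left mult_ac)
    finally show "h (act t x) * f (act t x) = (\<Sum>k\<in>(\<lambda>k. k + d) ` S. t powi k * (h x * part f (k - d) x))"
      using homogD(2)[OF h t x] S(3)[OF t x] by simp
  next
    fix k assume "k \<notin> (\<lambda>k. k + d) ` S"
    then have "k - d \<notin> S" by force
    then show "h x * part f (k - d) x = 0" using S(2) by simp
  qed (use S in auto)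
qed

lemma part_of_homog:
  assumes h: "h \<in> homog d" and x: "x \<in> E"
  shows "part h k x = (if k = d then h x else 0)"
  by (rule part_unique[OF homogD(1)[OF h] _ _ x, of "{d}"]) (use homogD(2)[OF h _ x] in auto)

lemma homog_unique: 
  assumes "f \<in> homog k" "f \<in> homog l" "k \<noteq> l"
  shows "vanishes f"
  unfolding vanishes_def
proof
  fix x assume x: "x \<in> E"
  show "f x = 0" using part_of_homog[OF assms(1) x, of k] part_of_homog[OF assms(2) x, of k] assms(3) by simp
qed

lemma homog_quotient:
  assumes f: "f \<in> homog k" and g: "g \<in> homog l" "\<not> vanishes g" and h: "h \<in> A"
    and eq: "\<And>x. x \<in> E \<Longrightarrow> f x = g x * h x"
  shows "h \<in> homog (k - l)"
proof (rule homog_cong[OF part_homog[OF h]])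
  fix x assume x: "x \<in> E"
  have "g x * part h (k - l) x = g x * h x" if x: "x \<in> E" for x
  proof -
    have "g x * part h (k - l) x = part (\<lambda>x. g x * h x) k x"
      by (rule part_mult_homog[OF g(1) h x, symmetric])
    also have "\<dots> = part f k x" by (rule part_cong[OF homogD(1)[OF f] eq x])
    also have "\<dots> = g x * h x" using part_of_homog[OF f x] eq[OF x] by simp
    finally show ?thesis .
  qed
  then show "part h (k - l) x = h x"
    by (rule cancel[OF homogD(1)[OF g(1)] part_in[OF h] h g(2) _ x])
qed

text \<open>
  More vectors (indexed by \<open>K\<close>) than coordinates (indexed by \<open>B\<close>) are dependent over a domain \<open>C\<close>. One coordinate is eliminated at
  a time; as \<open>C\<close> has no division, the vectors are cleared by cross-multiplication with the pivot \<open>\<pi>\<close>.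
\<close>

lemma linear_dependence:
  fixes K :: "'i set" and B :: "'j set"
  assumes "finite B" "finite K" "card B < card K" "\<And>k b. k \<in> K \<Longrightarrow> b \<in> B \<Longrightarrow> a k b \<in> C"
    and C: "C \<subseteq> A" "\<And>\<kappa>. (\<lambda>_. \<kappa>) \<in> C" "\<And>f g. f \<in> C \<Longrightarrow> g \<in> C \<Longrightarrow> (\<lambda>x. f x + g x) \<in> C"
      "\<And>f g. f \<in> C \<Longrightarrow> g \<in> C \<Longrightarrow> (\<lambda>x. f x * g x) \<in> C"
  shows "\<exists>c. (\<forall>k\<in>K. c k \<in> C) \<and> (\<exists>k\<in>K. \<not> vanishes (c k)) \<and>
    (\<forall>b\<in>B. \<forall>x\<in>E. (\<Sum>k\<in>K. c k x * a k b x) = 0)"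
  using assms(1-4)
proof (induction B arbitrary: K a rule: finite_induct)
  case empty
  then have "K \<noteq> {}" by auto
  moreover have "\<not> vanishes (\<lambda>_. 1)" using nonempty by (auto simp: vanishes_def)
  ultimately show ?case using C(2) by (intro exI[of _ "\<lambda>_ _. 1"]) auto
next
  case (insert b B)
  have minus: "(\<lambda>x. f x - g x) \<in> C" if "f \<in> C" "g \<in> C" for f g
    using C(3)[OF that(1) C(4)[OF C(2)[of "- 1"] that(2)]] by simp
  have csum: "(\<lambda>x. \<Sum>i\<in>S. F i x) \<in> C" if "\<And>i. i \<in> S \<Longrightarrow> F i \<in> C" for S :: "'i set" and F
    using that by (induction S rule: infinite_finite_induct) (auto intro: C)
  show ?case
  proof (cases "\<forall>k\<in>K. vanishes (a k b)")
    case True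
    have "card B < card K" using insert by simp
    from insert.IH[OF insert.prems(1) this] obtain c where c: "\<forall>k\<in>K. c k \<in> C"
      "\<exists>k\<in>K. \<not> vanishes (c k)" "\<forall>b\<in>B. \<forall>x\<in>E. (\<Sum>k\<in>K. c k x * a k b x) = 0"
      using insert.prems(3) by blast
    then show ?thesis using True by (intro exI[of _ c]) (auto simp: vanishes_def)
  next
    case False
    then obtain k0 where k0: "k0 \<in> K" "\<not> vanishes (a k0 b)" by blast
    let ?K = "K - {k0}" and ?\<pi> = "a k0 b"
    let ?a = "\<lambda>k i x. ?\<pi> x * a k i x - a k b x * a k0 i x"
    have aC: "a k i \<in> C" if "k \<in> K" "i \<in> insert b B" for k i using insert.prems(3) that by blast
    have card: "card B < card ?K" using insert k0 by simp
    have a'C: "?a k i \<in> C" if "k \<in> ?K" "i \<in> B" for k i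
      by (intro minus C(4) aC) (use that k0 in auto)
    from insert.IH[of ?K ?a, OF finite_Diff[OF insert.prems(1)] card a'C] obtain c where c: "\<forall>k\<in>?K. c k \<in> C"
      "\<exists>k\<in>?K. \<not> vanishes (c k)" "\<forall>i\<in>B. \<forall>x\<in>E. (\<Sum>k\<in>?K. c k x * ?a k i x) = 0"
      by auto
    let ?c = "\<lambda>k. if k = k0 then (\<lambda>x. 0 - (\<Sum>k\<in>?K. c k x * a k b x)) else (\<lambda>x. ?\<pi> x * c k x)"
    have "(\<lambda>x. \<Sum>k\<in>?K. c k x * a k b x) \<in> C"
      by (intro csum C(4) aC) (use c in auto)
    then have "(\<lambda>x. 0 - (\<Sum>k\<in>?K. c k x * a k b x)) \<in> C" by (rule minus[OF C(2)])
    then have mem: "\<forall>k\<in>K. ?c k \<in> C" using c(1) aC[OF k0(1)] C(4) by auto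
    obtain k where k: "k \<in> ?K" "\<not> vanishes (c k)" using c(2) by blast
    then have "\<not> vanishes (?c k)"
      using vanishes_mult[of ?\<pi> "c k"] k0 c(1) aC[OF k0(1)] C(1) by auto
    then have nz: "\<exists>k\<in>K. \<not> vanishes (?c k)" using k(1) by (intro bexI[of _ k]) auto
    have rel: "(\<Sum>k\<in>K. ?c k x * a k i x) = 0" if i: "i \<in> insert b B" and x: "x \<in> E" for i x
    proof -
      have "(\<Sum>k\<in>K. ?c k x * a k i x) = ?c k0 x * a k0 i x + (\<Sum>k\<in>?K. ?c k x * a k i x)"
        by (rule sum.remove[OF insert.prems(1) k0(1)])
      also have "(\<Sum>k\<in>?K. ?c k x * a k i x) = (\<Sum>k\<in>?K. ?\<pi> x * c k x * a k i x)"
        by (rule sum.cong) auto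
      also have "?c k0 x * a k0 i x + \<dots> = (\<Sum>k\<in>?K. c k x * ?a k i x)"
        by (simp add: sum_distrib_right sum_distrib_left right_diff_distrib sum_subtractf mult_ac)
      also have "\<dots> = 0"
        using c(3) x i by (cases "i = b") (auto simp: mult_ac)
      finally show ?thesis .
    qed
    show ?thesis by (rule exI[of _ ?c]) (intro conjI mem nz ballI rel)
  qed
qed

end

section \<open>A divisor of fixed points\<close>

text \<open>
  The set \<open>D\<close> is a prime divisor of fixed points of a normal affine variety with coordinates \<open>c\<close>. The assumption \<open>height_one\<close>
  is how the codimension of \<open>D\<close> is used: in the local ring at \<open>D\<close>, every nonunit \<open>p\<close> has a power that is divisible
  by the nonzero nonunit \<open>u\<close>. The assumption \<open>normal\<close> says that a fraction \<open>f / g\<close> which is integral over \<open>A\<close> lies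
  in \<open>A\<close>; the equation is multiplied by \<open>g\<^sup>m\<close>.
\<close>

locale fixed_divisor = weighted_algebra E A act
  for E :: "'a set" and A :: "('a \<Rightarrow> 'k::{alg_closed_field, field_char_0}) set" and act +
  fixes D :: "'a set" and n :: nat and c :: "'a \<Rightarrow> nat \<Rightarrow> 'k"
  assumes D_sub: "D \<subseteq> E" and D_ne: "D \<noteq> {}"
    and fixed: "t \<noteq> 0 \<Longrightarrow> x \<in> D \<Longrightarrow> act t x = x"
    and prime: "f \<in> A \<Longrightarrow> g \<in> A \<Longrightarrow> (\<And>x. x \<in> D \<Longrightarrow> f x * g x = 0) \<Longrightarrow>
       (\<forall>x\<in>D. f x = 0) \<or> (\<forall>x\<in>D. g x = 0)"
    and height_one: "u \<in> A \<Longrightarrow> p \<in> A \<Longrightarrow> (\<And>x. x \<in> D \<Longrightarrow> u x = 0) \<Longrightarrow> \<not> vanishes u \<Longrightarrow>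
       (\<And>x. x \<in> D \<Longrightarrow> p x = 0) \<Longrightarrow>
       \<exists>v w N. v \<in> A \<and> w \<in> A \<and> \<not> (\<forall>x\<in>D. v x = 0) \<and> (\<forall>x\<in>E. v x * p x ^ N = u x * w x)"
    and normal: "f \<in> A \<Longrightarrow> g \<in> A \<Longrightarrow> \<not> vanishes g \<Longrightarrow> (\<And>i. i < m \<Longrightarrow> a i \<in> A) \<Longrightarrow>
       (\<And>x. x \<in> E \<Longrightarrow> f x ^ m + (\<Sum>i<m. a i x * f x ^ i * g x ^ (m - i)) = 0) \<Longrightarrow>
       \<exists>h\<in>A. \<forall>x\<in>E. f x = g x * h x"
    and coord_in: "i < n \<Longrightarrow> (\<lambda>x. c x i) \<in> A"
    and generated: "f \<in> A \<Longrightarrow> \<exists>p\<in>poly_funs n. \<forall>x\<in>E. f x = p (c x)"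
begin

definition zero_on_D :: "('a \<Rightarrow> 'k) \<Rightarrow> bool" where
  "zero_on_D f \<longleftrightarrow> (\<forall>x\<in>D. f x = 0)"

lemma zero_on_D_mult:
  "f \<in> A \<Longrightarrow> g \<in> A \<Longrightarrow> zero_on_D (\<lambda>x. f x * g x) \<longleftrightarrow> zero_on_D f \<or> zero_on_D g"
  using prime[of f g] by (auto simp: zero_on_D_def)

lemma zero_on_D_power: "f \<in> A \<Longrightarrow> zero_on_D (\<lambda>x. f x ^ k) \<Longrightarrow> zero_on_D f"
proof (induction k)
  case 0
  then show ?case using D_ne by (auto simp: zero_on_D_def)
next
  case (Suc k)
  then show ?case using zero_on_D_mult[OF Suc.prems(1) power[OF Suc.prems(1)], of k] by auto
qed

lemma zero_on_D_if_vanishes: "vanishes f \<Longrightarrow> zero_on_D f"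
  using D_sub by (auto simp: zero_on_D_def vanishes_def)

text \<open>
  At a fixed point \<open>f x = t\<^sup>k f x\<close> for all \<open>t\<close>; comparing coefficients of this Laurent polynomial gives \<open>f x = 0\<close>.
\<close>

lemma nonzero_weight_zero_on_D:
  assumes f: "f \<in> homog k" and k: "k \<noteq> 0"
  shows "zero_on_D f"
  unfolding zero_on_D_def
proof
  fix x assume x: "x \<in> D"
  have xE: "x \<in> E" using x D_sub by blast
  have "(\<Sum>l\<in>{0, k}. t powi l * (if l = 0 then f x else - f x)) = 0" if "t \<noteq> 0" for t :: 'k
    using homogD(2)[OF f that xE] fixed[OF that x] k by simp
  from laurent_polynomial_zero[OF _ this, of 0] show "f x = 0" by simp
qed

subsection \<open>Homogeneous generators\<close>

definition weights_of :: "nat \<Rightarrow> int set" where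
  "weights_of i = (SOME S. finite S \<and> (\<forall>x\<in>E. c x i = (\<Sum>k\<in>S. part (\<lambda>x. c x i) k x)))"

text \<open>
  A generator is a weight component of a coordinate, indexed by the coordinate and the weight.
\<close>

definition gens :: "(nat \<times> int) set" where
  "gens = Sigma {..<n} weights_of"

definition gen :: "nat \<times> int \<Rightarrow> 'a \<Rightarrow> 'k" where
  "gen g = part (\<lambda>x. c x (fst g)) (snd g)"

definition monomial :: "(nat \<times> int \<Rightarrow> nat) \<Rightarrow> 'a \<Rightarrow> 'k" where
  "monomial \<alpha> x = (\<Prod>g\<in>gens. gen g x ^ \<alpha> g)"

lemma weights_of:
  assumes "i < n"
  shows "finite (weights_of i)" "x \<in> E \<Longrightarrow> c x i = (\<Sum>k\<in>weights_of i. part (\<lambda>x. c x i) k x)"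
proof -
  let ?P = "\<lambda>S. finite S \<and> (\<forall>x\<in>E. c x i = (\<Sum>k\<in>S. part (\<lambda>x. c x i) k x))"
  obtain S where "finite S" "\<And>x. x \<in> E \<Longrightarrow> c x i = (\<Sum>k\<in>S. part (\<lambda>x. c x i) k x)"
    by (rule part_support[OF coord_in[OF assms]]) (rule that)
  then have "?P S" by blast
  then have "?P (weights_of i)" unfolding weights_of_def by (rule someI[of ?P])
  then show "finite (weights_of i)" "x \<in> E \<Longrightarrow> c x i = (\<Sum>k\<in>weights_of i. part (\<lambda>x. c x i) k x)"
    by auto
qed

lemma finite_gens: "finite gens"
  unfolding gens_def using weights_of(1) by (intro finite_SigmaI) auto

lemma gen_homog: "g \<in> gens \<Longrightarrow> gen g \<in> homog (snd g)"
  unfolding gen_def gens_def using coord_in by (intro part_homog) auto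

lemma gen_in: "g \<in> gens \<Longrightarrow> gen g \<in> A"
  using gen_homog homogD(1) by blast

lemma monomial_homog: "monomial \<alpha> \<in> homog (\<Sum>g\<in>gens. int (\<alpha> g) * snd g)"
proof -
  have "monomial \<alpha> = (\<lambda>x. \<Prod>g\<in>gens. gen g x ^ \<alpha> g)" by (simp add: fun_eq_iff monomial_def)
  then show ?thesis using homog_prod[of gens "\<lambda>g x. gen g x ^ \<alpha> g"] homog_power[OF gen_homog] by simp
qed

lemma monomial_in: "monomial \<alpha> \<in> A"
  using monomial_homog homogD(1) by blast

text \<open>
  The linear span of the monomials as a set of functions; unlike \<open>A\<close>, it is not closed under changes outside \<open>E\<close>.
\<close>

inductive_set mspan :: "('a \<Rightarrow> 'k) set" where
  scaled: "(\<lambda>x. \<kappa> * monomial \<alpha> x) \<in> mspan"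
| add: "f \<in> mspan \<Longrightarrow> g \<in> mspan \<Longrightarrow> (\<lambda>x. f x + g x) \<in> mspan"

lemma mspan_in: "s \<in> mspan \<Longrightarrow> s \<in> A"
  by (induction rule: mspan.induct) (auto intro: add_in mult_in const_in monomial_in)

lemma mspan_const: "(\<lambda>_. \<kappa>) \<in> mspan"
  using mspan.scaled[of \<kappa> "\<lambda>_. 0"] by (simp add: monomial_def)

lemma mspan_sum: "(\<And>i. i \<in> S \<Longrightarrow> F i \<in> mspan) \<Longrightarrow> (\<lambda>x. \<Sum>i\<in>S. F i x) \<in> mspan"
  by (induction S rule: infinite_finite_induct) (simp_all add: mspan_const mspan.add)

lemma mspan_mult_monomial: "g \<in> mspan \<Longrightarrow> (\<lambda>x. \<kappa> * monomial \<alpha> x * g x) \<in> mspan"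
proof (induction rule: mspan.induct)
  case (scaled \<mu> \<beta>)
  have "monomial (\<lambda>g. \<alpha> g + \<beta> g) x = monomial \<alpha> x * monomial \<beta> x" for x
    by (simp add: monomial_def prod.distrib power_add)
  then have "(\<lambda>x. \<kappa> * monomial \<alpha> x * (\<mu> * monomial \<beta> x))
      = (\<lambda>x. (\<kappa> * \<mu>) * monomial (\<lambda>g. \<alpha> g + \<beta> g) x)"
    by (auto simp: fun_eq_iff)
  then show ?case using mspan.scaled[of "\<kappa> * \<mu>" "\<lambda>g. \<alpha> g + \<beta> g"] by simp
next
  case (add f g)
  then show ?case using mspan.add[OF add.IH] by (simp add: distrib_left)
qed

lemma mspan_mult: "f \<in> mspan \<Longrightarrow> g \<in> mspan \<Longrightarrow> (\<lambda>x. f x * g x) \<in> mspan"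
proof (induction rule: mspan.induct)
  case (scaled \<kappa> \<alpha>)
  then show ?case by (rule mspan_mult_monomial)
next
  case (add f h)
  then show ?case using mspan.add[OF add.IH(1)[OF add.prems] add.IH(2)[OF add.prems]]
    by (simp add: distrib_right)
qed

lemma gen_mspan: "g \<in> gens \<Longrightarrow> gen g \<in> mspan"
proof -
  assume g: "g \<in> gens"
  have "monomial (\<lambda>h. if h = g then 1 else 0) x = gen g x" for x
  proof -
    have "monomial (\<lambda>h. if h = g then 1 else 0) x = (\<Prod>h\<in>gens. if h = g then gen h x else 1)"
      unfolding monomial_def by (rule prod.cong) auto
    also have "\<dots> = gen g x" using g finite_gens by simp
    finally show ?thesis .
  qed
  then show ?thesis using mspan.scaled[of 1 "\<lambda>h. if h = g then 1 else 0"] by simp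
qed

lemma polynomial_mspan:
  "p \<in> poly_funs n \<Longrightarrow> \<exists>s\<in>mspan. \<forall>x\<in>E. p (c x) = s x"
proof (induction rule: poly_funs.induct)
  case (const \<kappa>)
  show ?case using mspan_const by (intro bexI[of _ "\<lambda>_. \<kappa>"]) auto
next
  case (coord i)
  show ?case
  proof (intro bexI[of _ "\<lambda>x. \<Sum>k\<in>weights_of i. gen (i, k) x"] ballI)
    show "(\<lambda>x. \<Sum>k\<in>weights_of i. gen (i, k) x) \<in> mspan"
      using coord by (intro mspan_sum gen_mspan) (simp add: gens_def)
  qed (use weights_of(2)[OF coord] in \<open>simp add: gen_def\<close>)
next
  case (add p q)
  then obtain s t where "s \<in> mspan" "\<forall>x\<in>E. p (c x) = s x" "t \<in> mspan" "\<forall>x\<in>E. q (c x) = t x" by blast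
  then show ?case by (intro bexI[of _ "\<lambda>x. s x + t x"] mspan.add) auto
next
  case (mult p q)
  then obtain s t where "s \<in> mspan" "\<forall>x\<in>E. p (c x) = s x" "t \<in> mspan" "\<forall>x\<in>E. q (c x) = t x" by blast
  then show ?case by (intro bexI[of _ "\<lambda>x. s x * t x"] mspan_mult) auto
qed

lemma mspan_represents:
  assumes "f \<in> A"
  obtains s where "s \<in> mspan" "\<And>x. x \<in> E \<Longrightarrow> f x = s x"
proof -
  obtain p where p: "p \<in> poly_funs n" "\<forall>x\<in>E. f x = p (c x)" using generated[OF assms] by blast
  obtain s where "s \<in> mspan" "\<forall>x\<in>E. p (c x) = s x" using polynomial_mspan[OF p(1)] by blast
  with p that[of s] show ?thesis by simp
qed

lemma part_of_scaled_monomial: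
  assumes x: "x \<in> E"
  shows "part (\<lambda>x. \<kappa> * monomial \<alpha> x) k x = (if k = (\<Sum>g\<in>gens. int (\<alpha> g) * snd g) then \<kappa> * monomial \<alpha> x else 0)"
  by (rule part_of_homog[OF homog_mult0[OF homog_const monomial_homog] x])

text \<open>
  A monomial of weight above the bound contains a generator of positive weight with exponent greater than \<open>N\<close>: otherwise
  its weight would be at most \<open>N\<close> times the sum of the positive weights. So every monomial of the weight of \<open>h\<close> lies in the ideal of all
  functions \<open>f\<close> for which \<open>v f\<close> is a multiple of \<open>u\<close>.
\<close>

lemma high_weight_multiple:
  assumes v: "v \<in> A" and u: "u \<in> A"
    and gen_multiple: "\<And>g. g \<in> gens \<Longrightarrow> snd g > 0 \<Longrightarrow> \<exists>w\<in>A. \<forall>x\<in>E. v x * gen g x ^ Suc N = u x * w x"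
    and k: "k > int N * (\<Sum>g\<in>gens. max (snd g) 0)" and h: "h \<in> homog k"
  shows "\<exists>w\<in>A. \<forall>x\<in>E. v x * h x = u x * w x"
proof -
  define J where "J = {f \<in> A. \<exists>w\<in>A. \<forall>x\<in>E. v x * f x = u x * w x}"
  have zero: "(\<lambda>_. 0) \<in> J" using const_in[of 0] by (auto simp: J_def intro!: bexI[of _ "\<lambda>_. 0"])
  have J_add: "(\<lambda>x. f x + g x) \<in> J" if "f \<in> J" "g \<in> J" for f g
  proof -
    obtain w w' where w: "f \<in> A" "w \<in> A" "\<forall>x\<in>E. v x * f x = u x * w x"
      "g \<in> A" "w' \<in> A" "\<forall>x\<in>E. v x * g x = u x * w' x" using \<open>f \<in> J\<close> \<open>g \<in> J\<close> by (auto simp: J_def)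
    then have "\<forall>x\<in>E. v x * (f x + g x) = u x * (w x + w' x)" by (simp add: distrib_left)
    then show ?thesis unfolding J_def
      by (intro CollectI conjI bexI[of _ "\<lambda>x. w x + w' x"] add_in w(1,2,4,5))
  qed
  have J_mult: "(\<lambda>x. g x * f x) \<in> J" if "f \<in> J" "g \<in> A" for f g
  proof -
    obtain w where w: "f \<in> A" "w \<in> A" "\<forall>x\<in>E. v x * f x = u x * w x" using \<open>f \<in> J\<close> by (auto simp: J_def)
    have eq: "v x * (g x * f x) = u x * (g x * w x)" if "x \<in> E" for x
    proof -
      have "v x * (g x * f x) = g x * (v x * f x)" by (simp only: mult_ac)
      also have "v x * f x = u x * w x" using w(3) \<open>x \<in> E\<close> by blast
      finally show ?thesis by (simp only: mult_ac)
    qed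
    show ?thesis unfolding J_def
      by (intro CollectI conjI bexI[of _ "\<lambda>x. g x * w x"] ballI eq mult_in \<open>g \<in> A\<close> w(1,2))
  qed
  have J_cong: "g \<in> J" if "f \<in> J" "\<And>x. x \<in> E \<Longrightarrow> f x = g x" for f g
    using that cong[of f g] by (auto simp: J_def)
  have J_gen: "(\<lambda>x. gen g x ^ Suc N) \<in> J" if "g \<in> gens" "snd g > 0" for g
    using gen_multiple[OF that] power[OF gen_in[OF that(1)], of "Suc N"] by (auto simp: J_def)
  have monomial_J: "monomial \<alpha> \<in> J" if wt: "(\<Sum>g\<in>gens. int (\<alpha> g) * snd g) = k" for \<alpha>
  proof -
    have "\<exists>g\<in>gens. snd g > 0 \<and> \<alpha> g > N"
    proof (rule ccontr)
      assume no: "\<not> ?thesis"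
      have "int (\<alpha> g) * snd g \<le> int N * max (snd g) 0" if "g \<in> gens" for g
      proof (cases "snd g > 0")
        case True
        then have "\<alpha> g \<le> N" using no that by force
        then show ?thesis using True by (simp add: mult_right_mono)
      next
        case False
        then have "int (\<alpha> g) * snd g \<le> 0" by (simp add: mult_nonneg_nonpos)
        then show ?thesis using False by simp
      qed
      then have "(\<Sum>g\<in>gens. int (\<alpha> g) * snd g) \<le> (\<Sum>g\<in>gens. int N * max (snd g) 0)"
        by (rule sum_mono)
      then show False using k wt by (simp add: sum_distrib_left)
    qed
    then obtain g where g: "g \<in> gens" "snd g > 0" "\<alpha> g > N" by blast
    let ?r = "\<lambda>x. gen g x ^ (\<alpha> g - Suc N) * (\<Prod>h\<in>gens - {g}. gen h x ^ \<alpha> h)"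
    have "?r \<in> A" by (intro mult_in power prod_in gen_in g) auto
    then have "(\<lambda>x. ?r x * gen g x ^ Suc N) \<in> J" by (rule J_mult[OF J_gen[OF g(1,2)]])
    moreover have "?r x * gen g x ^ Suc N = monomial \<alpha> x" for x
    proof -
      have "monomial \<alpha> x = gen g x ^ \<alpha> g * (\<Prod>h\<in>gens - {g}. gen h x ^ \<alpha> h)"
        unfolding monomial_def by (rule prod.remove[OF finite_gens g(1)])
      also have "gen g x ^ \<alpha> g = gen g x ^ (\<alpha> g - Suc N) * gen g x ^ Suc N"
        using g(3) by (simp only: power_add[symmetric]) simp
      finally show ?thesis by (simp add: mult_ac)
    qed
    ultimately show ?thesis by (rule J_cong)
  qed
  have part_J: "part s k \<in> J" if "s \<in> mspan" for s
    using that
  proof (induction rule: mspan.induct)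
    case (scaled \<kappa> \<alpha>)
    show ?case
    proof (cases "k = (\<Sum>g\<in>gens. int (\<alpha> g) * snd g)")
      case True
      show ?thesis
        by (rule J_cong[OF J_mult[OF monomial_J[OF True[symmetric]] const_in[of \<kappa>]]])
          (subst part_of_scaled_monomial, simp_all add: True)
    next
      case False
      show ?thesis by (rule J_cong[OF zero]) (subst part_of_scaled_monomial, simp_all add: False)
    qed
  next
    case (add f g)
    show ?case
      by (rule J_cong[OF J_add[OF add.IH]]) (simp add: part_add mspan_in add.hyps)
  qed
  obtain s where s: "s \<in> mspan" "\<And>x. x \<in> E \<Longrightarrow> h x = s x"
    by (rule mspan_represents[OF homogD(1)[OF h]]) (rule that)
  have "h \<in> J"
  proof (rule J_cong[OF part_J[OF s(1)]])
    fix x assume x: "x \<in> E"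
    have "part s k x = part h k x" by (rule part_cong[OF homogD(1)[OF h] s(2) x])
    then show "part s k x = h x" using part_of_homog[OF h x] by simp
  qed
  then show ?thesis by (simp add: J_def)
qed

subsection \<open>Functions of weight zero and the ideal of the divisor\<close>

text \<open>
  Comparing the components of weight \<open>N e\<close> in \<open>v p\<^sup>N = u w\<close> replaces \<open>v\<close> by its component of weight zero. That component
  does not vanish on \<open>D\<close>, since all the others do.
\<close>

lemma height_one_homog:
  assumes u: "u \<in> homog d" "zero_on_D u" "\<not> vanishes u" and p: "p \<in> homog e" "zero_on_D p"
  obtains v w N where "v \<in> homog 0" "\<not> zero_on_D v" "w \<in> A" "\<And>x. x \<in> E \<Longrightarrow> v x * p x ^ N = u x * w x"
proof -
  have "\<exists>v w N. v \<in> A \<and> w \<in> A \<and> \<not> (\<forall>x\<in>D. v x = 0) \<and> (\<forall>x\<in>E. v x * p x ^ N = u x * w x)"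
    by (rule height_one[OF homogD(1)[OF u(1)] homogD(1)[OF p(1)] _ u(3)])
      (use u p in \<open>auto simp: zero_on_D_def\<close>)
  then obtain v w N where v: "v \<in> A" "w \<in> A" "\<not> zero_on_D v"
    and eq: "\<And>x. x \<in> E \<Longrightarrow> v x * p x ^ N = u x * w x" unfolding zero_on_D_def by blast
  let ?K = "int N * e"
  show ?thesis
  proof (rule that[of "part v 0" "part w (?K - d)" N])
    show "part v 0 \<in> homog 0" "part w (?K - d) \<in> A" using part_homog[OF v(1)] part_in[OF v(2)] by auto
    show "\<not> zero_on_D (part v 0)"
    proof
      assume z: "zero_on_D (part v 0)"
      obtain S where S: "\<And>x. x \<in> E \<Longrightarrow> v x = (\<Sum>k\<in>S. part v k x)"
        by (rule part_support[OF v(1)]) (rule that)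
      have "part v k x = 0" if "x \<in> D" for k x
        using z nonzero_weight_zero_on_D[OF part_homog[OF v(1)], of k] that
        by (cases "k = 0") (auto simp: zero_on_D_def)
      then have "zero_on_D v" using S D_sub by (auto simp: zero_on_D_def)
      then show False using v(3) by simp
    qed
    fix x assume x: "x \<in> E"
    have pN: "(\<lambda>x. p x ^ N) \<in> homog ?K" by (rule homog_power[OF p(1)])
    have "part v 0 x * p x ^ N = part (\<lambda>x. p x ^ N * v x) ?K x"
      using part_mult_homog[OF pN v(1) x, of ?K] by (simp add: mult.commute)
    also have "\<dots> = part (\<lambda>x. u x * w x) ?K x"
      by (rule part_cong[OF mult_in[OF homogD(1)[OF u(1)] v(2)] _ x]) (simp add: eq[symmetric] mult.commute)
    also have "\<dots> = u x * part w (?K - d) x" by (rule part_mult_homog[OF u(1) v(2) x])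
    finally show "part v 0 x * p x ^ N = u x * part w (?K - d) x" .
  qed
qed

text \<open>
  By \<open>height_one_homog\<close> each generator of positive weight has a power that is a multiple of \<open>u\<close> up to a factor of weight
  zero; the product of these factors works for all generators, and \<open>high_weight_multiple\<close> applies.
\<close>

lemma high_weight_divisible:
  assumes u: "u \<in> homog d" "zero_on_D u" "\<not> vanishes u"
  obtains v e where "v \<in> homog 0" "\<not> zero_on_D v"
    "\<And>k h. k \<ge> e \<Longrightarrow> h \<in> homog k \<Longrightarrow> \<exists>w\<in>homog (k - d). \<forall>x\<in>E. v x * h x = u x * w x"
proof -
  have "\<exists>v N. v \<in> homog 0 \<and> \<not> zero_on_D v \<and>
      (\<forall>g\<in>F. snd g > 0 \<longrightarrow> (\<exists>w\<in>A. \<forall>x\<in>E. v x * gen g x ^ N = u x * w x))"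
    if "finite F" "F \<subseteq> gens" for F
    using that
  proof (induction F rule: finite_induct)
    case empty
    have "\<not> zero_on_D (\<lambda>_. 1)" using D_ne by (auto simp: zero_on_D_def)
    then show ?case using homog_const by blast
  next
    case (insert g F)
    then obtain v N where v: "v \<in> homog 0" "\<not> zero_on_D v"
      "\<forall>g\<in>F. snd g > 0 \<longrightarrow> (\<exists>w\<in>A. \<forall>x\<in>E. v x * gen g x ^ N = u x * w x)" by auto
    show ?case
    proof (cases "snd g > 0")
      case False
      then show ?thesis using v by (intro exI[of _ v] exI[of _ N]) auto
    next
      case True
      have gh: "gen g \<in> homog (snd g)" using gen_homog insert.prems by blast
      obtain v' w' N' where v': "v' \<in> homog 0" "\<not> zero_on_D v'" "w' \<in> A"
        "\<And>x. x \<in> E \<Longrightarrow> v' x * gen g x ^ N' = u x * w' x"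
        by (rule height_one_homog[OF u gh nonzero_weight_zero_on_D[OF gh]]) (use True that in auto)
      have nz: "\<not> zero_on_D (\<lambda>x. v x * v' x)"
        using zero_on_D_mult[OF homogD(1)[OF v(1)] homogD(1)[OF v'(1)]] v v' by simp
      have "\<exists>w\<in>A. \<forall>x\<in>E. (v x * v' x) * gen g' x ^ (N + N') = u x * w x"
        if g': "g' \<in> insert g F" "snd g' > 0" for g'
      proof (cases "g' = g")
        case True
        have "(\<lambda>x. v x * gen g x ^ N * w' x) \<in> A"
          by (intro mult_in power homogD(1)[OF v(1)] homogD(1)[OF gh] v')
        moreover have "(v x * v' x) * gen g' x ^ (N + N') = u x * (v x * gen g x ^ N * w' x)" if "x \<in> E" for x
        proof -
          have "(v x * v' x) * gen g' x ^ (N + N') = v x * gen g x ^ N * (v' x * gen g x ^ N')"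
            by (simp add: True power_add)
          also have "\<dots> = u x * (v x * gen g x ^ N * w' x)" unfolding v'(4)[OF that] by (simp add: mult_ac)
          finally show ?thesis .
        qed
        ultimately show ?thesis by (intro bexI[of _ "\<lambda>x. v x * gen g x ^ N * w' x"]) auto
      next
        case False
        then have "g' \<in> F" using g' by simp
        then obtain w where w: "w \<in> A" "\<forall>x\<in>E. v x * gen g' x ^ N = u x * w x" using v(3) g' by blast
        have "gen g' \<in> A" using gen_in \<open>g' \<in> F\<close> insert.prems by blast
        then have "(\<lambda>x. v' x * gen g' x ^ N' * w x) \<in> A"
          by (intro mult_in power homogD(1)[OF v'(1)] w)
        moreover have "(v x * v' x) * gen g' x ^ (N + N') = u x * (v' x * gen g' x ^ N' * w x)" if "x \<in> E" for x
        proof -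
          have "(v x * v' x) * gen g' x ^ (N + N') = v' x * gen g' x ^ N' * (v x * gen g' x ^ N)"
            by (simp add: power_add)
          also have "v x * gen g' x ^ N = u x * w x" using w(2) that by blast
          finally show ?thesis by (simp only: mult_ac)
        qed
        ultimately show ?thesis by (intro bexI[of _ "\<lambda>x. v' x * gen g' x ^ N' * w x"]) auto
      qed
      then show ?thesis using nz homog_mult0[OF v(1) v'(1)]
        by (intro exI[of _ "\<lambda>x. v x * v' x"] exI[of _ "N + N'"]) auto
    qed
  qed
  from this[OF finite_gens order.refl] obtain v N where v: "v \<in> homog 0" "\<not> zero_on_D v"
    "\<forall>g\<in>gens. snd g > 0 \<longrightarrow> (\<exists>w\<in>A. \<forall>x\<in>E. v x * gen g x ^ N = u x * w x)" by blast
  let ?e = "int N * (\<Sum>g\<in>gens. max (snd g) 0) + 1"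
  have "\<exists>w\<in>homog (k - d). \<forall>x\<in>E. v x * h x = u x * w x" if k: "k \<ge> ?e" and h: "h \<in> homog k" for k h
  proof -
    have "\<exists>w\<in>A. \<forall>x\<in>E. v x * h x = u x * w x"
    proof (rule high_weight_multiple[OF homogD(1)[OF v(1)] homogD(1)[OF u(1)] _ _ h])
      show "\<exists>w\<in>A. \<forall>x\<in>E. v x * gen g x ^ Suc N = u x * w x" if g: "g \<in> gens" "snd g > 0" for g
      proof -
        obtain w where w: "w \<in> A" "\<forall>x\<in>E. v x * gen g x ^ N = u x * w x" using v(3) g by blast
        have "v x * gen g x ^ Suc N = u x * (gen g x * w x)" if "x \<in> E" for x
        proof -
          have "v x * gen g x ^ Suc N = gen g x * (v x * gen g x ^ N)" by simp
          also have "v x * gen g x ^ N = u x * w x" using w(2) that by blast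
          finally show ?thesis by (simp only: mult_ac)
        qed
        then show ?thesis by (intro bexI[OF _ mult_in[OF gen_in[OF g(1)] w(1)]] ballI)
      qed
      show "int N * (\<Sum>g\<in>gens. max (snd g) 0) < k" using k by simp
    qed
    then obtain w where w: "w \<in> A" "\<forall>x\<in>E. v x * h x = u x * w x" by blast
    have "w \<in> homog (k - d)"
      by (rule homog_quotient[OF homog_mult0[OF v(1) h] u(1,3) w(1)]) (use w in simp)
    then show ?thesis using w(2) by blast
  qed
  then show ?thesis using that[of v ?e] v by blast
qed

text \<open>
  Let \<open>u\<close> be nonzero and let \<open>F\<close> be a power of \<open>f\<close> of large weight. Dividing by \<open>u\<close> does not change the weight, so
  \<open>high_weight_divisible\<close> can be iterated: \<open>v\<^sup>l F\<close> is a multiple of \<open>u\<^sup>l\<close> for every \<open>l\<close>. On the other hand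
  \<open>v1 u\<^sup>N\<close> is a multiple of \<open>F\<close> for some \<open>N\<close> and some \<open>v1\<close> that does not vanish on \<open>D\<close>. For \<open>l = N + 1\<close> the two
  combine to show that \<open>v1 v\<^sup>l\<close> is a multiple of \<open>u\<close>, although it does not vanish on \<open>D\<close>.
\<close>

theorem weight_zero_meets_ideal:
  assumes f: "f \<in> homog m" "m > 0" "\<not> vanishes f" and u: "u \<in> homog 0" "zero_on_D u"
  shows "vanishes u"
proof (rule ccontr)
  assume nu: "\<not> vanishes u"
  obtain v e where v: "v \<in> homog 0" "\<not> zero_on_D v"
    and div: "\<And>k h. k \<ge> e \<Longrightarrow> h \<in> homog k \<Longrightarrow> \<exists>w\<in>homog (k - 0). \<forall>x\<in>E. v x * h x = u x * w x"
    by (rule high_weight_divisible[OF u nu]) (rule that)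
  define j where "j = nat e + 1"
  let ?K = "int j * m" and ?F = "\<lambda>x. f x ^ j"
  have "e \<le> int j" by (simp add: j_def)
  also have "\<dots> \<le> ?K" using f(2) mult_left_mono[of 1 m "int j"] by simp
  finally have K: "e \<le> ?K" .
  have F: "?F \<in> homog ?K" by (rule homog_power[OF f(1)])
  have nF: "\<not> vanishes ?F" using vanishes_power[OF homogD(1)[OF f(1)]] f(3) by blast
  have FD: "zero_on_D ?F" by (rule nonzero_weight_zero_on_D[OF F]) (use f(2) in \<open>simp add: j_def\<close>)
  have iter: "\<exists>w\<in>homog ?K. \<forall>x\<in>E. v x ^ l * ?F x = u x ^ l * w x" for l
  proof (induction l)
    case 0
    show ?case using F by (intro bexI[of _ ?F]) auto
  next
    case (Suc l)
    then obtain w where w: "w \<in> homog ?K" "\<forall>x\<in>E. v x ^ l * ?F x = u x ^ l * w x" by blast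
    obtain w' where w': "w' \<in> homog ?K" "\<forall>x\<in>E. v x * w x = u x * w' x" using div[OF K w(1)] by auto
    have "v x ^ Suc l * ?F x = u x ^ Suc l * w' x" if "x \<in> E" for x
    proof -
      have "v x ^ Suc l * ?F x = v x * (v x ^ l * ?F x)" by simp
      also have "\<dots> = u x ^ l * (v x * w x)" using w(2) that by simp
      also have "\<dots> = u x ^ Suc l * w' x" using w'(2) that by simp
      finally show ?thesis .
    qed
    then show ?case using w'(1) by blast
  qed
  obtain v1 w1 N where v1: "v1 \<in> homog 0" "\<not> zero_on_D v1" "w1 \<in> A"
    "\<And>x. x \<in> E \<Longrightarrow> v1 x * u x ^ N = ?F x * w1 x"
    by (rule height_one_homog[OF F FD nF u]) (rule that)
  obtain w where w: "w \<in> homog ?K" "\<forall>x\<in>E. v x ^ Suc N * ?F x = u x ^ Suc N * w x"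
    using iter by blast
  note vA = homogD(1)[OF v(1)] and v1A = homogD(1)[OF v1(1)] and uA = homogD(1)[OF u(1)] and wA = homogD(1)[OF w(1)]
  have eq: "v1 x * v x ^ Suc N = u x * (w1 x * w x)" if x: "x \<in> E" for x
  proof (rule cancel[OF homogD(1)[OF F] _ _ nF _ x])
    show "(\<lambda>x. v1 x * v x ^ Suc N) \<in> A" by (intro mult_in power vA v1A)
    show "(\<lambda>x. u x * (w1 x * w x)) \<in> A" by (intro mult_in power uA v1 wA)
    fix x assume x: "x \<in> E"
    have "?F x * (v1 x * v x ^ Suc N) = v1 x * (v x ^ Suc N * ?F x)" by (simp add: mult_ac)
    also have "\<dots> = (v1 x * u x ^ N) * (u x * w x)" using w(2) x by (simp add: mult_ac)
    also have "\<dots> = ?F x * (u x * (w1 x * w x))" using v1(4)[OF x] by (simp add: mult_ac)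
    finally show "?F x * (v1 x * v x ^ Suc N) = ?F x * (u x * (w1 x * w x))" .
  qed
  have "zero_on_D (\<lambda>x. v1 x * v x ^ Suc N)"
    unfolding zero_on_D_def
  proof
    fix x assume x: "x \<in> D"
    then have "x \<in> E" using D_sub by blast
    from eq[OF this] show "v1 x * v x ^ Suc N = 0" using u(2) x by (simp add: zero_on_D_def)
  qed
  then have "zero_on_D v1 \<or> zero_on_D (\<lambda>x. v x ^ Suc N)"
    using zero_on_D_mult[OF v1A power[OF vA]] by blast
  then show False using v1(2) v(2) zero_on_D_power[OF vA] by blast
qed

text \<open>
  Suitable powers of \<open>f\<close> and \<open>g\<close> have a product of weight zero, which vanishes on \<open>D\<close> because \<open>f\<close> does.
\<close>

theorem negative_weight_vanishes:
  assumes f: "f \<in> homog m" "m > 0" "\<not> vanishes f" and g: "g \<in> homog k" "k < 0"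
  shows "vanishes g"
proof -
  note fA = homogD(1)[OF f(1)] and gA = homogD(1)[OF g(1)]
  let ?u = "\<lambda>x. f x ^ nat (- k) * g x ^ nat m"
  have "?u \<in> homog (int (nat (- k)) * m + int (nat m) * k)"
    by (intro homog_mult homog_power f g)
  then have u: "?u \<in> homog 0" using f(2) g(2) by (simp add: mult.commute)
  have "zero_on_D f" by (rule nonzero_weight_zero_on_D[OF f(1)]) (use f(2) in simp)
  then have "zero_on_D ?u" using g(2) by (simp add: zero_on_D_def)
  then have "vanishes ?u" by (rule weight_zero_meets_ideal[OF f u])
  then show ?thesis
    using vanishes_mult[OF power[OF fA] power[OF gA]] vanishes_power[OF fA] vanishes_power[OF gA] f(3) by blast
qed

end

section \<open>The structure of the grading\<close>

text \<open>
  The function \<open>f0\<close> witnesses that some weight is positive; then no weight is negative.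
\<close>

locale positive_divisor = fixed_divisor +
  fixes f0 and m0 :: int
  assumes pos: "f0 \<in> homog m0" "m0 > 0" "\<not> vanishes f0"
begin

lemma weight_nonneg: "g \<in> homog k \<Longrightarrow> \<not> vanishes g \<Longrightarrow> k \<ge> 0"
  using negative_weight_vanishes[OF pos, of g k] by force

text \<open>
  A monomial of weight \<open>k\<close> splits into generators of weight zero, which go into the coefficient, and generators of
  positive weight, whose exponents are at most \<open>k\<close>. This leaves finitely many monomials.
\<close>

lemma homog_finite_span:
  obtains B where "finite (B :: (nat \<times> int \<Rightarrow> nat) set)"
    "\<And>h. h \<in> homog k \<Longrightarrow> \<exists>a. (\<forall>\<beta>\<in>B. a \<beta> \<in> homog 0) \<and> (\<forall>x\<in>E. h x = (\<Sum>\<beta>\<in>B. a \<beta> x * monomial \<beta> x))"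
proof -
  define B :: "(nat \<times> int \<Rightarrow> nat) set" where "B = PiE gens (\<lambda>g. if snd g > 0 then {..nat k} else {0})"
  have finB: "finite B" unfolding B_def by (intro finite_PiE finite_gens) auto
  let ?S = "\<lambda>h. \<exists>a. (\<forall>\<beta>\<in>B. a \<beta> \<in> homog 0) \<and> (\<forall>x\<in>E. h x = (\<Sum>\<beta>\<in>B. a \<beta> x * monomial \<beta> x))"
  have zero: "?S h" if "\<And>x. x \<in> E \<Longrightarrow> h x = 0" for h
    using that homog_const[of 0] by (intro exI[of _ "\<lambda>_ _. 0"]) auto
  have mono: "?S (part (\<lambda>x. \<kappa> * monomial \<alpha> x) k)" for \<kappa> \<alpha>
  proof (cases "k = (\<Sum>g\<in>gens. int (\<alpha> g) * snd g) \<and> \<not> vanishes (monomial \<alpha>)")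
    case False
    then show ?thesis by (intro zero) (auto simp: part_of_scaled_monomial vanishes_def)
  next
    case True
    let ?\<beta> = "restrict (\<lambda>g. if snd g > 0 then \<alpha> g else 0) gens"
    let ?r = "\<lambda>x. \<Prod>g\<in>gens. if snd g > 0 then 1 else gen g x ^ \<alpha> g"
    have split: "monomial \<alpha> x = ?r x * monomial ?\<beta> x" for x
      unfolding monomial_def prod.distrib[symmetric] by (rule prod.cong) auto
    have neg: "\<alpha> g = 0" if g: "g \<in> gens" "snd g < 0" for g
    proof (rule ccontr)
      assume a: "\<alpha> g \<noteq> 0"
      have "vanishes (gen g)" using weight_nonneg[OF gen_homog[OF g(1)]] g(2) by force
      then have "monomial \<alpha> x = 0" if "x \<in> E" for x
        unfolding monomial_def using g(1) a that finite_gens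
        by (intro prod_zero bexI[of _ g]) (auto simp: vanishes_def)
      then show False using True by (auto simp: vanishes_def)
    qed
    have r: "?r \<in> homog 0"
    proof -
      have "(\<lambda>x. if snd g > 0 then 1 else gen g x ^ \<alpha> g) \<in> homog 0" if g: "g \<in> gens" for g
      proof (cases "snd g = 0")
        case True
        then have "gen g \<in> homog 0" using gen_homog[OF g] by simp
        then show ?thesis using True homog_power0 by simp
      next
        case False
        then show ?thesis using neg[OF g] homog_const[of 1] by (cases "snd g > 0") auto
      qed
      then have "?r \<in> homog (\<Sum>g\<in>gens. 0)" by (rule homog_prod)
      then show ?thesis by simp
    qed
    have "\<alpha> g \<le> nat k" if g: "g \<in> gens" "snd g > 0" for g
    proof -
      have nn: "0 \<le> int (\<alpha> h) * snd h" if "h \<in> gens" for h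
        using neg[OF that] by (cases "snd h < 0") auto
      have "int (\<alpha> g) \<le> int (\<alpha> g) * snd g" using g(2) mult_left_mono[of 1 "snd g" "int (\<alpha> g)"] by simp
      also have "\<dots> \<le> (\<Sum>g\<in>gens. int (\<alpha> g) * snd g)"
        by (rule member_le_sum[OF g(1) _ finite_gens]) (use nn in auto)
      also have "\<dots> = k" using True by simp
      finally show ?thesis by simp
    qed
    then have \<beta>: "?\<beta> \<in> B" by (auto simp: B_def)
    let ?a = "\<lambda>\<beta>'. if \<beta>' = ?\<beta> then (\<lambda>x. \<kappa> * ?r x) else (\<lambda>_. 0)"
    have "\<forall>\<beta>'\<in>B. ?a \<beta>' \<in> homog 0"
      using homog_mult0[OF homog_const[of \<kappa>] r] homog_const[of 0] by auto
    moreover have "part (\<lambda>x. \<kappa> * monomial \<alpha> x) k x = (\<Sum>\<beta>'\<in>B. ?a \<beta>' x * monomial \<beta>' x)" if "x \<in> E" for x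
    proof -
      have "(\<Sum>\<beta>'\<in>B. ?a \<beta>' x * monomial \<beta>' x) = (\<Sum>\<beta>'\<in>B. if \<beta>' = ?\<beta> then \<kappa> * ?r x * monomial \<beta>' x else 0)"
        by (rule sum.cong) auto
      also have "\<dots> = \<kappa> * ?r x * monomial ?\<beta> x" using finB \<beta> by simp
      finally have *: "(\<Sum>\<beta>'\<in>B. ?a \<beta>' x * monomial \<beta>' x) = \<kappa> * ?r x * monomial ?\<beta> x" .
      have "part (\<lambda>x. \<kappa> * monomial \<alpha> x) k x = \<kappa> * monomial \<alpha> x"
        unfolding part_of_scaled_monomial[OF that] using True by simp
      then show ?thesis unfolding * split[of x] by (simp only: mult.assoc)
    qed
    ultimately show ?thesis by (intro exI[of _ ?a] conjI ballI) auto
  qed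
  have span: "?S (part s k)" if "s \<in> mspan" for s
    using that
  proof (induction rule: mspan.induct)
    case (scaled \<kappa> \<alpha>)
    show ?case by (rule mono)
  next
    case (add f g)
    obtain a b where a: "\<forall>\<beta>\<in>B. a \<beta> \<in> homog 0" "\<forall>x\<in>E. part f k x = (\<Sum>\<beta>\<in>B. a \<beta> x * monomial \<beta> x)"
      and b: "\<forall>\<beta>\<in>B. b \<beta> \<in> homog 0" "\<forall>x\<in>E. part g k x = (\<Sum>\<beta>\<in>B. b \<beta> x * monomial \<beta> x)"
      using add.IH by (elim exE conjE)
    show ?case
    proof (intro exI[of _ "\<lambda>\<beta> x. a \<beta> x + b \<beta> x"] conjI ballI)
      show "(\<lambda>x. a \<beta> x + b \<beta> x) \<in> homog 0" if "\<beta> \<in> B" for \<beta> using a(1) b(1) that by (intro homog_add) auto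
      show "part (\<lambda>x. f x + g x) k x = (\<Sum>\<beta>\<in>B. (a \<beta> x + b \<beta> x) * monomial \<beta> x)" if "x \<in> E" for x
        using a(2) b(2) that part_add[OF mspan_in[OF add.hyps(1)] mspan_in[OF add.hyps(2)] that]
        by (simp add: distrib_right sum.distrib)
    qed
  qed
  have "?S h" if h: "h \<in> homog k" for h
  proof -
    obtain s where s: "s \<in> mspan" "\<And>x. x \<in> E \<Longrightarrow> h x = s x"
      by (rule mspan_represents[OF homogD(1)[OF h]]) (rule that)
    have eq: "part s k x = h x" if "x \<in> E" for x
      using part_cong[OF homogD(1)[OF h] s(2) that] part_of_homog[OF h that] by simp
    obtain a where a: "\<forall>\<beta>\<in>B. a \<beta> \<in> homog 0" "\<forall>x\<in>E. part s k x = (\<Sum>\<beta>\<in>B. a \<beta> x * monomial \<beta> x)"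
      using span[OF s(1)] by (elim exE conjE)
    then have "\<forall>x\<in>E. h x = (\<Sum>\<beta>\<in>B. a \<beta> x * monomial \<beta> x)" by (simp add: eq)
    with a(1) show ?thesis by (intro exI conjI)
  qed
  with finB show ?thesis by (rule that)
qed

text \<open>
  In the localisation at \<open>v\<close>, functions of large weight are divisible by \<open>f\<close>, so \<open>v\<^sup>l g\<^sup>l\<^sup>+\<^sup>q / f\<^sup>l\<close> is a regular
  function \<open>H l\<close> for all \<open>l\<close>. All the functions \<open>H l\<close> have the weight \<open>q k\<close>, so they lie in a finitely generated module over \<open>A\<^sub>0\<close> and satisfy
  a linear relation over \<open>A\<^sub>0\<close>. Cancelling \<open>g\<^sup>q\<close> leaves a nontrivial polynomial equation for \<open>g / f\<close> over \<open>A\<^sub>0\<close>, whose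
  leading coefficient \<open>b\<close> makes \<open>b g / f\<close> integral. By normality it is regular, of weight zero.
\<close>

theorem same_weight_proportional:
  assumes f: "f \<in> homog k" "\<not> vanishes f" and g: "g \<in> homog k" and k: "k > 0"
  obtains b h where "b \<in> homog 0" "\<not> vanishes b" "h \<in> homog 0" "\<And>x. x \<in> E \<Longrightarrow> b x * g x = f x * h x"
proof (cases "vanishes g")
  case True
  have "\<not> vanishes (\<lambda>_. 1)" using nonempty by (auto simp: vanishes_def)
  then show ?thesis
    using that[of "\<lambda>_. 1" "\<lambda>_. 0"] homog_const True by (auto simp: vanishes_def)
next
  case ng: False
  note fA = homogD(1)[OF f(1)] and gA = homogD(1)[OF g]
  have fD: "zero_on_D f" by (rule nonzero_weight_zero_on_D[OF f(1)]) (use k in simp)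
  obtain v e where v: "v \<in> homog 0" "\<not> zero_on_D v"
    and div: "\<And>l h. l \<ge> e \<Longrightarrow> h \<in> homog l \<Longrightarrow> \<exists>w\<in>homog (l - k). \<forall>x\<in>E. v x * h x = f x * w x"
    by (rule high_weight_divisible[OF f(1) fD f(2)]) (rule that)
  have nv: "\<not> vanishes v" using v(2) zero_on_D_if_vanishes by blast
  note vA = homogD(1)[OF v(1)]
  define q where "q = nat e + 1"
  have "e \<le> int q" by (simp add: q_def)
  also have "int q \<le> int q * k" using k mult_left_mono[of 1 k "int q"] by simp
  finally have qe: "e \<le> int q * k" .
  have "\<exists>h\<in>homog (int q * k). \<forall>x\<in>E. v x ^ l * g x ^ (l + q) = f x ^ l * h x" for l
  proof (induction l)
    case 0
    show ?case using homog_power[OF g, of q] by (intro bexI[of _ "\<lambda>x. g x ^ q"]) auto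
  next
    case (Suc l)
    then obtain h where h: "h \<in> homog (int q * k)" "\<forall>x\<in>E. v x ^ l * g x ^ (l + q) = f x ^ l * h x" by blast
    have gh: "(\<lambda>x. g x * h x) \<in> homog (k + int q * k)" by (rule homog_mult[OF g h(1)])
    obtain w where w: "w \<in> homog (int q * k)" "\<forall>x\<in>E. v x * (g x * h x) = f x * w x"
      using div[OF _ gh] qe k by auto
    have "v x ^ Suc l * g x ^ (Suc l + q) = f x ^ Suc l * w x" if "x \<in> E" for x
    proof -
      have "v x ^ Suc l * g x ^ (Suc l + q) = v x * g x * (v x ^ l * g x ^ (l + q))" by (simp add: mult_ac)
      also have "\<dots> = f x ^ l * (v x * (g x * h x))" using h(2) that by (simp add: mult_ac)
      also have "\<dots> = f x ^ Suc l * w x" using w(2) that by simp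
      finally show ?thesis .
    qed
    then show ?case using w(1) by blast
  qed
  then obtain H where H: "\<And>l. H l \<in> homog (int q * k)"
    "\<And>l x. x \<in> E \<Longrightarrow> v x ^ l * g x ^ (l + q) = f x ^ l * H l x" by metis
  obtain B where finB: "finite (B :: (nat \<times> int \<Rightarrow> nat) set)"
    and span: "\<And>h. h \<in> homog (int q * k) \<Longrightarrow>
      \<exists>a. (\<forall>\<beta>\<in>B. a \<beta> \<in> homog 0) \<and> (\<forall>x\<in>E. h x = (\<Sum>\<beta>\<in>B. a \<beta> x * monomial \<beta> x))"
    by (rule homog_finite_span[of "int q * k"]) (rule that)
  have "\<forall>l. \<exists>a. (\<forall>\<beta>\<in>B. a \<beta> \<in> homog 0) \<and> (\<forall>x\<in>E. H l x = (\<Sum>\<beta>\<in>B. a \<beta> x * monomial \<beta> x))"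
    using span[OF H(1)] by blast
  from choice[OF this] obtain a where a: "\<And>l \<beta>. \<beta> \<in> B \<Longrightarrow> a l \<beta> \<in> homog 0"
    "\<And>l x. x \<in> E \<Longrightarrow> H l x = (\<Sum>\<beta>\<in>B. a l \<beta> x * monomial \<beta> x)" by blast
  let ?m = "card B"
  have h0A: "homog 0 \<subseteq> A" using homogD(1) by blast
  have "\<exists>\<gamma>. (\<forall>l\<in>{..?m}. \<gamma> l \<in> homog 0) \<and> (\<exists>l\<in>{..?m}. \<not> vanishes (\<gamma> l)) \<and>
     (\<forall>\<beta>\<in>B. \<forall>x\<in>E. (\<Sum>l\<in>{..?m}. \<gamma> l x * a l \<beta> x) = 0)"
    by (rule linear_dependence[OF finB _ _ _ h0A]) (auto intro: a homog_const homog_add homog_mult0)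
  then obtain \<gamma> where rel: "\<forall>l\<in>{..?m}. \<gamma> l \<in> homog 0" "\<exists>l\<in>{..?m}. \<not> vanishes (\<gamma> l)"
    "\<forall>\<beta>\<in>B. \<forall>x\<in>E. (\<Sum>l\<in>{..?m}. \<gamma> l x * a l \<beta> x) = 0" by (elim exE conjE)
  from rel(2) obtain l0 where l0: "l0 \<le> ?m" "\<not> vanishes (\<gamma> l0)" by auto
  have \<gamma>: "\<And>l. l \<le> ?m \<Longrightarrow> \<gamma> l \<in> homog 0" "l0 \<le> ?m" "\<not> vanishes (\<gamma> l0)"
    "\<And>\<beta> x. \<beta> \<in> B \<Longrightarrow> x \<in> E \<Longrightarrow> (\<Sum>l\<le>?m. \<gamma> l x * a l \<beta> x) = 0"
    using rel(1,3) l0 by simp_all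
  let ?d = "\<lambda>l x. \<gamma> l x * v x ^ l"
  have d0: "?d l \<in> homog 0" if "l \<le> ?m" for l
    by (intro homog_mult0 \<gamma> that homog_power0 v)
  have \<gamma>H: "(\<Sum>l\<le>?m. \<gamma> l x * H l x) = 0" if x: "x \<in> E" for x
  proof -
    have "(\<Sum>l\<le>?m. \<gamma> l x * H l x) = (\<Sum>l\<le>?m. \<Sum>\<beta>\<in>B. monomial \<beta> x * (\<gamma> l x * a l \<beta> x))"
      using a(2)[OF x] by (simp add: sum_distrib_left mult_ac)
    also have "\<dots> = (\<Sum>\<beta>\<in>B. \<Sum>l\<le>?m. monomial \<beta> x * (\<gamma> l x * a l \<beta> x))" by (rule sum.swap)
    also have "\<dots> = (\<Sum>\<beta>\<in>B. monomial \<beta> x * (\<Sum>l\<le>?m. \<gamma> l x * a l \<beta> x))" by (simp add: sum_distrib_left)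
    also have "\<dots> = 0" using \<gamma>(4)[OF _ x] by simp
    finally show ?thesis .
  qed
  let ?R = "\<lambda>x. \<Sum>l\<le>?m. ?d l x * g x ^ l * f x ^ (?m - l)"
  have RA: "?R \<in> A"
    by (intro sum_in mult_in power fA gA homogD(1)[OF \<gamma>(1)] vA) auto
  have "vanishes (\<lambda>x. g x ^ q * ?R x)"
    unfolding vanishes_def
  proof
    fix x assume x: "x \<in> E"
    have "g x ^ q * ?R x = (\<Sum>l\<le>?m. \<gamma> l x * f x ^ (?m - l) * (v x ^ l * g x ^ (l + q)))"
      by (simp add: sum_distrib_left power_add mult_ac)
    also have "\<dots> = (\<Sum>l\<le>?m. f x ^ ?m * (\<gamma> l x * H l x))"
    proof (rule sum.cong[OF refl])
      fix l assume "l \<in> {..?m}"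
      then have "f x ^ ?m = f x ^ (?m - l) * f x ^ l" by (simp add: power_add[symmetric])
      then show "\<gamma> l x * f x ^ (?m - l) * (v x ^ l * g x ^ (l + q)) = f x ^ ?m * (\<gamma> l x * H l x)"
        unfolding H(2)[OF x] by (simp add: mult_ac)
    qed
    also have "\<dots> = 0" using \<gamma>H[OF x] by (simp add: sum_distrib_left[symmetric])
    finally show "g x ^ q * ?R x = 0" .
  qed
  then have R0: "vanishes ?R"
    using vanishes_mult[OF power[OF gA] RA] vanishes_power[OF gA] ng by blast
  let ?L = "{l. l \<le> ?m \<and> \<not> vanishes (?d l)}"
  \<comment> \<open>\<open>M\<close> is the degree of the equation; the terms above it vanish, and the power of \<open>f\<close> that is common to the
      others can be cancelled.\<close>
  define M where "M = Max ?L"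
  have "\<not> vanishes (?d l0)"
    using vanishes_mult[OF homogD(1)[OF \<gamma>(1)[OF \<gamma>(2)]] power[OF vA]] vanishes_power[OF vA] nv \<gamma>(3) by blast
  then have "l0 \<in> ?L" using \<gamma>(2) by simp
  moreover have finL: "finite ?L" by simp
  ultimately have "M \<in> ?L" unfolding M_def by (intro Max_in) auto
  then have M: "M \<le> ?m" "\<not> vanishes (?d M)" by auto
  have above: "?d l x = 0" if "l \<le> ?m" "M < l" "x \<in> E" for l x
  proof (rule ccontr)
    assume "?d l x \<noteq> 0"
    then have "l \<in> ?L" using that by (auto simp: vanishes_def)
    then have "l \<le> M" unfolding M_def by (rule Max_ge[OF finL])
    then show False using that by simp
  qed
  let ?R' = "\<lambda>x. \<Sum>l\<le>M. ?d l x * g x ^ l * f x ^ (M - l)"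
  have R'A: "?R' \<in> A"
    by (intro sum_in mult_in power fA gA homogD(1)[OF \<gamma>(1)] vA) (use M in auto)
  have "f x ^ (?m - M) * ?R' x = ?R x" if x: "x \<in> E" for x
  proof -
    have "f x ^ (?m - M) * ?R' x = (\<Sum>l\<le>M. ?d l x * g x ^ l * f x ^ (?m - l))"
      unfolding sum_distrib_left
    proof (rule sum.cong[OF refl])
      fix l assume "l \<in> {..M}"
      then have "f x ^ (?m - l) = f x ^ (?m - M) * f x ^ (M - l)"
        using M(1) by (simp add: power_add[symmetric])
      then show "f x ^ (?m - M) * (?d l x * g x ^ l * f x ^ (M - l)) = ?d l x * g x ^ l * f x ^ (?m - l)"
        by (simp add: mult_ac)
    qed
    also have "\<dots> = ?R x"
    proof (rule sum.mono_neutral_left)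
      show "\<forall>l\<in>{..?m} - {..M}. ?d l x * g x ^ l * f x ^ (?m - l) = 0" using above x by auto
    qed (use M in auto)
    finally show ?thesis .
  qed
  then have "vanishes (\<lambda>x. f x ^ (?m - M) * ?R' x)" using R0 by (simp add: vanishes_def)
  then have R'0: "vanishes ?R'"
    using vanishes_mult[OF power[OF fA] R'A] vanishes_power[OF fA] f(2) by blast
  have M0: "M \<noteq> 0"
  proof
    assume "M = 0"
    then show False using R'0 M(2) by (auto simp: vanishes_def)
  qed
  let ?b = "?d M"
  have bA: "?b \<in> A" using homogD(1)[OF d0[OF M(1)]] .
  have "\<exists>h\<in>A. \<forall>x\<in>E. ?b x * g x = f x * h x"
  \<comment> \<open>The equation of degree \<open>M\<close> for \<open>g / f\<close> with leading coefficient \<open>b\<close>, multiplied by \<open>b\<^sup>M\<^sup>-\<^sup>1\<close>, is a monic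
      equation for \<open>b g / f\<close>.\<close>
  proof (rule normal[where m = M and a = "\<lambda>l x. ?d l x * ?b x ^ (M - 1 - l)", OF mult_in[OF bA gA] fA f(2)])
    show "(\<lambda>x. ?d l x * ?b x ^ (M - 1 - l)) \<in> A" if "l < M" for l
      by (intro mult_in power bA homogD(1)[OF \<gamma>(1)] vA) (use that M in auto)
    fix x assume x: "x \<in> E"
    have "(\<Sum>l<M. ?d l x * ?b x ^ (M - 1 - l) * (?b x * g x) ^ l * f x ^ (M - l))
        = (\<Sum>l<M. ?b x ^ (M - 1) * (?d l x * g x ^ l * f x ^ (M - l)))"
    proof (rule sum.cong[OF refl])
      fix l assume "l \<in> {..<M}"
      then have e: "?b x ^ (M - 1) = ?b x ^ (M - 1 - l) * ?b x ^ l" by (simp add: power_add[symmetric])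
      show "?d l x * ?b x ^ (M - 1 - l) * (?b x * g x) ^ l * f x ^ (M - l) = ?b x ^ (M - 1) * (?d l x * g x ^ l * f x ^ (M - l))"
        unfolding e power_mult_distrib[of "?b x" "g x" l] by (simp only: mult_ac)
    qed
    also have "\<dots> = ?b x ^ (M - 1) * (\<Sum>l<M. ?d l x * g x ^ l * f x ^ (M - l))"
      by (simp only: sum_distrib_left)
    finally have s: "(\<Sum>l<M. ?d l x * ?b x ^ (M - 1 - l) * (?b x * g x) ^ l * f x ^ (M - l))
      = ?b x ^ (M - 1) * (\<Sum>l<M. ?d l x * g x ^ l * f x ^ (M - l))" .
    have "?b x ^ M = ?b x ^ (M - 1) * ?b x" using M0 by (cases M) auto
    then have "(?b x * g x) ^ M = ?b x ^ (M - 1) * (?d M x * g x ^ M)"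
      unfolding power_mult_distrib[of "?b x" "g x" M] by (simp only: mult_ac)
    then have "(?b x * g x) ^ M + (\<Sum>l<M. ?d l x * ?b x ^ (M - 1 - l) * (?b x * g x) ^ l * f x ^ (M - l))
      = ?b x ^ (M - 1) * ?R' x"
      unfolding s by (simp add: lessThan_Suc_atMost[symmetric] distrib_left)
    also have "\<dots> = 0" using R'0 x by (simp add: vanishes_def)
    finally show "(?b x * g x) ^ M + (\<Sum>l<M. ?d l x * ?b x ^ (M - 1 - l) * (?b x * g x) ^ l * f x ^ (M - l)) = 0" .
  qed
  then obtain h where h: "h \<in> A" "\<forall>x\<in>E. ?b x * g x = f x * h x" by blast
  have "h \<in> homog (k - k)"
    by (rule homog_quotient[OF homog_mult0[OF d0[OF M(1)] g] f h(1)]) (use h(2) in simp)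
  then show ?thesis using that[of ?b h] d0[OF M(1)] M(2) h(2) by simp
qed

text \<open>
  Let \<open>d\<close> be the least positive difference of two occurring weights \<open>b\<close> and \<open>b + d\<close>, and let \<open>g\<close> and \<open>f\<close> have these weights. The
  powers \<open>f\<^sup>b\<close> and \<open>g\<^sup>b\<^sup>+\<^sup>d\<close> have the same weight, so they are proportional over \<open>A\<^sub>0\<close>, say \<open>e f\<^sup>b = h g\<^sup>b\<^sup>+\<^sup>d\<close>. Hence \<open>(e f / g)\<^sup>b\<close>
  is regular, and normality makes \<open>z = e f / g\<close> a regular function of weight \<open>d\<close> (for \<open>b = 0\<close> take \<open>z = f\<close>). Division with remainder shows that \<open>d\<close>
  divides every weight, so each generator of positive weight is proportional to a power of \<open>z\<close>; the product of the
  denominators is \<open>a\<close>.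
\<close>

theorem slice:
  obtains z a d where "d > (0::nat)" "z \<in> homog (int d)" "\<not> vanishes z" "a \<in> homog 0" "\<not> vanishes a"
    "\<And>k h. h \<in> homog k \<Longrightarrow> \<not> vanishes h \<Longrightarrow> int d dvd k"
    "\<And>k h. h \<in> homog k \<Longrightarrow> k > 0 \<Longrightarrow> \<exists>w\<in>A. \<forall>x\<in>E. a x * h x = z x * w x"
proof -
  define occurs where "occurs k \<longleftrightarrow> (\<exists>h\<in>homog k. \<not> vanishes h)" for k
  have one: "\<not> vanishes (\<lambda>_. 1)" using nonempty by (auto simp: vanishes_def)
  have occ_add: "occurs (k + l)" if k: "occurs k" and l: "occurs l" for k l
  proof -
    obtain f g where "f \<in> homog k" "\<not> vanishes f" "g \<in> homog l" "\<not> vanishes g"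
      using k l unfolding occurs_def by blast
    then show ?thesis unfolding occurs_def
      using vanishes_mult[OF homogD(1) homogD(1), of f k g l]
      by (intro bexI[of _ "\<lambda>x. f x * g x"] homog_mult) auto
  qed
  have occ0: "occurs 0" unfolding occurs_def using homog_const[of 1] one by blast
  let ?P = "\<lambda>d::nat. d > 0 \<and> (\<exists>b. occurs b \<and> occurs (b + int d))"
  have "occurs m0" using pos unfolding occurs_def by blast
  then have "?P (nat m0)" using occ0 pos(2) by (intro conjI exI[of _ 0]) auto
  then obtain d where d: "?P d" and d_min: "\<And>r. ?P r \<Longrightarrow> d \<le> r"
    using LeastI[of ?P] Least_le[of ?P] by blast
  then have d0: "d > 0" by blast
  from d obtain b where b: "occurs b" "occurs (b + int d)" by blast
  then obtain g f where g: "g \<in> homog b" "\<not> vanishes g" and f: "f \<in> homog (b + int d)" "\<not> vanishes f"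
    unfolding occurs_def by blast
  note fA = homogD(1)[OF f(1)] and gA = homogD(1)[OF g(1)]
  have b0: "b \<ge> 0" by (rule weight_nonneg[OF g])
  have "\<exists>z\<in>homog (int d). \<not> vanishes z"
  proof (cases "b = 0")
    case True
    then show ?thesis using f by auto
  next
    case False
    define s where "s = nat b"
    have s: "s > 0" "int s = b" using b0 False by (auto simp: s_def)
    let ?F = "\<lambda>x. g x ^ (s + d)" and ?G = "\<lambda>x. f x ^ s"
    have F: "?F \<in> homog (int s * (b + int d))"
      using homog_power[OF g(1), of "s + d"] s(2) by (simp add: algebra_simps)
    have G: "?G \<in> homog (int s * (b + int d))" by (rule homog_power[OF f(1)])
    have nF: "\<not> vanishes ?F" using vanishes_power[OF gA] g(2) by blast
    have pos': "int s * (b + int d) > 0" using s d0 b0 by (intro mult_pos_pos) auto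
    obtain e h where eh: "e \<in> homog 0" "\<not> vanishes e" "h \<in> homog 0" "\<And>x. x \<in> E \<Longrightarrow> e x * ?G x = ?F x * h x"
      by (rule same_weight_proportional[OF F nF G pos']) (rule that)
    note eA = homogD(1)[OF eh(1)] and hA = homogD(1)[OF eh(3)]
    have ef: "(\<lambda>x. e x * f x) \<in> homog (b + int d)" by (rule homog_mult0[OF eh(1) f(1)])
    let ?y = "\<lambda>x. 0 - e x ^ (s - 1) * g x ^ d * h x"
    have yA: "?y \<in> A" by (intro diff const_in mult_in power eA gA hA)
    have "\<exists>z\<in>A. \<forall>x\<in>E. e x * f x = g x * z x"
    proof (rule normal[where m = s and a = "\<lambda>i. if i = 0 then ?y else (\<lambda>_. 0)", OF homogD(1)[OF ef] gA g(2)])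
      show "(if i = 0 then ?y else (\<lambda>_. 0)) \<in> A" for i :: nat using yA const_in[of 0] by simp
      fix x assume x: "x \<in> E"
      have "(\<Sum>i<s. (if i = 0 then ?y else (\<lambda>_. 0)) x * (e x * f x) ^ i * g x ^ (s - i))
          = (\<Sum>i<s. if i = 0 then ?y x * g x ^ s else 0)" by (rule sum.cong) auto
      also have "\<dots> = ?y x * g x ^ s" using s(1) by simp
      also have "\<dots> = - (e x ^ (s - 1) * (g x ^ (s + d) * h x))" by (simp add: power_add mult_ac)
      also have "\<dots> = - (e x ^ (s - 1) * (e x * f x ^ s))" unfolding eh(4)[OF x] ..
      also have "e x ^ (s - 1) * (e x * f x ^ s) = (e x * f x) ^ s"
        using s(1) by (cases s) (auto simp: power_mult_distrib mult_ac)
      finally show "(e x * f x) ^ s + (\<Sum>i<s. (if i = 0 then ?y else (\<lambda>_. 0)) x * (e x * f x) ^ i * g x ^ (s - i)) = 0"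
        by simp
    qed
    then obtain z where z: "z \<in> A" "\<forall>x\<in>E. e x * f x = g x * z x" by blast
    have "z \<in> homog (b + int d - b)" by (rule homog_quotient[OF ef g z(1)]) (use z(2) in simp)
    moreover have "\<not> vanishes z"
    proof
      assume "vanishes z"
      then have "vanishes (\<lambda>x. e x * f x)" using z(2) by (simp add: vanishes_def)
      then show False using vanishes_mult[OF eA fA] eh(2) f(2) by blast
    qed
    ultimately show ?thesis by auto
  qed
  then obtain z where z: "z \<in> homog (int d)" "\<not> vanishes z" by blast
  note zA = homogD(1)[OF z(1)]
  have zpow: "(\<lambda>x. z x ^ j) \<in> homog (int j * int d)" "\<not> vanishes (\<lambda>x. z x ^ j)" for j
    using homog_power[OF z(1)] vanishes_power[OF zA] z(2) by blast+
  have dvd: "int d dvd k" if h: "h \<in> homog k" "\<not> vanishes h" for k h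
  proof (rule ccontr)
    assume nd: "\<not> int d dvd k"
    have k0: "k \<ge> 0" by (rule weight_nonneg[OF h])
    have r: "k mod int d > 0" "k mod int d < int d"
    proof -
      have "k mod int d \<noteq> 0" using nd by (simp only: dvd_eq_mod_eq_0 not_False_eq_True)
      moreover have "0 \<le> k mod int d" using d0 by simp
      ultimately show "k mod int d > 0" by linarith
      show "k mod int d < int d" using d0 by simp
    qed
    let ?q = "nat (k div int d)"
    have q: "int ?q = k div int d" using k0 d0 by (simp add: pos_imp_zdiv_nonneg_iff)
    have "occurs (int ?q * int d)" using zpow unfolding occurs_def by blast
    moreover have "int ?q * int d + int (nat (k mod int d)) = k" using q r by simp
    then have "occurs (int ?q * int d + int (nat (k mod int d)))" using h unfolding occurs_def by auto
    ultimately have "?P (nat (k mod int d))" using r by auto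
    then have "d \<le> nat (k mod int d)" by (rule d_min)
    then show False using r by simp
  qed
  have "\<exists>a\<in>homog 0. \<not> vanishes a \<and> (\<forall>g\<in>F. snd g > 0 \<longrightarrow> (\<exists>w\<in>A. \<forall>x\<in>E. a x * gen g x = z x * w x))"
    if "finite F" "F \<subseteq> gens" for F
    using that
  proof (induction F rule: finite_induct)
    case empty
    show ?case using homog_const one by (intro bexI[of _ "\<lambda>_. 1"]) auto
  next
    case (insert g F)
    then obtain a where a: "a \<in> homog 0" "\<not> vanishes a"
      "\<forall>g\<in>F. snd g > 0 \<longrightarrow> (\<exists>w\<in>A. \<forall>x\<in>E. a x * gen g x = z x * w x)" by auto
    have gg: "g \<in> gens" using insert.prems by simp
    have "\<exists>b\<in>homog 0. \<not> vanishes b \<and> (snd g > 0 \<longrightarrow> (\<exists>w\<in>A. \<forall>x\<in>E. b x * gen g x = z x * w x))"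
    proof (cases "snd g > 0 \<and> \<not> vanishes (gen g)")
      case False
      then have "snd g > 0 \<longrightarrow> (\<exists>w\<in>A. \<forall>x\<in>E. 1 * gen g x = z x * w x)"
        using const_in[of 0] by (auto simp: vanishes_def intro!: bexI[of _ "\<lambda>_. 0"])
      then show ?thesis using homog_const[of 1] one by (intro bexI[of _ "\<lambda>_. 1"]) auto
    next
      case True
      then have "int d dvd snd g" using dvd[OF gen_homog[OF gg]] by blast
      then obtain j' where "snd g = int d * j'" by (elim dvdE)
      then have j': "snd g = j' * int d" "j' > 0" using True d0 by (auto simp: zero_less_mult_iff)
      define j where "j = nat j'"
      have j: "snd g = int j * int d" "j > 0" using j' by (auto simp: j_def)
      have gj: "gen g \<in> homog (int j * int d)" using gen_homog[OF gg] j(1) by simp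
      have pj: "int j * int d > 0" using True j(1) by simp
      obtain b h where b: "b \<in> homog 0" "\<not> vanishes b" "h \<in> homog 0"
        "\<And>x. x \<in> E \<Longrightarrow> b x * gen g x = z x ^ j * h x"
        by (rule same_weight_proportional[OF zpow[of j] gj pj]) (rule that)
      have wA: "(\<lambda>x. z x ^ (j - 1) * h x) \<in> A" by (intro mult_in power zA homogD(1)[OF b(3)])
      have "b x * gen g x = z x * (z x ^ (j - 1) * h x)" if "x \<in> E" for x
        using b(4)[OF that] j(2) by (cases j) auto
      then have "\<exists>w\<in>A. \<forall>x\<in>E. b x * gen g x = z x * w x" by (intro bexI[OF _ wA] ballI)
      then show ?thesis using b(1,2) by blast
    qed
    then obtain b where b: "b \<in> homog 0" "\<not> vanishes b"
      "snd g > 0 \<longrightarrow> (\<exists>w\<in>A. \<forall>x\<in>E. b x * gen g x = z x * w x)" by blast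
    have "\<exists>w\<in>A. \<forall>x\<in>E. a x * b x * gen g' x = z x * w x" if g': "g' \<in> insert g F" "snd g' > 0" for g'
    proof (cases "g' = g")
      case True
      then obtain w where w: "w \<in> A" "\<forall>x\<in>E. b x * gen g' x = z x * w x" using b(3) g' by blast
      then have "a x * b x * gen g' x = z x * (a x * w x)" if "x \<in> E" for x
        using that by (simp add: mult.assoc mult.left_commute)
      then show ?thesis by (intro bexI[OF _ mult_in[OF homogD(1)[OF a(1)] w(1)]] ballI)
    next
      case False
      then obtain w where w: "w \<in> A" "\<forall>x\<in>E. a x * gen g' x = z x * w x" using a(3) g' by blast
      have "a x * b x * gen g' x = z x * (b x * w x)" if "x \<in> E" for x
      proof -
        have "a x * b x * gen g' x = b x * (a x * gen g' x)" by (simp add: mult_ac)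
        then show ?thesis using w(2) that by (simp add: mult_ac)
      qed
      then show ?thesis by (intro bexI[OF _ mult_in[OF homogD(1)[OF b(1)] w(1)]] ballI)
    qed
    moreover have "\<not> vanishes (\<lambda>x. a x * b x)"
      using vanishes_mult[OF homogD(1)[OF a(1)] homogD(1)[OF b(1)]] a b by blast
    ultimately show ?case using homog_mult0[OF a(1) b(1)] by (intro bexI[of _ "\<lambda>x. a x * b x"]) auto
  qed
  from this[OF finite_gens order.refl] obtain a where a: "a \<in> homog 0" "\<not> vanishes a"
    "\<forall>g\<in>gens. snd g > 0 \<longrightarrow> (\<exists>w\<in>A. \<forall>x\<in>E. a x * gen g x = z x * w x)" by blast
  have main: "\<exists>w\<in>A. \<forall>x\<in>E. a x * h x = z x * w x" if h: "h \<in> homog k" and k: "k > 0" for k h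
    by (rule high_weight_multiple[OF homogD(1)[OF a(1)] zA _ _ h, of 0]) (use a(3) k in auto)
  show ?thesis
    by (rule that[OF d0 z a(1,2)]) (erule (1) dvd, erule (1) main)
qed

end

section \<open>The additive group action of a slice\<close>

text \<open>
  The graded algebras found above, as subalgebras of a polynomial ring in \<open>z\<close> over the fractions of weight zero that are stable
  under the derivation \<open>a \<cdot> d/dz\<close>. The assumptions on the coordinates \<open>c\<close> say that \<open>c\<close> embeds \<open>E\<close> as a closed subset of affine space.
\<close>

locale slice_algebra = weighted_algebra E A act
  for E :: "'a set" and A :: "('a \<Rightarrow> 'k::{alg_closed_field, field_char_0}) set" and act +
  fixes z a :: "'a \<Rightarrow> 'k" and d n :: nat and c :: "'a \<Rightarrow> nat \<Rightarrow> 'k"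
  assumes d_pos: "d > 0"
    and z_homog: "z \<in> homog (int d)" and z_nz: "\<not> vanishes z"
    and a_homog: "a \<in> homog 0" and a_nz: "\<not> vanishes a"
    and weight_multiple: "h \<in> homog k \<Longrightarrow> \<not> vanishes h \<Longrightarrow> \<exists>j::nat. k = int j * int d"
    and lower: "h \<in> homog k \<Longrightarrow> k > 0 \<Longrightarrow> \<exists>w\<in>A. \<forall>x\<in>E. a x * h x = z x * w x"
    and proportional: "f \<in> homog k \<Longrightarrow> \<not> vanishes f \<Longrightarrow> g \<in> homog k \<Longrightarrow> k > 0 \<Longrightarrow>
       \<exists>b\<in>homog 0. \<exists>h\<in>homog 0. \<not> vanishes b \<and> (\<forall>x\<in>E. b x * g x = f x * h x)"
    and coord_in: "i < n \<Longrightarrow> (\<lambda>x. c x i) \<in> A"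
    and generated: "f \<in> A \<Longrightarrow> \<exists>p\<in>poly_funs n. \<forall>x\<in>E. f x = p (c x)"
    and c_ext: "x \<in> E \<Longrightarrow> c x \<in> {..<n} \<rightarrow>\<^sub>E UNIV"
    and c_inj: "inj_on c E"
    and c_closed: "w \<in> {..<n} \<rightarrow>\<^sub>E UNIV \<Longrightarrow> w \<notin> c ` E \<Longrightarrow> \<exists>p\<in>poly_funs n. p w \<noteq> 0 \<and> (\<forall>x\<in>E. p (c x) = 0)"
begin

lemma zA: "z \<in> A" and aA: "a \<in> A"
  using homogD(1) z_homog a_homog by blast+

lemma polynomial_in: "p \<in> poly_funs n \<Longrightarrow> (\<And>i. i < n \<Longrightarrow> (\<lambda>x. Y x i) \<in> A) \<Longrightarrow> (\<lambda>x. p (Y x)) \<in> A"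
  by (induction rule: poly_funs.induct) (simp_all add: const_in add_in mult_in)

lemma separates:
  assumes x: "x \<in> E" and y: "y \<in> E" and eq: "\<And>f. f \<in> A \<Longrightarrow> f x = f y"
  shows "x = y"
proof -
  have "c x = c y"
    by (rule PiE_ext[OF c_ext[OF x] c_ext[OF y]]) (use eq[OF coord_in] in auto)
  then show ?thesis using c_inj x y by (auto dest: inj_onD)
qed

text \<open>
  A regular function is determined by its values at the points where \<open>q\<close> is not zero. Identities along the flow below
  are checked at points where the flow is given by the torus, and extended to all of \<open>E\<close> in this way.
\<close>

lemma dense:
  assumes q: "q \<in> A" "\<not> vanishes q" and f: "f \<in> A" and g: "g \<in> A"
    and eq: "\<And>x. x \<in> E \<Longrightarrow> q x \<noteq> 0 \<Longrightarrow> f x = g x" and x: "x \<in> E"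
  shows "f x = g x"
proof (rule cancel[OF q(1) f g q(2) _ x])
  show "q x * f x = q x * g x" if "x \<in> E" for x using eq[OF that] by (cases "q x = 0") auto
qed

lemma shift_nonzero:
  shows "(\<lambda>x. z x + s * a x) \<in> A" "\<not> vanishes (\<lambda>x. z x + s * a x)"
proof -
  show "(\<lambda>x. z x + s * a x) \<in> A" by (intro add_in mult_in const_in zA aA)
  show "\<not> vanishes (\<lambda>x. z x + s * a x)"
  proof
    assume v: "vanishes (\<lambda>x. z x + s * a x)"
    have "(\<lambda>x. (- s) * a x) \<in> homog 0" by (intro homog_mult0 homog_const a_homog)
    moreover have "(- s) * a x = z x" if "x \<in> E" for x
    proof -
      have "(- s) * a x = z x - (z x + s * a x)" by simp
      also have "\<dots> = z x" using v that by (simp add: vanishes_def)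
      finally show ?thesis .
    qed
    ultimately have "z \<in> homog 0" by (rule homog_cong)
    from homog_unique[OF z_homog this] show False using z_nz d_pos by simp
  qed
qed

text \<open>
  Where \<open>z\<close> is not zero, the additive group is to move \<open>x\<close> to \<open>\<tau> x\<close> with \<open>\<tau>\<^sup>d = 1 + s a(x) / z(x)\<close>. The function \<open>f\<close> expands if its
  value there is a polynomial in \<open>s\<close> with regular coefficients. Coefficients beyond the degree are
  zero functions, so that sums of different lengths can be added.
\<close>

definition expands :: "('a \<Rightarrow> 'k) \<Rightarrow> bool" where
  "expands f \<longleftrightarrow> (\<exists>m e. (\<forall>j. e j \<in> A) \<and> (\<forall>j. m < j \<longrightarrow> e j = (\<lambda>_. 0)) \<and>
     (\<forall>x s \<tau>. x \<in> E \<longrightarrow> z x \<noteq> 0 \<longrightarrow> \<tau> \<noteq> 0 \<longrightarrow> \<tau> ^ d = 1 + s * a x / z x \<longrightarrow>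
        f (act \<tau> x) = (\<Sum>j\<le>m. s ^ j * e j x)))"

lemma expandsE:
  assumes "expands f"
  obtains m e where "\<And>j. e j \<in> A" "\<And>j. m < j \<Longrightarrow> e j = (\<lambda>_. 0)"
    "\<And>x s \<tau>. x \<in> E \<Longrightarrow> z x \<noteq> 0 \<Longrightarrow> \<tau> \<noteq> 0 \<Longrightarrow> \<tau> ^ d = 1 + s * a x / z x \<Longrightarrow>
        f (act \<tau> x) = (\<Sum>j\<le>(m::nat). s ^ j * e j x)"
  using assms unfolding expands_def by blast

lemma expands_cong:
  assumes f: "expands f" and eq: "\<And>x. x \<in> E \<Longrightarrow> f x = g x"
  shows "expands g"
proof (rule expandsE[OF f])
  fix m e assume e: "\<And>j. e j \<in> A" "\<And>j. m < j \<Longrightarrow> e j = (\<lambda>_. 0)"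
    "\<And>x s \<tau>. x \<in> E \<Longrightarrow> z x \<noteq> 0 \<Longrightarrow> \<tau> \<noteq> 0 \<Longrightarrow> \<tau> ^ d = 1 + s * a x / z x \<Longrightarrow>
        f (act \<tau> x) = (\<Sum>j\<le>(m::nat). s ^ j * e j x)"
  show ?thesis unfolding expands_def
  proof (intro exI[of _ m] exI[of _ e] conjI allI impI)
    fix x s \<tau> assume h: "x \<in> E" "z x \<noteq> 0" "\<tau> \<noteq> 0" "\<tau> ^ d = 1 + s * a x / z x"
    show "g (act \<tau> x) = (\<Sum>j\<le>m. s ^ j * e j x)"
      using e(3)[OF h] eq[OF act_in[OF h(3,1)]] by simp
  qed (use e in auto)
qed

lemma expands_add:
  assumes "expands f" "expands g"
  shows "expands (\<lambda>x. f x + g x)"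
proof (rule expandsE[OF assms(1)], rule expandsE[OF assms(2)])
  fix m e l e' assume e: "\<And>j. e j \<in> A" "\<And>j. m < j \<Longrightarrow> e j = (\<lambda>_. 0)"
    "\<And>x s \<tau>. x \<in> E \<Longrightarrow> z x \<noteq> 0 \<Longrightarrow> \<tau> \<noteq> 0 \<Longrightarrow> \<tau> ^ d = 1 + s * a x / z x \<Longrightarrow>
        f (act \<tau> x) = (\<Sum>j\<le>(m::nat). s ^ j * e j x)"
    and e': "\<And>j. e' j \<in> A" "\<And>j. l < j \<Longrightarrow> e' j = (\<lambda>_. 0)"
    "\<And>x s \<tau>. x \<in> E \<Longrightarrow> z x \<noteq> 0 \<Longrightarrow> \<tau> \<noteq> 0 \<Longrightarrow> \<tau> ^ d = 1 + s * a x / z x \<Longrightarrow>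
        g (act \<tau> x) = (\<Sum>j\<le>(l::nat). s ^ j * e' j x)"
  show ?thesis unfolding expands_def
  proof (intro exI[of _ "m + l"] exI[of _ "\<lambda>j x. e j x + e' j x"] conjI allI impI)
    fix x s \<tau> assume h: "x \<in> E" "z x \<noteq> 0" "\<tau> \<noteq> 0" "\<tau> ^ d = 1 + s * a x / z x"
    have "(\<Sum>j\<le>m. s ^ j * e j x) = (\<Sum>j\<le>m + l. s ^ j * e j x)"
      by (rule sum.mono_neutral_left) (use e(2) in auto)
    moreover have "(\<Sum>j\<le>l. s ^ j * e' j x) = (\<Sum>j\<le>m + l. s ^ j * e' j x)"
      by (rule sum.mono_neutral_left) (use e'(2) in auto)
    ultimately show "f (act \<tau> x) + g (act \<tau> x) = (\<Sum>j\<le>m + l. s ^ j * (e j x + e' j x))"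
      using e(3)[OF h] e'(3)[OF h] by (simp add: distrib_left sum.distrib)
  next
    fix j show "(\<lambda>x. e j x + e' j x) \<in> A" by (intro add_in e e')
    assume "m + l < j" then show "(\<lambda>x. e j x + e' j x) = (\<lambda>_. 0)" using e(2)[of j] e'(2)[of j] by auto
  qed
qed

lemma expands_zero: "expands (\<lambda>_. 0)"
  unfolding expands_def by (intro exI[of _ 0] exI[of _ "\<lambda>_ _. 0"]) (auto intro: const_in)

text \<open>
  For \<open>h\<close> of weight \<open>l d\<close> the binomial theorem gives \<open>h (\<tau> x) = (1 + s a / z)\<^sup>l h = \<Sum>\<^sub>j (l choose j) s\<^sup>j (a / z)\<^sup>j h\<close>, and
  \<open>(a / z)\<^sup>j h\<close> is regular for \<open>j \<le> l\<close> because \<open>lower\<close> applies as long as the weight is positive.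
\<close>

lemma expands_homog:
  assumes h: "h \<in> homog k"
  shows "expands h"
proof (cases "vanishes h")
  case True
  then show ?thesis by (intro expands_cong[OF expands_zero]) (simp add: vanishes_def)
next
  case False
  then obtain l :: nat where k: "k = int l * int d" using weight_multiple[OF h] by blast
  have "\<exists>w\<in>homog (int (l - j) * int d). \<forall>x\<in>E. a x ^ j * h x = z x ^ j * w x" if "j \<le> l" for j
    using that
  proof (induction j)
    case 0
    show ?case using h k by (intro bexI[of _ h]) auto
  next
    case (Suc j)
    then obtain w where w: "w \<in> homog (int (l - j) * int d)" "\<forall>x\<in>E. a x ^ j * h x = z x ^ j * w x" by auto
    have "int (l - j) * int d > 0" using Suc.prems d_pos by simp
    from lower[OF w(1) this] obtain w' where w': "w' \<in> A" "\<forall>x\<in>E. a x * w x = z x * w' x" by blast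
    have "w' \<in> homog (int (l - j) * int d - int d)"
      by (rule homog_quotient[OF homog_mult0[OF a_homog w(1)] z_homog z_nz w'(1)]) (use w'(2) in simp)
    also have "int (l - j) * int d - int d = int (l - Suc j) * int d"
      using Suc.prems by (simp add: of_nat_diff algebra_simps)
    finally have "w' \<in> homog (int (l - Suc j) * int d)" .
    moreover have "a x ^ Suc j * h x = z x ^ Suc j * w' x" if "x \<in> E" for x
    proof -
      have "a x ^ Suc j * h x = a x * (a x ^ j * h x)" by simp
      also have "\<dots> = z x ^ j * (a x * w x)" using w(2) that by simp
      also have "\<dots> = z x ^ Suc j * w' x" using w'(2) that by simp
      finally show ?thesis .
    qed
    ultimately show ?case by blast
  qed
  then have "\<forall>j. \<exists>w. j \<le> l \<longrightarrow> w \<in> A \<and> (\<forall>x\<in>E. a x ^ j * h x = z x ^ j * w x)"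
    using homogD(1) by blast
  from choice[OF this] obtain w where w: "\<And>j. j \<le> l \<Longrightarrow> w j \<in> A"
    "\<And>j x. j \<le> l \<Longrightarrow> x \<in> E \<Longrightarrow> a x ^ j * h x = z x ^ j * w j x" by blast
  let ?e = "\<lambda>j. if j \<le> l then (\<lambda>x. of_nat (l choose j) * w j x) else (\<lambda>_. 0)"
  show ?thesis unfolding expands_def
  proof (intro exI[of _ l] exI[of _ ?e] conjI allI impI)
    show "?e j \<in> A" for j using mult_in[OF const_in w(1)] const_in by auto
    fix x s \<tau> assume x: "x \<in> E" "z x \<noteq> 0" "\<tau> \<noteq> 0" "\<tau> ^ d = 1 + s * a x / z x"
    have "h (act \<tau> x) = \<tau> powi k * h x" by (rule homogD(2)[OF h x(3,1)])
    also have "\<tau> powi k = \<tau> ^ (d * l)" unfolding k by (simp add: mult.commute flip: of_nat_mult)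
    also have "\<dots> = (s * a x / z x + 1) ^ l" unfolding power_mult x(4) by (simp add: add.commute)
    also have "\<dots> * h x = (\<Sum>j\<le>l. of_nat (l choose j) * (s * a x / z x) ^ j * h x)"
      by (simp add: binomial_ring sum_distrib_right)
    also have "\<dots> = (\<Sum>j\<le>l. s ^ j * ?e j x)"
    proof (rule sum.cong[OF refl])
      fix j assume "j \<in> {..l}"
      then have wj: "a x ^ j * h x / z x ^ j = w j x" using w(2)[OF _ x(1), of j] x(2) by simp
      have "of_nat (l choose j) * (s * a x / z x) ^ j * h x
          = of_nat (l choose j) * s ^ j * (a x ^ j * h x / z x ^ j)"
        by (simp add: power_mult_distrib power_divide)
      also have "\<dots> = s ^ j * ?e j x" unfolding wj using \<open>j \<in> {..l}\<close> by simp
      finally show "of_nat (l choose j) * (s * a x / z x) ^ j * h x = s ^ j * ?e j x" .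
    qed
    finally show "h (act \<tau> x) = (\<Sum>j\<le>l. s ^ j * ?e j x)" .
  qed auto
qed

lemma expands_all:
  assumes f: "f \<in> A"
  shows "expands f"
proof -
  obtain S where S: "\<And>x. x \<in> E \<Longrightarrow> f x = (\<Sum>k\<in>S. part f k x)"
    by (rule part_support[OF f]) (rule that)
  have "expands (\<lambda>x. \<Sum>k\<in>T. part f k x)" for T
    by (induction T rule: infinite_finite_induct)
      (simp_all add: expands_zero expands_add expands_homog[OF part_homog[OF f]])
  then show ?thesis by (rule expands_cong) (simp add: S)
qed

text \<open>
  The coordinates of the moved point, extended to the points with \<open>z x = 0\<close> by the regular expansions of the
  coordinate functions. Only the values on \<open>E\<close> are determined, hence the choice.
\<close>

definition flow_coords :: "'k \<Rightarrow> 'a \<Rightarrow> nat \<Rightarrow> 'k" where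
  "flow_coords = (SOME Y. \<forall>s. (\<forall>x. Y s x \<in> {..<n} \<rightarrow>\<^sub>E UNIV) \<and> (\<forall>i<n. (\<lambda>x. Y s x i) \<in> A) \<and>
     (\<forall>x \<tau>. x \<in> E \<longrightarrow> z x \<noteq> 0 \<longrightarrow> \<tau> \<noteq> 0 \<longrightarrow> \<tau> ^ d = 1 + s * a x / z x \<longrightarrow> Y s x = c (act \<tau> x)))"

definition flow :: "'k \<Rightarrow> 'a \<Rightarrow> 'a" where
  "flow s x = inv_into E c (flow_coords s x)"

lemma flow_coords:
  shows flow_coords_ext: "flow_coords s x \<in> {..<n} \<rightarrow>\<^sub>E UNIV"
    and flow_coords_in: "i < n \<Longrightarrow> (\<lambda>x. flow_coords s x i) \<in> A"
    and flow_coords_generic: "x \<in> E \<Longrightarrow> z x \<noteq> 0 \<Longrightarrow> \<tau> \<noteq> 0 \<Longrightarrow> \<tau> ^ d = 1 + s * a x / z x \<Longrightarrow>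
       flow_coords s x = c (act \<tau> x)"
proof -
  let ?P = "\<lambda>Y. \<forall>s. (\<forall>x. Y s x \<in> {..<n} \<rightarrow>\<^sub>E UNIV) \<and> (\<forall>i<n. (\<lambda>x. Y s x i) \<in> A) \<and>
     (\<forall>x \<tau>. x \<in> E \<longrightarrow> z x \<noteq> 0 \<longrightarrow> \<tau> \<noteq> 0 \<longrightarrow> \<tau> ^ d = 1 + s * a x / z x \<longrightarrow> Y s x = c (act \<tau> x))"
  have "\<forall>i. \<exists>F. i < n \<longrightarrow> (\<forall>s. (\<lambda>x. F s x) \<in> A) \<and>
     (\<forall>s x \<tau>. x \<in> E \<longrightarrow> z x \<noteq> 0 \<longrightarrow> \<tau> \<noteq> 0 \<longrightarrow> \<tau> ^ d = 1 + s * a x / z x \<longrightarrow> F s x = c (act \<tau> x) i)"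
  proof
    fix i
    show "\<exists>F. i < n \<longrightarrow> (\<forall>s. (\<lambda>x. F s x) \<in> A) \<and>
     (\<forall>s x \<tau>. x \<in> E \<longrightarrow> z x \<noteq> 0 \<longrightarrow> \<tau> \<noteq> 0 \<longrightarrow> \<tau> ^ d = 1 + s * a x / z x \<longrightarrow> F s x = c (act \<tau> x) i)"
    proof (cases "i < n")
      case True
      show ?thesis
      proof (rule expandsE[OF expands_all[OF coord_in[OF True]]])
        fix m e assume e: "\<And>j. e j \<in> A"
          "\<And>x s \<tau>. x \<in> E \<Longrightarrow> z x \<noteq> 0 \<Longrightarrow> \<tau> \<noteq> 0 \<Longrightarrow> \<tau> ^ d = 1 + s * a x / z x \<Longrightarrow>
            c (act \<tau> x) i = (\<Sum>j\<le>(m::nat). s ^ j * e j x)"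
        have "(\<lambda>x. \<Sum>j\<le>m. s ^ j * e j x) \<in> A" for s by (intro sum_in mult_in const_in e(1))
        then show ?thesis
          by (intro exI[of _ "\<lambda>s x. \<Sum>j\<le>m. s ^ j * e j x"] impI conjI allI e(2)[symmetric])
      qed
    qed auto
  qed
  from choice[OF this] obtain F where F: "\<And>i s. i < n \<Longrightarrow> (\<lambda>x. F i s x) \<in> A"
    "\<And>i s x \<tau>. i < n \<Longrightarrow> x \<in> E \<Longrightarrow> z x \<noteq> 0 \<Longrightarrow> \<tau> \<noteq> 0 \<Longrightarrow> \<tau> ^ d = 1 + s * a x / z x \<Longrightarrow>
       F i s x = c (act \<tau> x) i" by blast
  have "?P (\<lambda>s x. \<lambda>i\<in>{..<n}. F i s x)"
  proof (intro allI conjI impI)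
    fix s x \<tau> assume h: "x \<in> E" "z x \<noteq> 0" "\<tau> \<noteq> 0" "\<tau> ^ d = 1 + s * a x / z x"
    show "(\<lambda>i\<in>{..<n}. F i s x) = c (act \<tau> x)"
      by (rule PiE_ext[where k = "{..<n}" and s = "\<lambda>_. UNIV", OF _ c_ext[OF act_in[OF h(3,1)]]]) (use F(2)[OF _ h] in auto)
  qed (use F(1) in auto)
  then have *: "?P flow_coords" unfolding flow_coords_def by (rule someI[of ?P])
  then show "flow_coords s x \<in> {..<n} \<rightarrow>\<^sub>E UNIV" by blast
  from * show "i < n \<Longrightarrow> (\<lambda>x. flow_coords s x i) \<in> A" by blast
  from * show "x \<in> E \<Longrightarrow> z x \<noteq> 0 \<Longrightarrow> \<tau> \<noteq> 0 \<Longrightarrow> \<tau> ^ d = 1 + s * a x / z x \<Longrightarrow>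
       flow_coords s x = c (act \<tau> x)" by blast
qed

lemma root_exists:
  assumes "z x \<noteq> 0" "z x + s * a x \<noteq> 0"
  obtains \<tau> where "\<tau> \<noteq> 0" "\<tau> ^ d = 1 + s * a x / z x"
proof -
  obtain \<tau> where \<tau>: "\<tau> ^ d = 1 + s * a x / z x" using nth_root_exists[OF d_pos, of "1 + s * a x / z x"] by auto
  have "1 + s * a x / z x = (z x + s * a x) / z x" using assms(1) by (simp add: field_simps)
  then have "1 + s * a x / z x \<noteq> 0" using assms by simp
  then have "\<tau> \<noteq> 0" using \<tau> d_pos by (metis power_0_left less_irrefl)
  then show ?thesis using that \<tau> by blast
qed

lemma generic_nonzero:
  "(\<lambda>x. z x * (z x + s * a x)) \<in> A" "\<not> vanishes (\<lambda>x. z x * (z x + s * a x))"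
  using mult_in[OF zA shift_nonzero(1)] vanishes_mult[OF zA shift_nonzero(1)] z_nz shift_nonzero(2) by auto

text \<open>
  An equation of \<open>c ` E\<close>, evaluated at the moved coordinates, is a regular function of \<open>x\<close>. It vanishes where the flow
  is given by the torus, hence everywhere.
\<close>

lemma flow_coords_image:
  assumes x: "x \<in> E"
  shows "flow_coords s x \<in> c ` E"
proof (rule ccontr)
  assume no: "flow_coords s x \<notin> c ` E"
  obtain p where p: "p \<in> poly_funs n" "p (flow_coords s x) \<noteq> 0" "\<forall>x\<in>E. p (c x) = 0"
    using c_closed[OF flow_coords_ext no] by blast
  have "p (flow_coords s x) = (\<lambda>_. 0) x"
  proof (rule dense[OF generic_nonzero[of s] polynomial_in[OF p(1) flow_coords_in] const_in _ x])
    fix x assume x: "x \<in> E" "z x * (z x + s * a x) \<noteq> 0"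
    then obtain \<tau> where \<tau>: "\<tau> \<noteq> 0" "\<tau> ^ d = 1 + s * a x / z x" using root_exists[of x s] by auto
    then have "flow_coords s x = c (act \<tau> x)" using flow_coords_generic[OF x(1) _ \<tau>] x(2) by auto
    then show "p (flow_coords s x) = 0" using p(3) act_in[OF \<tau>(1) x(1)] by simp
  qed
  then show False using p(2) by simp
qed

lemma flow_in: "x \<in> E \<Longrightarrow> flow s x \<in> E"
  unfolding flow_def by (rule inv_into_into[OF flow_coords_image])

lemma c_flow: "x \<in> E \<Longrightarrow> c (flow s x) = flow_coords s x"
  unfolding flow_def by (rule f_inv_into_f[OF flow_coords_image])

lemma flow_generic:
  assumes "x \<in> E" "z x \<noteq> 0" "\<tau> \<noteq> 0" "\<tau> ^ d = 1 + s * a x / z x"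
  shows "flow s x = act \<tau> x"
  using c_flow[OF assms(1), of s] flow_coords_generic[OF assms] c_inj flow_in[OF assms(1)] act_in[OF assms(3,1)]
  by (auto dest: inj_onD)

lemma flow_pullback:
  assumes f: "f \<in> A"
  shows "(\<lambda>x. f (flow s x)) \<in> A"
proof -
  obtain p where p: "p \<in> poly_funs n" "\<forall>x\<in>E. f x = p (c x)" using generated[OF f] by blast
  show ?thesis
    by (rule cong[OF polynomial_in[where Y = "flow_coords s", OF p(1) flow_coords_in]])
      (simp_all add: p(2) flow_in c_flow)
qed

lemma flow_expansion:
  assumes f: "f \<in> A"
  obtains m e where "\<And>j. e j \<in> A" "\<And>s x. x \<in> E \<Longrightarrow> f (flow s x) = (\<Sum>j\<le>(m::nat). s ^ j * e j x)"
proof (rule expandsE[OF expands_all[OF f]])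
  fix m e assume e: "\<And>j. e j \<in> A"
    "\<And>x s \<tau>. x \<in> E \<Longrightarrow> z x \<noteq> 0 \<Longrightarrow> \<tau> \<noteq> 0 \<Longrightarrow> \<tau> ^ d = 1 + s * a x / z x \<Longrightarrow>
        f (act \<tau> x) = (\<Sum>j\<le>(m::nat). s ^ j * e j x)"
  have "f (flow s x) = (\<Sum>j\<le>m. s ^ j * e j x)" if x: "x \<in> E" for s x
  proof (rule dense[OF generic_nonzero[of s] flow_pullback[OF f] _ _ x])
    show "(\<lambda>x. \<Sum>j\<le>m. s ^ j * e j x) \<in> A" by (intro sum_in mult_in const_in e(1))
    fix x assume x: "x \<in> E" "z x * (z x + s * a x) \<noteq> 0"
    then obtain \<tau> where \<tau>: "\<tau> \<noteq> 0" "\<tau> ^ d = 1 + s * a x / z x" using root_exists[of x s] by auto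
    then show "f (flow s x) = (\<Sum>j\<le>m. s ^ j * e j x)" using flow_generic[OF x(1) _ \<tau>] e(2)[OF x(1) _ \<tau>] x(2) by auto
  qed
  then show ?thesis using that e(1) by blast
qed

lemma flow_slice: "x \<in> E \<Longrightarrow> z (flow s x) = z x + s * a x"
proof (rule dense[OF generic_nonzero[of s] flow_pullback[OF zA] shift_nonzero(1)])
  fix x assume x: "x \<in> E" "z x * (z x + s * a x) \<noteq> 0"
  then obtain \<tau> where \<tau>: "\<tau> \<noteq> 0" "\<tau> ^ d = 1 + s * a x / z x" using root_exists[of x s] by auto
  then have "z (flow s x) = \<tau> ^ d * z x"
    using flow_generic[OF x(1) _ \<tau>] x(2) homogD(2)[OF z_homog \<tau>(1) x(1)] by simp
  also have "\<dots> = (1 + s * a x / z x) * z x" by (simp only: \<tau>(2))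
  also have "\<dots> = z x + s * a x" using x(2) by (simp add: distrib_right)
  finally show "z (flow s x) = z x + s * a x" .
qed

lemma flow_zero:
  assumes x: "x \<in> E"
  shows "flow 0 x = x"
proof (rule separates[OF flow_in[OF x] x])
  fix f assume f: "f \<in> A"
  show "f (flow 0 x) = f x"
    by (rule dense[OF zA z_nz flow_pullback[OF f] f _ x]) (use flow_generic[of _ 1 0] act_one in auto)
qed

text \<open>
  At general points two successive moves by \<open>\<tau>\<close> and \<open>\<sigma>\<close> amount to the move by \<open>\<sigma> \<tau>\<close>, and
  \<open>(\<sigma> \<tau>)\<^sup>d = (z + (s + r) a) / z\<close>, since the first move changes \<open>z\<close> to \<open>z + r a\<close> and fixes \<open>a\<close>.
\<close>

lemma flow_add:
  assumes x: "x \<in> E"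
  shows "flow s (flow r x) = flow (s + r) x"
proof (rule separates[OF flow_in[OF flow_in[OF x]] flow_in[OF x]])
  fix f assume f: "f \<in> A"
  let ?q = "\<lambda>x. (z x * (z x + r * a x)) * (z x + (s + r) * a x)"
  have q: "?q \<in> A" "\<not> vanishes ?q"
    using mult_in[OF generic_nonzero(1) shift_nonzero(1)]
      vanishes_mult[OF generic_nonzero(1) shift_nonzero(1)] generic_nonzero(2) shift_nonzero(2) by auto
  show "f (flow s (flow r x)) = f (flow (s + r) x)"
  proof (rule dense[OF q flow_pullback[OF flow_pullback[OF f]] flow_pullback[OF f] _ x])
    fix x assume x: "x \<in> E" "?q x \<noteq> 0"
    then have nz: "z x \<noteq> 0" "z x + r * a x \<noteq> 0" "z x + (s + r) * a x \<noteq> 0" by auto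
    obtain \<tau> where \<tau>: "\<tau> \<noteq> 0" "\<tau> ^ d = 1 + r * a x / z x" using root_exists[OF nz(1,2)] by blast
    let ?y = "act \<tau> x"
    have y: "?y \<in> E" by (rule act_in[OF \<tau>(1) x(1)])
    have fl: "flow r x = ?y" by (rule flow_generic[OF x(1) nz(1) \<tau>])
    have zy: "z ?y = z x + r * a x" using flow_slice[OF x(1), of r] fl by simp
    have ay: "a ?y = a x" using homogD(2)[OF a_homog \<tau>(1) x(1)] by simp
    have nzy: "z ?y \<noteq> 0" "z ?y + s * a ?y \<noteq> 0" using nz by (auto simp: zy ay algebra_simps)
    obtain \<sigma> where \<sigma>: "\<sigma> \<noteq> 0" "\<sigma> ^ d = 1 + s * a ?y / z ?y" using root_exists[OF nzy] by blast
    have "flow s ?y = act \<sigma> ?y" by (rule flow_generic[OF y nzy(1) \<sigma>])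
    also have "\<dots> = act (\<sigma> * \<tau>) x" by (rule act_act[OF \<sigma>(1) \<tau>(1) x(1)])
    also have "\<dots> = flow (s + r) x"
    proof (rule flow_generic[OF x(1) nz(1), symmetric])
      show "\<sigma> * \<tau> \<noteq> 0" using \<sigma> \<tau> by simp
      have "(\<sigma> * \<tau>) ^ d = (1 + s * a x / (z x + r * a x)) * (1 + r * a x / z x)"
        by (simp add: power_mult_distrib \<sigma>(2) \<tau>(2) zy ay)
      also have "\<dots> = ((z x + r * a x + s * a x) / (z x + r * a x)) * ((z x + r * a x) / z x)"
        using nz by (simp add: add_divide_distrib)
      also have "\<dots> = (z x + r * a x + s * a x) / z x" using nz by simp
      also have "\<dots> = 1 + (s + r) * a x / z x" using nz by (simp add: field_simps)
      finally show "(\<sigma> * \<tau>) ^ d = 1 + (s + r) * a x / z x" .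
    qed
    finally show "f (flow s (flow r x)) = f (flow (s + r) x)" by (simp add: fl)
  qed
qed

lemma flow_moves: "\<exists>x\<in>E. flow 1 x \<noteq> x"
proof -
  obtain x where x: "x \<in> E" "a x \<noteq> 0" using a_nz by (auto simp: vanishes_def)
  then show ?thesis using flow_slice[OF x(1), of 1] by (intro bexI[of _ x]) auto
qed

text \<open>
  A multiple of the derivation \<open>a \<cdot> d/dz\<close> by a function in its kernel has the same properties; this provides a
  family of flows that is as large as the algebra of functions of weight zero.
\<close>

lemma slice_algebra_rescale:
  assumes b: "b \<in> homog 0" "\<not> vanishes b"
  shows "slice_algebra E A act z (\<lambda>x. a x * b x) d n c"
proof
  show "(\<lambda>x. a x * b x) \<in> homog 0" by (rule homog_mult0[OF a_homog b(1)])
  show "\<not> vanishes (\<lambda>x. a x * b x)" using vanishes_mult[OF aA homogD(1)[OF b(1)]] a_nz b(2) by blast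
  show "\<exists>w\<in>A. \<forall>x\<in>E. a x * b x * h x = z x * w x" if h: "h \<in> homog k" "k > 0" for h k
  proof -
    obtain w where w: "w \<in> A" "\<forall>x\<in>E. a x * h x = z x * w x" using lower[OF h] by blast
    have "a x * b x * h x = z x * (b x * w x)" if "x \<in> E" for x
    proof -
      have "a x * b x * h x = b x * (a x * h x)" by (simp add: mult_ac)
      also have "a x * h x = z x * w x" using w(2) that by blast
      finally show ?thesis by (simp only: mult_ac)
    qed
    then show ?thesis by (intro bexI[OF _ mult_in[OF homogD(1)[OF b(1)] w(1)]] ballI)
  qed
qed (fact d_pos z_homog z_nz weight_multiple proportional coord_in generated c_ext c_inj c_closed)+

subsection \<open>Functions of weight zero\<close>

text \<open>
  The product of \<open>f - r\<close> over the finitely many roots \<open>r\<close> of \<open>p\<close> vanishes on the irreducible set \<open>C\<close>, so one of the factors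
  does.
\<close>

lemma constant_if_algebraic:
  assumes f: "f \<in> A" and p: "p \<noteq> 0" "\<And>x. x \<in> C \<Longrightarrow> poly p (f x) = 0" and C: "C \<noteq> {}"
    and prime: "\<And>f g. f \<in> A \<Longrightarrow> g \<in> A \<Longrightarrow> (\<And>x. x \<in> C \<Longrightarrow> f x * g x = 0) \<Longrightarrow>
       (\<forall>x\<in>C. f x = 0) \<or> (\<forall>x\<in>C. g x = 0)"
  shows "\<exists>r. \<forall>x\<in>C. f x = r"
proof -
  have fin: "finite {r. poly p r = 0}" by (rule poly_roots_finite[OF p(1)])
  have "\<exists>r\<in>F. \<forall>x\<in>C. f x - r = 0" if "finite F" "\<And>x. x \<in> C \<Longrightarrow> (\<Prod>r\<in>F. f x - r) = 0" for F
    using that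
  proof (induction F rule: finite_induct)
    case empty
    then show ?case using C by auto
  next
    case (insert r F)
    have "(f x - r) * (\<Prod>r\<in>F. f x - r) = 0" if "x \<in> C" for x
      using insert.prems[OF that] insert.hyps by simp
    then have "(\<forall>x\<in>C. f x - r = 0) \<or> (\<forall>x\<in>C. (\<Prod>r\<in>F. f x - r) = 0)"
      by (rule prime[OF diff[OF f const_in] prod_in[OF diff[OF f const_in]]])
    then show ?case using insert.IH by blast
  qed
  moreover have "(\<Prod>r\<in>{r. poly p r = 0}. f x - r) = 0" if "x \<in> C" for x
    using p(2)[OF that] fin by (intro prod_zero) auto
  ultimately obtain r where "\<forall>x\<in>C. f x - r = 0" using fin by blast
  then show ?thesis by auto
qed

text \<open>
  Among more than \<open>l\<close> of these functions there is a linear relation with constant coefficients. Its component of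
  weight zero, divided by \<open>a\<close>, is a polynomial equation for \<open>b\<close>, which would make \<open>b\<close> constant.
\<close>

lemma translates_not_finite_dimensional:
  fixes y :: "nat \<Rightarrow> 'a \<Rightarrow> 'k"
  assumes b: "b \<in> homog 0" "\<And>r. \<exists>x\<in>E. b x \<noteq> r" and K: "infinite K"
    and span: "\<And>k. k \<in> K \<Longrightarrow> \<exists>\<kappa>. \<forall>x\<in>E. z x + a x * b x ^ k = (\<Sum>i<l. \<kappa> i * y i x)"
  shows False
proof -
  obtain K' where K': "K' \<subseteq> K" "finite K'" "card K' = Suc l" using infinite_arbitrarily_large[OF K] by blast
  have "\<forall>k. \<exists>\<kappa>. k \<in> K' \<longrightarrow> (\<forall>x\<in>E. z x + a x * b x ^ k = (\<Sum>i<l. \<kappa> i * y i x))"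
    using span K'(1) by blast
  from choice[OF this] obtain \<kappa> where \<kappa>: "\<And>k x. k \<in> K' \<Longrightarrow> x \<in> E \<Longrightarrow>
    z x + a x * b x ^ k = (\<Sum>i<l. \<kappa> k i * y i x)" by blast
  let ?C = "range (\<lambda>r (_::'a). r :: 'k)"
  have "\<exists>\<gamma>. (\<forall>k\<in>K'. \<gamma> k \<in> ?C) \<and> (\<exists>k\<in>K'. \<not> vanishes (\<gamma> k)) \<and>
      (\<forall>i\<in>{..<l}. \<forall>x\<in>E. (\<Sum>k\<in>K'. \<gamma> k x * \<kappa> k i) = 0)"
    by (rule linear_dependence[where a = "\<lambda>k i _. \<kappa> k i"]) (use K' const_in in auto)
  then obtain \<gamma>' where \<gamma>': "\<forall>k\<in>K'. \<gamma>' k \<in> ?C" "\<exists>k\<in>K'. \<not> vanishes (\<gamma>' k)"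
      "\<forall>i\<in>{..<l}. \<forall>x\<in>E. (\<Sum>k\<in>K'. \<gamma>' k x * \<kappa> k i) = 0" by (elim exE conjE)
  obtain x0 where x0: "x0 \<in> E" using nonempty by blast
  define \<gamma> where "\<gamma> k = \<gamma>' k x0" for k
  have \<gamma>_const: "\<gamma>' k x = \<gamma> k" if "k \<in> K'" for k x using \<gamma>'(1) that by (auto simp: \<gamma>_def)
  obtain k0 where k0: "k0 \<in> K'" "\<gamma> k0 \<noteq> 0"
    using \<gamma>'(2) \<gamma>_const by (force simp: vanishes_def)
  have rel: "(\<Sum>k\<in>K'. \<gamma> k * \<kappa> k i) = 0" if "i < l" for i
    using \<gamma>'(3) that x0 by (auto simp: \<gamma>_def)
  have sum0: "(\<Sum>k\<in>K'. \<gamma> k * (z x + a x * b x ^ k)) = 0" if x: "x \<in> E" for x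
  proof -
    have "(\<Sum>k\<in>K'. \<gamma> k * (z x + a x * b x ^ k)) = (\<Sum>k\<in>K'. \<Sum>i<l. y i x * (\<gamma> k * \<kappa> k i))"
      by (rule sum.cong) (simp_all add: \<kappa>[OF _ x] sum_distrib_left mult_ac)
    also have "\<dots> = (\<Sum>i<l. \<Sum>k\<in>K'. y i x * (\<gamma> k * \<kappa> k i))" by (rule sum.swap)
    also have "\<dots> = (\<Sum>i<l. y i x * (\<Sum>k\<in>K'. \<gamma> k * \<kappa> k i))" by (simp add: sum_distrib_left)
    also have "\<dots> = 0" using rel by simp
    finally show ?thesis .
  qed
  let ?B = "\<lambda>x. \<Sum>k\<in>K'. \<gamma> k * b x ^ k"
  have Bh: "?B \<in> homog 0" by (intro homog_sum homog_mult0 homog_const homog_power0 b)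
  have aB: "(\<lambda>x. (- 1) * (a x * ?B x)) \<in> homog 0" by (intro homog_mult0 homog_const a_homog Bh)
  have zs: "(\<lambda>x. (\<Sum>k\<in>K'. \<gamma> k) * z x) \<in> homog (int d)" by (rule homog_mult0[OF homog_const z_homog])
  have eq: "(- 1) * (a x * ?B x) = (\<Sum>k\<in>K'. \<gamma> k) * z x" if x: "x \<in> E" for x
  proof -
    have "(\<Sum>k\<in>K'. \<gamma> k * (z x + a x * b x ^ k)) = (\<Sum>k\<in>K'. \<gamma> k) * z x + a x * ?B x"
      by (simp add: distrib_left sum.distrib sum_distrib_right sum_distrib_left mult_ac)
    with sum0[OF x] have "(\<Sum>k\<in>K'. \<gamma> k) * z x + a x * ?B x = 0" by simp
    then show ?thesis by (simp add: add_eq_0_iff)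
  qed
  have "(\<lambda>x. (\<Sum>k\<in>K'. \<gamma> k) * z x) \<in> homog 0" by (rule homog_cong[OF aB eq])
  from homog_unique[OF zs this] have v: "vanishes (\<lambda>x. (\<Sum>k\<in>K'. \<gamma> k) * z x)" using d_pos by simp
  have "vanishes (\<lambda>x. a x * ?B x)"
    unfolding vanishes_def
  proof
    fix x assume x: "x \<in> E"
    have "(- 1) * (a x * ?B x) = 0" unfolding eq[OF x] using v x unfolding vanishes_def by blast
    then show "a x * ?B x = 0" by simp
  qed
  then have "vanishes ?B" using vanishes_mult[OF aA homogD(1)[OF Bh]] a_nz by blast
  moreover define p where "p = (\<Sum>k\<in>K'. monom (\<gamma> k) k)"
  ultimately have "poly p (b x) = 0" if "x \<in> E" for x
    using that by (simp add: p_def poly_sum poly_monom vanishes_def)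
  moreover have "p \<noteq> 0"
  proof
    assume "p = 0"
    then have "0 = coeff p k0" by simp
    also have "\<dots> = (\<Sum>k\<in>K'. if k = k0 then \<gamma> k else 0)" by (simp add: p_def coeff_sum)
    also have "\<dots> = \<gamma> k0" using k0(1) K'(2) by simp
    finally show False using k0(2) by simp
  qed
  ultimately obtain r where "\<forall>x\<in>E. b x = r" using constant_if_algebraic[OF homogD(1)[OF b(1)] _ _ nonempty dom] by blast
  then show False using b(2)[of r] by blast
qed

text \<open>
  A function of weight \<open>j d\<close> is proportional to \<open>z\<^sup>j\<close> over the functions of weight zero, that is, over the constants.
\<close>

lemma polynomial_in_slice:
  assumes const0: "\<And>b. b \<in> homog 0 \<Longrightarrow> \<exists>r. \<forall>x\<in>E. b x = r" and f: "f \<in> A"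
  shows "\<exists>p. \<forall>x\<in>E. f x = poly p (z x)"
proof -
  have hom: "\<exists>p. \<forall>x\<in>E. h x = poly p (z x)" if h: "h \<in> homog k" for h k
  proof (cases "vanishes h")
    case True
    then show ?thesis by (intro exI[of _ 0]) (simp add: vanishes_def)
  next
    case False
    then obtain j :: nat where k: "k = int j * int d" using weight_multiple[OF h] by blast
    show ?thesis
    proof (cases "j = 0")
      case True
      then obtain r where "\<forall>x\<in>E. h x = r" using const0[of h] h k by auto
      then show ?thesis by (intro exI[of _ "[:r:]"]) simp
    next
      case False
      then have "k > 0" using k d_pos by simp
      have zj: "(\<lambda>x. z x ^ j) \<in> homog k" unfolding k by (rule homog_power[OF z_homog])
      have nz: "\<not> vanishes (\<lambda>x. z x ^ j)" using vanishes_power[OF zA] z_nz by blast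
      obtain b g where b: "b \<in> homog 0" "g \<in> homog 0" "\<not> vanishes b" "\<forall>x\<in>E. b x * h x = z x ^ j * g x"
        using proportional[OF zj nz h \<open>k > 0\<close>] by blast
      obtain r q where r: "\<forall>x\<in>E. b x = r" and q: "\<forall>x\<in>E. g x = q" using const0 b(1,2) by blast
      have "r \<noteq> 0" using b(3) r by (auto simp: vanishes_def)
      have "h x = poly (monom (q / r) j) (z x)" if "x \<in> E" for x
      proof -
        have "r * h x = z x ^ j * q" using b(4) r q that by force
        then show ?thesis using \<open>r \<noteq> 0\<close> by (simp add: poly_monom field_simps)
      qed
      then show ?thesis by blast
    qed
  qed
  obtain S where S: "\<And>x. x \<in> E \<Longrightarrow> f x = (\<Sum>k\<in>S. part f k x)"
    by (rule part_support[OF f]) (rule that)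
  have "\<forall>k. \<exists>p. \<forall>x\<in>E. part f k x = poly p (z x)" using hom[OF part_homog[OF f]] by blast
  from choice[OF this] obtain P where P: "\<And>k x. x \<in> E \<Longrightarrow> part f k x = poly (P k) (z x)" by blast
  have "f x = poly (\<Sum>k\<in>S. P k) (z x)" if "x \<in> E" for x
    using S[OF that] P[OF that] by (simp add: poly_sum)
  then show ?thesis by blast
qed

end

section \<open>From the divisor to a slice\<close>

lemma (in positive_divisor) slice_algebra_of_positive:
  assumes "\<And>x. x \<in> E \<Longrightarrow> c x \<in> {..<n} \<rightarrow>\<^sub>E UNIV" "inj_on c E"
    "\<And>w. w \<in> {..<n} \<rightarrow>\<^sub>E UNIV \<Longrightarrow> w \<notin> c ` E \<Longrightarrow> \<exists>p\<in>poly_funs n. p w \<noteq> 0 \<and> (\<forall>x\<in>E. p (c x) = 0)"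
  shows "\<exists>z a d. slice_algebra E A act z a d n c"
proof -
  obtain z a d where s: "d > (0::nat)" "z \<in> homog (int d)" "\<not> vanishes z" "a \<in> homog 0" "\<not> vanishes a"
    "\<And>k h. h \<in> homog k \<Longrightarrow> \<not> vanishes h \<Longrightarrow> int d dvd k"
    "\<And>k h. h \<in> homog k \<Longrightarrow> k > 0 \<Longrightarrow> \<exists>w\<in>A. \<forall>x\<in>E. a x * h x = z x * w x"
    by (rule slice) (rule that)
  have "slice_algebra E A act z a d n c"
  proof
    show "\<exists>j::nat. k = int j * int d" if h: "h \<in> homog k" "\<not> vanishes h" for h k
    proof -
      obtain j where j: "k = int d * j" using s(6)[OF h] by (elim dvdE)
      have "k \<ge> 0" by (rule weight_nonneg[OF h])
      then have "j \<ge> 0" using j s(1) by (simp add: zero_le_mult_iff)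
      then show ?thesis using j by (intro exI[of _ "nat j"]) (simp add: mult.commute)
    qed
    show "\<exists>b\<in>homog 0. \<exists>h\<in>homog 0. \<not> vanishes b \<and> (\<forall>x\<in>E. b x * g x = f x * h x)"
      if f: "f \<in> homog k" "\<not> vanishes f" "g \<in> homog k" "k > 0" for f g k
    proof -
      obtain b h where b: "b \<in> homog 0" "\<not> vanishes b" "h \<in> homog 0" "\<And>x. x \<in> E \<Longrightarrow> b x * g x = f x * h x"
        by (rule same_weight_proportional[OF f]) (rule that)
      then show ?thesis by (intro bexI[OF _ b(1)] bexI[OF _ b(3)]) simp
    qed
  qed (fact s coord_in generated assms)+
  then show ?thesis by blast
qed

text \<open>
  This exchanges positive and negative weights.
\<close>

lemma (in fixed_divisor) inverse_action: "fixed_divisor E A (\<lambda>t. act (inverse t)) D n c"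
proof
  show "\<exists>S F. finite S \<and> (\<forall>k. F k \<in> A) \<and>
       (\<forall>t x. t \<noteq> 0 \<longrightarrow> x \<in> E \<longrightarrow> f (act (inverse t) x) = (\<Sum>k\<in>S. t powi k * F k x))" if f: "f \<in> A" for f
  proof -
    obtain S where S: "finite S" "\<And>t x. t \<noteq> 0 \<Longrightarrow> x \<in> E \<Longrightarrow> f (act t x) = (\<Sum>k\<in>S. t powi k * part f k x)"
      by (rule part_support[OF f]) (rule that)
    show ?thesis
    proof (intro exI[of _ "uminus ` S"] exI[of _ "\<lambda>k. part f (- k)"] conjI allI impI)
      fix t :: 'k and x assume t: "t \<noteq> 0" and x: "x \<in> E"
      have "f (act (inverse t) x) = (\<Sum>k\<in>S. inverse t powi k * part f k x)" using S(2)[of "inverse t" x] t x by simp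
      also have "\<dots> = (\<Sum>k\<in>S. t powi (- k) * part f k x)" by (simp add: power_int_minus power_int_inverse)
      also have "\<dots> = (\<Sum>k\<in>uminus ` S. t powi k * part f (- k) x)" by (subst sum.reindex) auto
      finally show "f (act (inverse t) x) = (\<Sum>k\<in>uminus ` S. t powi k * part f (- k) x)" .
    qed (use S(1) part_in[OF f] in auto)
  qed
  show "act (inverse 1) x = x" if "x \<in> E" for x using act_one[OF that] by simp
  show "act (inverse s) (act (inverse t) x) = act (inverse (s * t)) x" if "s \<noteq> 0" "t \<noteq> 0" "x \<in> E" for s t x
    using act_act[of "inverse s" "inverse t" x] that by simp
  show "act (inverse t) x \<in> E" if "t \<noteq> 0" "x \<in> E" for t x using act_in[of "inverse t" x] that by simp
  show "act (inverse t) x = x" if "t \<noteq> 0" "x \<in> D" for t x using fixed[of "inverse t" x] that by simp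
  show "\<exists>v w N. v \<in> A \<and> w \<in> A \<and> \<not> (\<forall>x\<in>D. v x = 0) \<and> (\<forall>x\<in>E. v x * p x ^ N = u x * w x)"
    if "u \<in> A" "p \<in> A" "\<And>x. x \<in> D \<Longrightarrow> u x = 0"
      "\<not> weighted_algebra.vanishes E u" "\<And>x. x \<in> D \<Longrightarrow> p x = 0" for u p
    using height_one that by blast
qed (fact nonempty const_in add_in mult_in cong dom D_sub D_ne prime normal coord_in generated)+

text \<open>
  If the torus moves a point, some coordinate has a component of nonzero weight; replacing \<open>t\<close> by its inverse if
  necessary, this weight is positive.
\<close>

theorem (in fixed_divisor) slice_algebra_exists:
  assumes chart: "\<And>x. x \<in> E \<Longrightarrow> c x \<in> {..<n} \<rightarrow>\<^sub>E UNIV" "inj_on c E"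
    "\<And>w. w \<in> {..<n} \<rightarrow>\<^sub>E UNIV \<Longrightarrow> w \<notin> c ` E \<Longrightarrow> \<exists>p\<in>poly_funs n. p w \<noteq> 0 \<and> (\<forall>x\<in>E. p (c x) = 0)"
    and nontrivial: "t \<noteq> 0" "x \<in> E" "act t x \<noteq> x"
  shows "\<exists>act' z a d. slice_algebra E A act' z a d n c"
proof -
  have "\<exists>k f. k \<noteq> 0 \<and> f \<in> homog k \<and> \<not> vanishes f"
  proof (rule ccontr)
    assume no: "\<not> ?thesis"
    have inv: "f (act t x) = f x" if f: "f \<in> A" for f
    proof -
      obtain S where S: "finite S" "\<And>t x. t \<noteq> 0 \<Longrightarrow> x \<in> E \<Longrightarrow> f (act t x) = (\<Sum>k\<in>S. t powi k * part f k x)"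
        "\<And>x. x \<in> E \<Longrightarrow> f x = (\<Sum>k\<in>S. part f k x)"
        by (rule part_support[OF f]) (rule that)
      have "part f k x = 0" if "k \<noteq> 0" for k
        using no part_homog[OF f, of k] that nontrivial(2) unfolding vanishes_def by blast
      then have pk: "t powi k * part f k x = part f k x" for k by (cases "k = 0") auto
      show ?thesis
        unfolding S(2)[OF nontrivial(1,2)] S(3)[OF nontrivial(2)] by (rule sum.cong[OF refl]) (rule pk)
    qed
    have "c (act t x) = c x"
      by (rule PiE_ext[OF chart(1) chart(1)]) (use inv[OF coord_in] act_in nontrivial in auto)
    then show False using inj_onD[OF chart(2)] act_in nontrivial by metis
  qed
  then obtain k f where f: "k \<noteq> 0" "f \<in> homog k" "\<not> vanishes f" by blast
  show ?thesis
  proof (cases "k > 0")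
    case True
    interpret positive_divisor E A act D n c f k
      by unfold_locales (use f True in auto)
    show ?thesis using slice_algebra_of_positive[OF chart] by blast
  next
    case False
    interpret inverse: fixed_divisor E A "\<lambda>t. act (inverse t)" D n c by (rule inverse_action)
    have "f \<in> inverse.homog (- k)"
    proof (rule inverse.homogI)
      show "f \<in> A" by (rule homogD(1)[OF f(2)])
      show "f (act (inverse t) x) = t powi (- k) * f x" if "t \<noteq> 0" "x \<in> E" for t x
        using homogD(2)[OF f(2), of "inverse t" x] that by (simp add: power_int_minus power_int_inverse)
    qed
    then interpret inverse: positive_divisor E A "\<lambda>t. act (inverse t)" D n c f "- k"
      by unfold_locales (use f False in \<open>auto simp: vanishes_def inverse.vanishes_def\<close>)
    show ?thesis using inverse.slice_algebra_of_positive[OF chart] by blast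
  qed
qed

section \<open>Affine varieties in coordinates\<close>

locale affine_chart_variety =
  fixes X :: "('a, 'k::{alg_closed_field, field_char_0}) fspace" and n :: nat
    and Z :: "(nat \<Rightarrow> 'k) set" and c :: "'a \<Rightarrow> nat \<Rightarrow> 'k"
  assumes sheaf: "function_sheaf X"
    and algebraic: "algebraic_set n Z"
    and iso: "isomorphism X (zariski_fspace Z (poly_funs n)) c"
    and irreducible: "irreducible_in (Top X) (points X)"
begin

definition regular_functions :: "('a \<Rightarrow> 'k) set" where
  "regular_functions = {h. \<exists>p\<in>poly_funs n. \<forall>x\<in>points X. h x = p (c x)}"

abbreviation "R \<equiv> regular_functions"

lemmas chart = affine_chart(2)[OF iso sheaf algebraic]
lemmas open_nonzero = affine_chart(3)[OF iso sheaf algebraic]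
lemmas fraction_regular = affine_chart(4)[OF iso sheaf algebraic]
lemmas polynomial_regular = affine_chart(5)[OF iso sheaf algebraic]

lemma fraction: "fraction_chart X n c"
  using chart by (simp add: chart_off_def)

lemma inj: "inj_on c (points X)"
  using affine_chart(1)[OF iso sheaf algebraic] by (simp add: bij_betw_def)

lemma ext: "x \<in> points X \<Longrightarrow> c x \<in> {..<n} \<rightarrow>\<^sub>E UNIV"
  using chart by (simp add: chart_off_def)

lemma outside:
  assumes "w \<in> {..<n} \<rightarrow>\<^sub>E UNIV" "w \<notin> c ` points X"
  shows "\<exists>p\<in>poly_funs n. p w \<noteq> 0 \<and> (\<forall>x\<in>points X. p (c x) = 0)"
  by (rule chart_off_separates[OF chart assms one_neq_zero]) blast

lemma regularI: "p \<in> poly_funs n \<Longrightarrow> (\<And>x. x \<in> points X \<Longrightarrow> h x = p (c x)) \<Longrightarrow> h \<in> R"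
  by (auto simp: regular_functions_def)

lemma regularE:
  assumes "h \<in> R"
  obtains p where "p \<in> poly_funs n" "\<And>x. x \<in> points X \<Longrightarrow> h x = p (c x)"
  using assms by (auto simp: regular_functions_def)

lemma regular_in_Reg: "h \<in> R \<Longrightarrow> h \<in> Reg X (points X)"
  by (erule regularE, rule function_sheafD(1)[OF sheaf openin_topspace polynomial_regular]) auto

lemma closed_separate:
  assumes "closedin (Top X) C" "x \<in> points X" "x \<notin> C"
  obtains p where "p \<in> poly_funs n" "p (c x) \<noteq> 0" "\<And>y. y \<in> C \<Longrightarrow> p (c y) = 0"
proof -
  have "openin (Top X) (points X - C)" using assms(1) by (simp add: closedin_def)
  then obtain p where "p \<in> poly_funs n" "p (c x) \<noteq> 0"
    "\<And>y. y \<in> points X \<Longrightarrow> y \<notin> points X - C \<Longrightarrow> p (c y) = 0"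
    by (rule fraction_chart_separates[OF sheaf fraction]) (use assms that in auto)
  then show ?thesis using that closedin_subset[OF assms(1)] by auto
qed

lemma closedin_zeros:
  assumes "S \<subseteq> poly_funs n"
  shows "closedin (Top X) {x \<in> points X. \<forall>p\<in>S. p (c x) = 0}"
proof -
  have "openin (Top X) (\<Union>p\<in>S. {x \<in> points X. p (c x) \<noteq> 0})"
    using assms open_nonzero by (intro openin_Union) auto
  moreover have "points X - {x \<in> points X. \<forall>p\<in>S. p (c x) = 0} = (\<Union>p\<in>S. {x \<in> points X. p (c x) \<noteq> 0})"
    by auto
  ultimately show ?thesis by (simp add: closedin_def)
qed

lemma closedin_zero_set:
  assumes "h \<in> R"
  shows "closedin (Top X) {x \<in> points X. h x = 0}"
proof (rule regularE[OF assms])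
  fix p assume p: "p \<in> poly_funs n" "\<And>x. x \<in> points X \<Longrightarrow> h x = p (c x)"
  have "{x \<in> points X. h x = 0} = {x \<in> points X. \<forall>q\<in>{p}. q (c x) = 0}" using p by auto
  then show ?thesis using closedin_zeros[of "{p}"] p by simp
qed

lemma prime_on_irreducible:
  assumes C: "irreducible_in (Top X) C" and f: "f \<in> R" and g: "g \<in> R"
    and fg: "\<And>x. x \<in> C \<Longrightarrow> f x * g x = 0"
  shows "(\<forall>x\<in>C. f x = 0) \<or> (\<forall>x\<in>C. g x = 0)"
proof -
  have sub: "C \<subseteq> points X" using C by (simp add: irreducible_in_def)
  have "C \<subseteq> {x \<in> points X. f x = 0} \<union> {x \<in> points X. g x = 0}" using sub fg by auto
  then have "C \<subseteq> {x \<in> points X. f x = 0} \<or> C \<subseteq> {x \<in> points X. g x = 0}"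
    using C closedin_zero_set[OF f] closedin_zero_set[OF g] unfolding irreducible_in_def by blast
  then show ?thesis by auto
qed

lemma R_const: "(\<lambda>_. \<kappa>) \<in> R"
  by (rule regularI[OF poly_funs.const[of \<kappa>]]) simp

lemma R_add: "f \<in> R \<Longrightarrow> g \<in> R \<Longrightarrow> (\<lambda>x. f x + g x) \<in> R"
  by (elim regularE, rule regularI[OF poly_funs.add], assumption, assumption) simp

lemma R_mult: "f \<in> R \<Longrightarrow> g \<in> R \<Longrightarrow> (\<lambda>x. f x * g x) \<in> R"
  by (elim regularE, rule regularI[OF poly_funs.mult], assumption, assumption) simp

lemma R_cong: "f \<in> R \<Longrightarrow> (\<And>x. x \<in> points X \<Longrightarrow> f x = g x) \<Longrightarrow> g \<in> R"
  by (elim regularE, rule regularI, assumption) simp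

lemma R_coord: "i < n \<Longrightarrow> (\<lambda>x. c x i) \<in> R"
  by (rule regularI[OF poly_funs.coord]) auto

text \<open>
  The Nullstellensatz on the variety: the hypotheses say that \<open>J\<close> contains the equations of the variety and has no zero on it.
\<close>

lemma unit_ideal_if_no_zeros:
  assumes J: "ideal_of (poly_funs n) J"
    and I: "\<And>p. p \<in> poly_funs n \<Longrightarrow> (\<And>x. x \<in> points X \<Longrightarrow> p (c x) = 0) \<Longrightarrow> p \<in> J"
    and no: "\<And>x. x \<in> points X \<Longrightarrow> \<exists>q\<in>J. q (c x) \<noteq> 0"
  shows "1 \<in> J"
proof -
  have one: "1 \<in> poly_funs n" by (rule subring_setD(1)[OF subring_poly_funs])
  have "\<exists>N. 1 ^ N \<in> J"
  proof (rule nullstellensatz[OF J one])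
    fix y :: "nat \<Rightarrow> 'k" assume y: "y \<in> {..<n} \<rightarrow>\<^sub>E UNIV" and van: "\<And>q. q \<in> J \<Longrightarrow> q y = 0"
    have "y \<in> c ` points X"
    proof (rule ccontr)
      assume "y \<notin> c ` points X"
      from outside[OF y this] obtain p where p: "p \<in> poly_funs n" "p y \<noteq> 0" "\<forall>x\<in>points X. p (c x) = 0" by blast
      then have "p \<in> J" using I by blast
      then show False using van p(2) by blast
    qed
    then obtain x where "x \<in> points X" "y = c x" by blast
    then show "1 y = 0" using no van by blast
  qed
  then show ?thesis by simp
qed

text \<open>
  Otherwise the multiplicative set of all \<open>v p\<^sup>N\<close> with \<open>v\<close> nonzero on \<open>D\<close> is disjoint from the ideal of \<open>u\<close>, and a
  prime ideal \<open>Q\<close> contains that ideal and avoids the set. By the Nullstellensatz the zero set \<open>V\<close> of \<open>Q\<close> is irreducible with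
  ideal \<open>Q\<close>. It contains \<open>D\<close> properly because \<open>p\<close> is not in \<open>Q\<close>, and it is a proper subset of the variety because \<open>u\<close> is in
  \<open>Q\<close>. The chain \<open>D \<subset> V \<subset> X\<close> contradicts the codimension of \<open>D\<close>.
\<close>

lemma prime_divisor_height_one:
  assumes D: "prime_divisor X D" and u: "u \<in> R" "\<And>x. x \<in> D \<Longrightarrow> u x = 0" "x0 \<in> points X" "u x0 \<noteq> 0"
    and p: "p \<in> R" "\<And>x. x \<in> D \<Longrightarrow> p x = 0"
  shows "\<exists>v w N. v \<in> R \<and> w \<in> R \<and> \<not> (\<forall>x\<in>D. v x = 0) \<and> (\<forall>x\<in>points X. v x * p x ^ N = u x * w x)"
proof -
  let ?P = "poly_funs n :: ((nat \<Rightarrow> 'k) \<Rightarrow> 'k) set"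
  note P = subring_setD[OF subring_poly_funs[of n, where 'k = 'k]]
  have irrD: "irreducible_in (Top X) D" and clD: "closedin (Top X) D" and cod: "codimension X D = 1"
    using D by (auto simp: prime_divisor_def)
  have DX: "D \<subseteq> points X" and Dne: "D \<noteq> {}" using irrD by (auto simp: irreducible_in_def)
  obtain U where U: "U \<in> ?P" "\<And>x. x \<in> points X \<Longrightarrow> u x = U (c x)" by (rule regularE[OF u(1)]) (rule that)
  obtain Q0 where Q0: "Q0 \<in> ?P" "\<And>x. x \<in> points X \<Longrightarrow> p x = Q0 (c x)" by (rule regularE[OF p(1)]) (rule that)
  define J where "J = {q \<in> ?P. \<exists>w\<in>?P. \<forall>x\<in>points X. q (c x) = w (c x) * U (c x)}"
  define S where "S = {v * Q0 ^ N |v N. v \<in> ?P \<and> \<not> (\<forall>x\<in>D. v (c x) = 0)}"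
  have "J = {q \<in> ?P. \<exists>w\<in>?P. \<forall>x\<in>points X. q (c x) * 1 = w (c x) * U (c x)}" by (simp add: J_def)
  then have J: "ideal_of ?P J" by (simp only: ideal_of_denominators)
  have onD: "(\<forall>x\<in>D. v (c x) = 0) \<or> (\<forall>x\<in>D. w (c x) = 0)"
    if "v \<in> ?P" "w \<in> ?P" "\<And>x. x \<in> D \<Longrightarrow> v (c x) * w (c x) = 0" for v w
    by (rule prime_on_irreducible[OF irrD, of "\<lambda>x. v (c x)" "\<lambda>x. w (c x)"])
      (use that regularI in auto)
  have "J \<inter> S \<noteq> {}"
  proof
    assume disj: "J \<inter> S = {}"
    obtain Q where Q: "prime_ideal_of ?P Q" "J \<subseteq> Q" "Q \<inter> S = {}"
    proof (rule prime_ideal_containing[OF subring_poly_funs J _ _ _ disj])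
      show "S \<subseteq> ?P" unfolding S_def by (auto intro!: P Q0)
      show "1 \<in> S" unfolding S_def
        using Dne P(1) by (intro CollectI exI[of _ 1] exI[of _ 0]) auto
      fix s s' assume "s \<in> S" "s' \<in> S"
      then obtain v N v' N' where h: "s = v * Q0 ^ N" "v \<in> ?P" "\<not> (\<forall>x\<in>D. v (c x) = 0)"
        "s' = v' * Q0 ^ N'" "v' \<in> ?P" "\<not> (\<forall>x\<in>D. v' (c x) = 0)" unfolding S_def by blast
      have "s * s' = (v * v') * Q0 ^ (N + N')" by (simp only: h power_add mult_ac)
      moreover have "v * v' \<in> ?P" by (intro P h)
      moreover have "\<not> (\<forall>x\<in>D. (v * v') (c x) = 0)" using onD[OF h(2,5)] h(3,6) by auto
      ultimately show "s * s' \<in> S" unfolding S_def by blast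
    qed (rule that)
    have iQ: "ideal_of ?P Q" and Qp: "\<And>x y. x \<in> ?P \<Longrightarrow> y \<in> ?P \<Longrightarrow> x * y \<in> Q \<Longrightarrow> x \<in> Q \<or> y \<in> Q" and Q1: "1 \<notin> Q"
      using Q(1) by (auto simp: prime_ideal_of_def)
    have QP: "Q \<subseteq> ?P" using iQ by (simp add: ideal_of_def)
    define V where "V = {x \<in> points X. \<forall>q\<in>Q. q (c x) = 0}"
    have clV: "closedin (Top X) V" unfolding V_def by (rule closedin_zeros[OF QP])
    have VX: "V \<subseteq> points X" by (auto simp: V_def)
    have witness: "\<exists>x\<in>V. b (c x) \<noteq> 0" if b: "b \<in> ?P" "b \<notin> Q" for b
    proof -
      obtain y where y: "\<forall>q\<in>Q. q y = 0" "b y \<noteq> 0" using nullstellensatz_prime[OF Q(1) b] by blast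
      let ?y = "restrict y {..<n}"
      have e: "q ?y = q y" if "q \<in> ?P" for q by (rule poly_funs_depends[OF that]) simp
      have "?y \<in> c ` points X"
      proof (rule ccontr)
        assume "?y \<notin> c ` points X"
        from outside[OF _ this] obtain q where q: "q \<in> ?P" "q ?y \<noteq> 0" "\<forall>x\<in>points X. q (c x) = 0" by auto
        have "q \<in> J" unfolding J_def using q P(2) by (intro CollectI conjI bexI[of _ 0]) auto
        then show False using Q(2) y(1) e[OF q(1)] q(2) by auto
      qed
      then obtain x where x: "x \<in> points X" "c x = ?y" by auto
      have "q (c x) = 0" if "q \<in> Q" for q using x(2) e[OF subsetD[OF QP that]] y(1) that by simp
      then have "x \<in> V" using x(1) by (simp add: V_def)
      moreover have "b (c x) \<noteq> 0" using x(2) y(2) e[OF b(1)] by simp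
      ultimately show ?thesis by blast
    qed
    have irrV: "irreducible_in (Top X) V"
      unfolding irreducible_in_def
    proof (intro conjI allI impI)
      show "V \<subseteq> points X" by (rule VX)
      show "V \<noteq> {}" using witness[OF P(1) Q1] by auto
      fix C C' assume C: "closedin (Top X) C" "closedin (Top X) C'" "V \<subseteq> C \<union> C'"
      show "V \<subseteq> C \<or> V \<subseteq> C'"
      proof (rule ccontr)
        assume "\<not> ?thesis"
        then obtain x x' where x: "x \<in> V" "x \<notin> C" "x' \<in> V" "x' \<notin> C'" by blast
        obtain f where f: "f \<in> ?P" "f (c x) \<noteq> 0" "\<And>y. y \<in> C \<Longrightarrow> f (c y) = 0"
          by (rule closed_separate[OF C(1) subsetD[OF VX x(1)] x(2)]) (rule that)
        obtain g where g: "g \<in> ?P" "g (c x') \<noteq> 0" "\<And>y. y \<in> C' \<Longrightarrow> g (c y) = 0"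
          by (rule closed_separate[OF C(2) subsetD[OF VX x(3)] x(4)]) (rule that)
        have "f \<notin> Q" "g \<notin> Q" using x(1,3) f(2) g(2) by (auto simp: V_def)
        then have "f * g \<notin> Q" using Qp[OF f(1) g(1)] by blast
        moreover have "f * g \<in> ?P" by (intro P f g)
        ultimately obtain y where "y \<in> V" "(f * g) (c y) \<noteq> 0" using witness by blast
        then show False using C(3) f(3) g(3) by auto
      qed
    qed
    have "D \<subseteq> V"
    proof
      fix x assume x: "x \<in> D"
      have "q (c x) = 0" if q: "q \<in> Q" for q
      proof (rule ccontr)
        assume "q (c x) \<noteq> 0"
        then have "q * Q0 ^ 0 \<in> S" unfolding S_def using q QP x by blast
        then show False using Q(3) q by auto
      qed
      then show "x \<in> V" using x DX by (auto simp: V_def)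
    qed
    moreover have "D \<noteq> V"
    proof -
      have "1 * Q0 ^ 1 \<in> S" unfolding S_def
        using P(1) Dne by (intro CollectI exI[of _ 1] conjI refl) auto
      then have "Q0 \<notin> Q" using Q(3) by auto
      then obtain x where "x \<in> V" "Q0 (c x) \<noteq> 0" using witness[OF Q0(1)] by blast
      then show ?thesis using p(2)[of x] Q0(2)[of x] VX by auto
    qed
    ultimately have DV: "D \<subset> V" by blast
    have "U \<in> J" unfolding J_def using U(1) P(1) by (intro CollectI conjI bexI[of _ 1]) auto
    then have "x0 \<notin> V" using Q(2) u(3,4) U(2) by (auto simp: V_def)
    then have VE: "V \<subset> points X" using VX u(3) by blast
    define Ch where "Ch i = (if i = 0 then D else if i = 1 then V else points X)" for i :: nat
    have "irreducible_closed_chain (Top X) 2 Ch"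
      unfolding irreducible_closed_chain_def
    proof (intro conjI allI impI)
      fix i :: nat assume "i \<le> 2"
      show "closedin (Top X) (Ch i)" "irreducible_in (Top X) (Ch i)"
        using clD clV irrD irrV irreducible by (auto simp: Ch_def)
    next
      fix i :: nat assume "i < 2"
      then have "i = 0 \<or> i = 1" by auto
      then show "Ch i \<subset> Ch (Suc i)" using DV VE by (auto simp: Ch_def)
    qed
    moreover have "Ch 0 = D" by (simp add: Ch_def)
    ultimately have "enat 2 \<le> codimension X D" unfolding codimension_def by (intro Sup_upper) blast
    then show False using cod by (simp add: one_enat_def)
  qed
  then obtain s where "s \<in> J" "s \<in> S" by blast
  then obtain v N w where h: "v \<in> ?P" "\<not> (\<forall>x\<in>D. v (c x) = 0)" "w \<in> ?P"
    "\<forall>x\<in>points X. (v * Q0 ^ N) (c x) = w (c x) * U (c x)" unfolding S_def J_def by blast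
  show ?thesis
  proof (rule exI[of _ "\<lambda>x. v (c x)"], rule exI[of _ "\<lambda>x. w (c x)"], intro exI[of _ N] conjI ballI)
    show "(\<lambda>x. v (c x)) \<in> R" by (rule regularI[OF h(1)]) simp
    show "(\<lambda>x. w (c x)) \<in> R" by (rule regularI[OF h(3)]) simp
    show "v (c x) * p x ^ N = u x * w (c x)" if "x \<in> points X" for x
      using h(4) that U(2)[OF that] Q0(2)[OF that] by (simp add: power_fun_apply)
  qed (use h(2) in auto)
qed

text \<open>
  Normality at \<open>x\<close> extends \<open>f / g\<close> to a regular function near \<open>x\<close>, so some polynomial that is nonzero at \<open>x\<close> clears the
  denominator of \<open>f / g\<close>. As this holds at every \<open>x\<close>, the constant \<open>1\<close> clears it.
\<close>

lemma integral_quotient_regular: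
  assumes normal: "normal_variety X" and f: "f \<in> R" and g: "g \<in> R" "y0 \<in> points X" "g y0 \<noteq> 0"
    and a: "\<And>i. i < m \<Longrightarrow> a i \<in> R"
    and eq: "\<And>x. x \<in> points X \<Longrightarrow> f x ^ m + (\<Sum>i<m. a i x * f x ^ i * g x ^ (m - i)) = 0"
  shows "\<exists>h\<in>R. \<forall>x\<in>points X. f x = g x * h x"
proof -
  let ?P = "poly_funs n :: ((nat \<Rightarrow> 'k) \<Rightarrow> 'k) set"
  note P = subring_setD[OF subring_poly_funs[of n, where 'k = 'k]]
  obtain F where F: "F \<in> ?P" "\<And>x. x \<in> points X \<Longrightarrow> f x = F (c x)" by (rule regularE[OF f]) (rule that)
  obtain G where G: "G \<in> ?P" "\<And>x. x \<in> points X \<Longrightarrow> g x = G (c x)" by (rule regularE[OF g(1)]) (rule that)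
  define J where "J = {q \<in> ?P. \<exists>w\<in>?P. \<forall>x\<in>points X. q (c x) * f x = w (c x) * g x}"
  have J: "ideal_of ?P J" unfolding J_def by (rule ideal_of_denominators)
  let ?U = "{x \<in> points X. G (c x) \<noteq> 0}"
  have "1 \<in> J"
  proof (rule unit_ideal_if_no_zeros[OF J])
    show "q \<in> J" if "q \<in> ?P" "\<And>x. x \<in> points X \<Longrightarrow> q (c x) = 0" for q
      unfolding J_def using that P(2) by (intro CollectI conjI bexI[of _ 0]) auto
    fix x assume x: "x \<in> points X"
    have U: "openin (Top X) ?U" by (rule open_nonzero[OF G(1)])
    have Une: "?U \<noteq> {}" using g G(2) by auto
    let ?h = "\<lambda>x. F (c x) / G (c x)"
    have hU: "?h \<in> Reg X ?U" by (rule fraction_regular[OF F(1) G(1)])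
    have aReg: "\<forall>i<m. a i \<in> Reg X (points X)" using regular_in_Reg a by blast
    have int: "\<forall>y\<in>?U \<inter> points X. ?h y ^ m + (\<Sum>i<m. a i y * ?h y ^ i) = 0"
    proof
      fix y assume y: "y \<in> ?U \<inter> points X"
      then have Gy: "G (c y) \<noteq> 0" and yX: "y \<in> points X" by auto
      have "G (c y) ^ m * (?h y ^ m + (\<Sum>i<m. a i y * ?h y ^ i))
          = F (c y) ^ m + (\<Sum>i<m. a i y * F (c y) ^ i * G (c y) ^ (m - i))"
      proof -
        have lead: "G (c y) ^ m * ?h y ^ m = F (c y) ^ m" using Gy by (simp add: power_divide)
        have each: "G (c y) ^ m * (a i y * ?h y ^ i) = a i y * F (c y) ^ i * G (c y) ^ (m - i)" if "i < m" for i
        proof -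
          have "G (c y) ^ m = G (c y) ^ i * G (c y) ^ (m - i)" using that by (simp add: power_add[symmetric])
          then show ?thesis using Gy by (simp add: power_divide)
        qed
        have "(\<Sum>i<m. G (c y) ^ m * (a i y * ?h y ^ i)) = (\<Sum>i<m. a i y * F (c y) ^ i * G (c y) ^ (m - i))"
          by (rule sum.cong[OF refl], rule each) simp
        then show ?thesis unfolding distrib_left sum_distrib_left lead by simp
      qed
      also have "\<dots> = 0" using eq[OF yX] F(2)[OF yX] G(2)[OF yX] by simp
      finally show "?h y ^ m + (\<Sum>i<m. a i y * ?h y ^ i) = 0" using Gy by simp
    qed
    have "normal_at X x" using normal x by (simp add: normal_variety_def)
    from this[unfolded normal_at_def, THEN spec[of _ ?U], THEN spec[of _ ?h], THEN spec[of _ "points X"],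
        THEN spec[of _ m], THEN spec[of _ a], THEN mp, OF U, THEN mp, OF Une, THEN mp, OF hU, THEN mp,
        OF openin_topspace, THEN mp, OF x, THEN mp, OF aReg, THEN mp, OF int]
    obtain W H where W: "openin (Top X) W" "x \<in> W" "H \<in> Reg X W" "\<forall>y\<in>?U \<inter> W. H y = ?h y" by (elim exE conjE)
    obtain p q where pq: "p \<in> ?P" "q \<in> ?P" "p (c x) \<noteq> 0"
      "\<And>y. y \<in> points X \<Longrightarrow> p (c y) * H y = q (c y)" "\<And>y. y \<in> points X \<Longrightarrow> y \<notin> W \<Longrightarrow> p (c y) = 0"
      by (rule fraction_chartD[OF fraction W(1,3,2)]) (rule that)
    let ?r = "\<lambda>w. p w * F w + (- 1) * (q w * G w)"
    have r: "?r \<in> ?P" by (intro poly_funs.add poly_funs.mult poly_funs.const pq F G)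
    have rR: "(\<lambda>y. ?r (c y)) \<in> R" by (rule regularI[OF r]) (rule refl)
    have "?r (c y) * g y = 0" if y: "y \<in> points X" for y
    proof (cases "y \<in> W \<and> G (c y) \<noteq> 0")
      case True
      then have "H y = ?h y" using W(4) y by auto
      then have "F (c y) = H y * G (c y)" using True by simp
      then have "?r (c y) = 0" using pq(4)[OF y] by (simp add: mult.assoc[symmetric])
      then show ?thesis by simp
    next
      case False
      then have "G (c y) = 0 \<or> (p (c y) = 0 \<and> q (c y) = 0)" using pq(4,5)[OF y] by auto
      then show ?thesis using G(2)[OF y] by auto
    qed
    then have "(\<forall>y\<in>points X. ?r (c y) = 0) \<or> (\<forall>y\<in>points X. g y = 0)"
      by (rule prime_on_irreducible[OF irreducible rR g(1)])
    then have rz: "\<forall>y\<in>points X. ?r (c y) = 0" using g(2,3) by blast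
    have "p (c y) * f y = q (c y) * g y" if y: "y \<in> points X" for y
      using bspec[OF rz y] F(2)[OF y] G(2)[OF y] by simp
    then have "p \<in> J" unfolding J_def by (intro CollectI conjI pq(1) bexI[OF _ pq(2)] ballI)
    then show "\<exists>q\<in>J. q (c x) \<noteq> 0" using pq(3) by blast
  qed
  then obtain w where w: "w \<in> ?P" "\<forall>x\<in>points X. 1 (c x) * f x = w (c x) * g x" unfolding J_def by blast
  have "(\<lambda>x. w (c x)) \<in> R" by (rule regularI[OF w(1)]) (rule refl)
  then show ?thesis using w(2) by (intro bexI[of _ "\<lambda>x. w (c x)"]) (auto simp: mult.commute)
qed

end

section \<open>The torus and the additive group as varieties\<close>

definition line_coord :: "'k \<Rightarrow> nat \<Rightarrow> 'k" where
  "line_coord t = (\<lambda>i\<in>{..<1}. t)"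

lemma line_coord_0 [simp]: "line_coord t 0 = t"
  by (simp add: line_coord_def)

lemma poly_in_poly_funs: "(\<lambda>w. poly p (w 0)) \<in> poly_funs 1"
proof (induction p)
  case 0
  show ?case using poly_funs.const[of 0 1] by simp
next
  case (pCons a p)
  have "(\<lambda>w. a + w 0 * poly p (w 0)) \<in> poly_funs 1"
    by (intro poly_funs.add poly_funs.mult poly_funs.const poly_funs.coord pCons.IH) simp
  then show ?case by simp
qed

lemma poly_funs_line:
  "p \<in> poly_funs 1 \<Longrightarrow> \<exists>P. \<forall>t. p (line_coord t) = poly P t"
proof (induction rule: poly_funs.induct)
  case (const c)
  show ?case by (rule exI[of _ "[:c:]"]) simp
next
  case (coord i)
  then show ?case by (intro exI[of _ "[:0, 1:]"]) simp
next
  case (add p q)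
  then obtain P Q where "\<forall>t. p (line_coord t) = poly P t" "\<forall>t. q (line_coord t) = poly Q t" by blast
  then show ?case by (intro exI[of _ "P + Q"]) simp
next
  case (mult p q)
  then obtain P Q where "\<forall>t. p (line_coord t) = poly P t" "\<forall>t. q (line_coord t) = poly Q t" by blast
  then show ?case by (intro exI[of _ "P * Q"]) simp
qed

lemma sheaf_Gm: "function_sheaf (Gm_variety :: ('k, 'k::field) fspace)"
  and points_Gm: "points (Gm_variety :: ('k, 'k) fspace) = UNIV - {0}"
  unfolding Gm_variety_def
  by (rule function_sheaf_zariski[OF function_algebra_range_poly], rule points_zariski[OF function_algebra_range_poly])

lemma sheaf_Ga: "function_sheaf (Ga_variety :: ('k, 'k::field) fspace)"
  and points_Ga: "points (Ga_variety :: ('k, 'k) fspace) = UNIV"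
  unfolding Ga_variety_def
  by (rule function_sheaf_zariski[OF function_algebra_range_poly], rule points_zariski[OF function_algebra_range_poly])

text \<open>
  The torus is the locus of the affine line where the coordinate does not vanish, so it satisfies no further equation.
\<close>

lemma chart_Gm: "chart_off (Gm_variety :: ('k, 'k::field) fspace) 1 line_coord (\<lambda>w. w 0)"
  unfolding chart_off_def points_Gm
proof (intro conjI ballI impI)
  show "fraction_chart (Gm_variety :: ('k, 'k) fspace) 1 line_coord"
    unfolding fraction_chart_def points_Gm
  proof (intro allI impI)
    fix U and h :: "'k \<Rightarrow> 'k" and y
    assume h: "openin (Top Gm_variety) U" "h \<in> Reg Gm_variety U" "y \<in> U"
    obtain P Q where "P \<in> range poly" "Q \<in> range poly" and PQ: "P y \<noteq> 0"
      "\<And>y. y \<in> UNIV - {0} \<Longrightarrow> P y * h y = Q y" "\<And>y. y \<in> UNIV - {0} \<Longrightarrow> y \<notin> U \<Longrightarrow> P y = 0"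
      by (rule Reg_zariski_clear_denominators[OF function_algebra_range_poly h(2,3)[unfolded Gm_variety_def]])
        (rule that)
    then obtain p q where pq: "P = poly p" "Q = poly q" by blast
    show "\<exists>P\<in>poly_funs 1. \<exists>Q\<in>poly_funs 1. P (line_coord y) \<noteq> 0 \<and>
        (\<forall>x\<in>UNIV - {0}. P (line_coord x) * h x = Q (line_coord x)) \<and> (\<forall>x\<in>UNIV - {0} - U. P (line_coord x) = 0)"
      by (rule bexI[OF _ poly_in_poly_funs[of p]], rule bexI[OF _ poly_in_poly_funs[of q]])
        (use PQ pq in auto)
  qed
  fix w :: "nat \<Rightarrow> 'k" assume w: "w \<in> {..<1} \<rightarrow>\<^sub>E UNIV" "w \<notin> line_coord ` (UNIV - {0})" "w 0 \<noteq> 0"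
  have "w = line_coord (w 0)" using w(1) by (auto simp: fun_eq_iff line_coord_def PiE_def extensional_def)
  then have False using w(2,3) by blast
  then show "\<exists>p\<in>poly_funs 1. p w \<noteq> 0 \<and> (\<forall>y\<in>UNIV - {0}. p (line_coord y) = 0)" ..
qed (auto simp: line_coord_def intro: poly_funs.coord)

context affine_chart_variety
begin

lemma Reg_prod_fspaceD:
  assumes "h \<in> Reg (prod_fspace Y X) W" "p \<in> W"
  obtains U V f g where "openin (Top Y) U" "openin (Top X) V"
    "f \<in> tensor_funs Y X U V" "g \<in> tensor_funs Y X U V"
    "p \<in> nonvanishing (U \<times> V) g" "nonvanishing (U \<times> V) g \<subseteq> W"
    "\<forall>q\<in>nonvanishing (U \<times> V) g. h q = f q / g q"
  using assms(1)[unfolded prod_fspace_def fspace.select_convs mem_Collect_eq, THEN bspec, OF assms(2)]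
  by (elim exE conjE) (rule that)

lemma regular_along_morphism:
  assumes Y: "function_sheaf Y" and mor: "morphism (prod_fspace Y X) X \<Phi>" and f: "f \<in> R"
    and p: "p \<in> points Y \<times> points X"
  shows "\<exists>U V g h. openin (Top Y) U \<and> openin (Top X) V \<and> g \<in> tensor_funs Y X U V \<and>
    h \<in> tensor_funs Y X U V \<and> p \<in> nonvanishing (U \<times> V) h \<and>
    (\<forall>p'\<in>nonvanishing (U \<times> V) h. f (\<Phi> p') = g p' / h p')"
proof -
  let ?W = "{q \<in> points (prod_fspace Y X). \<Phi> q \<in> points X}"
  have "f \<circ> \<Phi> \<in> Reg (prod_fspace Y X) ?W"
    using mor regular_in_Reg[OF f] openin_topspace unfolding morphism_def by blast
  moreover have "p \<in> ?W"
    using mor p points_prod_fspace[OF Y sheaf] by (auto simp: morphism_def continuous_map_def)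
  ultimately obtain U V g h where "openin (Top Y) U" "openin (Top X) V"
               "g \<in> tensor_funs Y X U V" "h \<in> tensor_funs Y X U V"
               "p \<in> nonvanishing (U \<times> V) h" "nonvanishing (U \<times> V) h \<subseteq> ?W"
               "\<forall>q\<in>nonvanishing (U \<times> V) h. (f \<circ> \<Phi>) q = g q / h q"
    by (rule Reg_prod_fspaceD) (rule that)
  then show ?thesis unfolding o_apply by (intro exI conjI)
qed

text \<open>
  A regular function on \<open>Y \<times> X\<close> is, up to a power of \<open>q\<close>, a finite sum of products of a function on \<open>Y\<close> and a function on \<open>X\<close>.
  For \<open>Y\<close> the torus this gives the weight decomposition; for \<open>Y\<close> a piece of the automorphism group it gives
  finite-dimensionality.
\<close>

lemma regular_family_expansion:
  assumes Y: "function_sheaf Y" "chart_off Y m e q"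
    and h: "\<And>p. p \<in> points Y \<times> points X \<Longrightarrow> \<exists>U V g h. openin (Top Y) U \<and> openin (Top X) V \<and>
      g \<in> tensor_funs Y X U V \<and> h \<in> tensor_funs Y X U V \<and> p \<in> nonvanishing (U \<times> V) h \<and>
      (\<forall>p'\<in>nonvanishing (U \<times> V) h. F p' = g p' / h p')"
  obtains N and k :: nat and a b where "\<And>j. j < k \<Longrightarrow> a j \<in> poly_funs m" "\<And>j. j < k \<Longrightarrow> b j \<in> R"
    "\<And>y x. y \<in> points Y \<Longrightarrow> x \<in> points X \<Longrightarrow> q (e y) ^ N * F (y, x) = (\<Sum>j<k. a j (e y) * b j x)"
proof -
  have "\<exists>N k a b. (\<forall>j<(k::nat). a j \<in> poly_funs m \<and> b j \<in> poly_funs n) \<and>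
    (\<forall>y\<in>points Y. \<forall>x\<in>points X. q (e y) ^ N * F (y, x) = (\<Sum>j<k. a j (e y) * b j (c x)))"
    by (rule regular_on_product[OF Y sheaf chart h])
  then obtain N and k :: nat and a b where *: "\<forall>j<k. a j \<in> poly_funs m \<and> b j \<in> poly_funs n"
    "\<forall>y\<in>points Y. \<forall>x\<in>points X. q (e y) ^ N * F (y, x) = (\<Sum>j<k. a j (e y) * b j (c x))"
    by (elim exE conjE)
  show ?thesis
  proof (rule that[of k a "\<lambda>j x. b j (c x)" N])
    show "(\<lambda>x. b j (c x)) \<in> R" if "j < k" for j by (rule regularI[of "b j"]) (use * that in auto)
  qed (use * in auto)
qed

text \<open>
  Over the torus the expansion reads \<open>t\<^sup>N f (t x) = \<Sum>\<^sub>j P\<^sub>j(t) b\<^sub>j(x)\<close> with polynomials \<open>P\<^sub>j\<close>; sorting it by powers of \<open>t\<close> and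
  dividing by \<open>t\<^sup>N\<close> gives the Laurent expansion.
\<close>

lemma torus_weights:
  assumes mor: "morphism (prod_fspace Gm_variety X) X (\<lambda>(t, x). \<phi> t x)" and f: "f \<in> R"
  shows "\<exists>S F. finite S \<and> (\<forall>k. F k \<in> R) \<and>
    (\<forall>t x. t \<noteq> 0 \<longrightarrow> x \<in> points X \<longrightarrow> f (\<phi> t x) = (\<Sum>k\<in>S. t powi k * F k x))"
proof -
  obtain N and k :: nat and a b where a: "\<And>j. j < k \<Longrightarrow> a j \<in> poly_funs 1" and b: "\<And>j. j < k \<Longrightarrow> b j \<in> R"
    and exp: "\<And>t x. t \<in> points Gm_variety \<Longrightarrow> x \<in> points X \<Longrightarrow>
      line_coord t 0 ^ N * f (case (t, x) of (t, x) \<Rightarrow> \<phi> t x) = (\<Sum>j<k. a j (line_coord t) * b j x)"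
    by (rule regular_family_expansion[OF sheaf_Gm chart_Gm regular_along_morphism[OF sheaf_Gm mor f]])
      (assumption, rule that)
  have "\<forall>j. \<exists>P. j < k \<longrightarrow> (\<forall>t. a j (line_coord t) = poly P t)" using poly_funs_line[OF a] by blast
  from choice[OF this] obtain P where P: "\<And>j t. j < k \<Longrightarrow> a j (line_coord t) = poly (P j) t" by blast
  define M where "M = (\<Sum>j<k. degree (P j))"
  have deg: "degree (P j) \<le> M" if "j < k" for j
    unfolding M_def by (rule member_le_sum) (use that in auto)
  have polyM: "poly (P j) t = (\<Sum>i\<le>M. coeff (P j) i * t ^ i)" if "j < k" for j t
    unfolding poly_altdef
    by (rule sum.mono_neutral_left) (use deg[OF that] in \<open>auto simp: coeff_eq_0\<close>)
  define S where "S = (\<lambda>i::nat. int i - int N) ` {..M}"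
  define F where "F l x = (\<Sum>j<k. coeff (P j) (nat (l + int N)) * b j x)" for l x
  have RS: "(\<lambda>x. \<Sum>j\<in>T. \<kappa> j * b j x) \<in> R" if "T \<subseteq> {..<k}" "finite T" for T \<kappa>
    using that(2,1)
  proof (induction T rule: finite_induct)
    case empty
    show ?case using R_const[of 0] by simp
  next
    case (insert j T)
    then have "(\<lambda>x. \<kappa> j * b j x + (\<Sum>j\<in>T. \<kappa> j * b j x)) \<in> R"
      by (intro R_add R_mult R_const b) auto
    then show ?case using insert.hyps by simp
  qed
  show ?thesis
  proof (intro exI[of _ S] exI[of _ F] conjI allI impI)
    show "finite S" by (simp add: S_def)
    show "F l \<in> R" for l using RS[of "{..<k}"] unfolding F_def[abs_def] by simp
    fix t x assume t: "t \<noteq> (0::'k)" and x: "x \<in> points X"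
    have "t ^ N * f (\<phi> t x) = (\<Sum>j<k. poly (P j) t * b j x)"
      using exp[of t x] t x P by (simp add: points_Gm)
    also have "\<dots> = (\<Sum>j<k. \<Sum>i\<le>M. t ^ i * (coeff (P j) i * b j x))"
      by (rule sum.cong) (simp_all add: polyM sum_distrib_right sum_distrib_left mult_ac)
    also have "\<dots> = (\<Sum>i\<le>M. \<Sum>j<k. t ^ i * (coeff (P j) i * b j x))" by (rule sum.swap)
    also have "\<dots> = (\<Sum>i\<le>M. t ^ i * F (int i - int N) x)" by (simp add: F_def sum_distrib_left)
    also have "\<dots> = (\<Sum>i\<le>M. t ^ N * (t powi (int i - int N) * F (int i - int N) x))"
      by (rule sum.cong) (simp_all add: power_int_diff t)
    also have "\<dots> = t ^ N * (\<Sum>l\<in>S. t powi l * F l x)"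
      unfolding S_def by (subst sum.reindex) (auto simp: inj_on_def sum_distrib_left)
    finally show "f (\<phi> t x) = (\<Sum>l\<in>S. t powi l * F l x)" using t by simp
  qed
qed

theorem fixed_divisor_of_torus_action:
  assumes normal: "normal_variety X" and act: "regular_action Gm_group Gm_variety X \<phi>"
    and D: "prime_divisor X D" and fixed: "\<forall>t\<in>carrier Gm_group. \<forall>x\<in>D. \<phi> t x = x"
  shows "fixed_divisor (points X) R \<phi> D n c"
proof -
  interpret group_action "Gm_group :: 'k monoid" "points X" \<phi> using act by (simp add: regular_action_def)
  have car: "t \<in> carrier (Gm_group :: 'k monoid) \<longleftrightarrow> t \<noteq> 0" for t :: 'k by (simp add: Gm_group_def)
  have mor: "morphism (prod_fspace Gm_variety X) X (\<lambda>(t, x). \<phi> t x)"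
    using act by (simp add: regular_action_def)
  have irrD: "irreducible_in (Top X) D" using D by (simp add: prime_divisor_def)
  interpret W: weighted_algebra "points X" R \<phi>
  proof
    show "points X \<noteq> {}" using irreducible by (simp add: irreducible_in_def)
    show "(\<forall>x\<in>points X. f x = 0) \<or> (\<forall>x\<in>points X. g x = 0)"
      if "f \<in> R" "g \<in> R" "\<And>x. x \<in> points X \<Longrightarrow> f x * g x = 0" for f g
      by (rule prime_on_irreducible[OF irreducible that])
    show "\<phi> t x \<in> points X" if "t \<noteq> 0" "x \<in> points X" for t x
      using bij_prop0[of t] that by (auto simp: car Bij_def bij_betw_def)
    show "\<phi> 1 x = x" if "x \<in> points X" for x
      using id_eq_one that by (metis Gm_group_def monoid.select_convs(2) restrict_apply')
    show "\<phi> s (\<phi> t x) = \<phi> (s * t) x" if "s \<noteq> 0" "t \<noteq> 0" "x \<in> points X" for s t x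
      using composition_rule[OF that(3), of s t] that(1,2) by (simp add: Gm_group_def)
    show "\<exists>S F. finite S \<and> (\<forall>k. F k \<in> R) \<and>
       (\<forall>t x. t \<noteq> 0 \<longrightarrow> x \<in> points X \<longrightarrow> f (\<phi> t x) = (\<Sum>k\<in>S. t powi k * F k x))" if "f \<in> R" for f
      by (rule torus_weights[OF mor that])
  qed (fact R_const R_add R_mult R_cong)+
  show ?thesis
  proof
    show "D \<subseteq> points X" "D \<noteq> {}" using irrD by (auto simp: irreducible_in_def)
    show "\<phi> t x = x" if "t \<noteq> 0" "x \<in> D" for t x using fixed that car by blast
    show "(\<forall>x\<in>D. f x = 0) \<or> (\<forall>x\<in>D. g x = 0)"
      if "f \<in> R" "g \<in> R" "\<And>x. x \<in> D \<Longrightarrow> f x * g x = 0" for f g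
      by (rule prime_on_irreducible[OF irrD that])
    show "\<exists>v w N. v \<in> R \<and> w \<in> R \<and> \<not> (\<forall>x\<in>D. v x = 0) \<and> (\<forall>x\<in>points X. v x * p x ^ N = u x * w x)"
      if u: "u \<in> R" "p \<in> R" "\<And>x. x \<in> D \<Longrightarrow> u x = 0" "\<not> W.vanishes u" "\<And>x. x \<in> D \<Longrightarrow> p x = 0" for u p
    proof -
      obtain x0 where "x0 \<in> points X" "u x0 \<noteq> 0" using u(4) by (auto simp: W.vanishes_def)
      from prime_divisor_height_one[OF D u(1,3) this u(2,5)] show ?thesis .
    qed
    show "\<exists>h\<in>R. \<forall>x\<in>points X. f x = g x * h x"
      if f: "f \<in> R" "g \<in> R" "\<not> W.vanishes g" "\<And>i. i < m \<Longrightarrow> a i \<in> R"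
        "\<And>x. x \<in> points X \<Longrightarrow> f x ^ m + (\<Sum>i<m. a i x * f x ^ i * g x ^ (m - i)) = 0" for f g m a
    proof -
      obtain y0 where "y0 \<in> points X" "g y0 \<noteq> 0" using f(3) by (auto simp: W.vanishes_def)
      from integral_quotient_regular[OF normal f(1,2) this f(4,5)] show ?thesis .
    qed
    show "\<exists>p\<in>poly_funs n. \<forall>x\<in>points X. f x = p (c x)" if "f \<in> R" for f
      using that by (auto simp: regular_functions_def)
  qed (fact R_coord)
qed

text \<open>
  An effective action moves some point: otherwise \<open>1\<close> and \<open>2\<close> would act in the same way.
\<close>

lemma slice_exists:
  assumes "normal_variety X" "regular_action Gm_group Gm_variety X \<phi>"
    "faithful_action Gm_group (points X) \<phi>" "prime_divisor X D"
    "\<forall>t\<in>carrier Gm_group. \<forall>x\<in>D. \<phi> t x = x"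
  shows "\<exists>act z a d. slice_algebra (points X) R act z a d n c"
proof -
  interpret fixed_divisor "points X" R \<phi> D n c
    by (rule fixed_divisor_of_torus_action[OF assms(1,2,4,5)])
  interpret F: faithful_action "Gm_group :: 'k monoid" "points X" \<phi> by (rule assms(3))
  have "\<exists>t x. t \<noteq> 0 \<and> x \<in> points X \<and> \<phi> t x \<noteq> x"
  proof (rule ccontr)
    assume no: "\<not> ?thesis"
    have mem: "1 \<in> carrier (Gm_group :: 'k monoid)" "2 \<in> carrier (Gm_group :: 'k monoid)" by (simp_all add: Gm_group_def)
    have "\<phi> 1 = \<phi> 2"
    proof (rule extensionalityI[of _ "points X"])
      show "\<phi> 1 \<in> extensional (points X)" "\<phi> 2 \<in> extensional (points X)"
        using F.bij_prop0 mem by (auto simp: Bij_def)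
      show "\<phi> 1 x = \<phi> 2 x" if "x \<in> points X" for x using no that by (metis one_neq_zero zero_neq_numeral)
    qed
    then have "1 = (2 :: 'k)" using F.faithful mem by (auto dest: inj_onD)
    then show False by simp
  qed
  then obtain t x where "t \<noteq> 0" "x \<in> points X" "\<phi> t x \<noteq> x" by blast
  then show ?thesis by (intro slice_algebra_exists[OF ext inj outside])
qed

section \<open>Morphisms in coordinates\<close>

text \<open>
  The topology and the regular functions of \<open>X\<close> are given by fractions of polynomials in the coordinates, so it is enough to pull
  back polynomials.
\<close>

lemma morphism_on_product:
  assumes Y: "function_sheaf Y" and maps: "\<And>y x. y \<in> points Y \<Longrightarrow> x \<in> points X \<Longrightarrow> \<Phi> (y, x) \<in> points X"
    and tensor: "\<And>p. p \<in> poly_funs n \<Longrightarrow> \<exists>g\<in>tensor_funs Y X (points Y) (points X).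
      \<forall>y\<in>points Y. \<forall>x\<in>points X. p (c (\<Phi> (y, x))) = g (y, x)"
  shows "morphism (prod_fspace Y X) X \<Phi>"
  unfolding morphism_def
proof (intro conjI allI impI)
  note pts = points_prod_fspace[OF Y sheaf]
  let ?YX = "points Y \<times> points X"
  have nv: "\<exists>g\<in>tensor_funs Y X (points Y) (points X). q \<in> nonvanishing ?YX g \<and>
      nonvanishing ?YX g \<subseteq> {q \<in> ?YX. \<Phi> q \<in> U} \<and> (\<forall>q\<in>?YX. P (c (\<Phi> q)) = g q)"
    if P: "P \<in> poly_funs n" "P (c (\<Phi> q)) \<noteq> 0" "\<forall>x\<in>points X. x \<notin> U \<longrightarrow> P (c x) = 0"
      and q: "q \<in> ?YX" for P q U
  proof -
    obtain g where g: "g \<in> tensor_funs Y X (points Y) (points X)"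
      "\<forall>y\<in>points Y. \<forall>x\<in>points X. P (c (\<Phi> (y, x))) = g (y, x)" using tensor[OF P(1)] by blast
    have eq: "\<forall>q\<in>?YX. P (c (\<Phi> q)) = g q" using g(2) by auto
    moreover have "q \<in> nonvanishing ?YX g" using bspec[OF eq q] q P(2) by (simp only: nonvanishing_def mem_Collect_eq simp_thms)
    moreover have "nonvanishing ?YX g \<subseteq> {q \<in> ?YX. \<Phi> q \<in> U}"
    proof
      fix q' assume "q' \<in> nonvanishing ?YX g"
      then have q': "q' \<in> ?YX" "P (c (\<Phi> q')) \<noteq> 0" using eq by (auto simp: nonvanishing_def)
      then have "\<Phi> q' \<in> points X" using maps by auto
      then show "q' \<in> {q \<in> ?YX. \<Phi> q \<in> U}" using P(3) q' by auto
    qed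
    ultimately show ?thesis using g(1) by (intro bexI[OF _ g(1)] conjI)
  qed
  show "continuous_map (Top (prod_fspace Y X)) (Top X) \<Phi>"
    unfolding continuous_map_def pts openin_prod_fspace[OF Y sheaf]
  proof (intro conjI allI impI)
    show "\<Phi> \<in> ?YX \<rightarrow> points X" using maps by auto
    fix U assume U: "openin (Top X) U"
    show "prod_open Y X {q \<in> ?YX. \<Phi> q \<in> U}"
      unfolding prod_open_def
    proof
      fix q assume "q \<in> {q \<in> ?YX. \<Phi> q \<in> U}"
      then have q: "q \<in> ?YX" "\<Phi> q \<in> U" by auto
      obtain P where P: "P \<in> poly_funs n" "P (c (\<Phi> q)) \<noteq> 0" "\<And>x. x \<in> points X \<Longrightarrow> x \<notin> U \<Longrightarrow> P (c x) = 0"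
        by (rule fraction_chart_separates[OF sheaf fraction U q(2)]) (rule that)
      have "\<forall>x\<in>points X. x \<notin> U \<longrightarrow> P (c x) = 0" using P(3) by blast
      from nv[OF P(1,2) this q(1)] obtain g where "g \<in> tensor_funs Y X (points Y) (points X)"
        "q \<in> nonvanishing ?YX g" "nonvanishing ?YX g \<subseteq> {q \<in> ?YX. \<Phi> q \<in> U}" by (elim bexE conjE)
      then show "\<exists>U' V g. openin (Top Y) U' \<and> openin (Top X) V \<and> g \<in> tensor_funs Y X U' V \<and>
          q \<in> nonvanishing (U' \<times> V) g \<and> nonvanishing (U' \<times> V) g \<subseteq> {q \<in> ?YX. \<Phi> q \<in> U}"
        by (intro exI conjI) (assumption | rule openin_topspace)+
    qed
  qed
  fix V f assume V: "openin (Top X) V" and f: "f \<in> Reg X V"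
  have "\<exists>U' V' fa g. openin (Top Y) U' \<and> openin (Top X) V' \<and>
      fa \<in> tensor_funs Y X U' V' \<and> g \<in> tensor_funs Y X U' V' \<and> q \<in> nonvanishing (U' \<times> V') g \<and>
      nonvanishing (U' \<times> V') g \<subseteq> {q \<in> ?YX. \<Phi> q \<in> V} \<and> (\<forall>q\<in>nonvanishing (U' \<times> V') g. (f \<circ> \<Phi>) q = fa q / g q)"
    if q: "q \<in> ?YX" "\<Phi> q \<in> V" for q
  proof -
    obtain P Q where PQ: "P \<in> poly_funs n" "Q \<in> poly_funs n" "P (c (\<Phi> q)) \<noteq> 0"
      "\<And>x. x \<in> points X \<Longrightarrow> P (c x) * f x = Q (c x)" "\<And>x. x \<in> points X \<Longrightarrow> x \<notin> V \<Longrightarrow> P (c x) = 0"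
      by (rule fraction_chartD[OF fraction V f q(2)]) (rule that)
    have "\<forall>x\<in>points X. x \<notin> V \<longrightarrow> P (c x) = 0" using PQ(5) by blast
    from nv[OF PQ(1,3) this q(1)] obtain g where g: "g \<in> tensor_funs Y X (points Y) (points X)"
      "q \<in> nonvanishing ?YX g" "nonvanishing ?YX g \<subseteq> {q \<in> ?YX. \<Phi> q \<in> V}" "\<forall>q\<in>?YX. P (c (\<Phi> q)) = g q"
      by (elim bexE conjE)
    obtain h where h: "h \<in> tensor_funs Y X (points Y) (points X)"
      "\<forall>y\<in>points Y. \<forall>x\<in>points X. Q (c (\<Phi> (y, x))) = h (y, x)" using tensor[OF PQ(2)] by blast
    have fr: "\<forall>q\<in>nonvanishing ?YX g. (f \<circ> \<Phi>) q = h q / g q"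
    proof
      fix q assume "q \<in> nonvanishing ?YX g"
      then have q: "q \<in> ?YX" "g q \<noteq> 0" by (auto simp: nonvanishing_def)
      then have "\<Phi> q \<in> points X" "Q (c (\<Phi> q)) = h q" "P (c (\<Phi> q)) = g q" using maps h(2) g(4) by auto
      then show "(f \<circ> \<Phi>) q = h q / g q" using PQ(4)[of "\<Phi> q"] q(2) by (simp add: field_simps)
    qed
    show ?thesis by (intro exI conjI) (fact openin_topspace openin_topspace h(1) g(1,2,3) fr)+
  qed
  then show "f \<circ> \<Phi> \<in> Reg (prod_fspace Y X) {x \<in> points (prod_fspace Y X). \<Phi> x \<in> V}"
    unfolding pts by (simp add: prod_fspace_def)
qed

lemma endomorphism_in_coordinates:
  assumes maps: "\<And>x. x \<in> points X \<Longrightarrow> \<theta> x \<in> points X"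
    and pull: "\<And>p. p \<in> poly_funs n \<Longrightarrow> (\<lambda>x. p (c (\<theta> x))) \<in> R"
  shows "morphism X X \<theta>"
  unfolding morphism_def
proof (intro conjI allI impI)
  have pre_open: "openin (Top X) {x \<in> points X. P (c (\<theta> x)) \<noteq> 0}" if "P \<in> poly_funs n" for P
  proof (rule regularE[OF pull[OF that]])
    fix q assume q: "q \<in> poly_funs n" "\<And>x. x \<in> points X \<Longrightarrow> P (c (\<theta> x)) = q (c x)"
    have "{x \<in> points X. P (c (\<theta> x)) \<noteq> 0} = {x \<in> points X. q (c x) \<noteq> 0}" using q(2) by auto
    then show ?thesis using open_nonzero[OF q(1)] by simp
  qed
  have open_pre: "openin (Top X) {x \<in> points X. \<theta> x \<in> U}" if U: "openin (Top X) U" for U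
  proof (subst openin_subopen, intro ballI)
    fix x assume "x \<in> {x \<in> points X. \<theta> x \<in> U}"
    then have x: "x \<in> points X" "\<theta> x \<in> U" by auto
    obtain P where P: "P \<in> poly_funs n" "P (c (\<theta> x)) \<noteq> 0" "\<And>y. y \<in> points X \<Longrightarrow> y \<notin> U \<Longrightarrow> P (c y) = 0"
      by (rule fraction_chart_separates[OF sheaf fraction U x(2)]) (rule that)
    have "{y \<in> points X. P (c (\<theta> y)) \<noteq> 0} \<subseteq> {x \<in> points X. \<theta> x \<in> U}" using P(3) maps by blast
    then show "\<exists>T. openin (Top X) T \<and> x \<in> T \<and> T \<subseteq> {x \<in> points X. \<theta> x \<in> U}"
      using pre_open[OF P(1)] P(2) x(1) by blast
  qed
  then show "continuous_map (Top X) (Top X) \<theta>" using maps by (auto simp: continuous_map_def)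
  fix V f assume V: "openin (Top X) V" and f: "f \<in> Reg X V"
  let ?W = "{x \<in> points X. \<theta> x \<in> V}"
  show "f \<circ> \<theta> \<in> Reg X ?W"
  proof (rule function_sheafD(4)[OF sheaf open_pre[OF V]])
    fix x assume "x \<in> ?W"
    then have x: "x \<in> points X" "\<theta> x \<in> V" by auto
    obtain P Q where PQ: "P \<in> poly_funs n" "Q \<in> poly_funs n" "P (c (\<theta> x)) \<noteq> 0"
      "\<And>x. x \<in> points X \<Longrightarrow> P (c x) * f x = Q (c x)" "\<And>x. x \<in> points X \<Longrightarrow> x \<notin> V \<Longrightarrow> P (c x) = 0"
      by (rule fraction_chartD[OF fraction V f x(2)]) (rule that)
    obtain p where p: "p \<in> poly_funs n" "\<And>x. x \<in> points X \<Longrightarrow> P (c (\<theta> x)) = p (c x)"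
      by (rule regularE[OF pull[OF PQ(1)]]) (rule that)
    obtain q where q: "q \<in> poly_funs n" "\<And>x. x \<in> points X \<Longrightarrow> Q (c (\<theta> x)) = q (c x)"
      by (rule regularE[OF pull[OF PQ(2)]]) (rule that)
    let ?T = "{x \<in> points X. p (c x) \<noteq> 0}"
    have T: "openin (Top X) ?T" by (rule open_nonzero[OF p(1)])
    have "f \<circ> \<theta> \<in> Reg X ?T"
    proof (rule function_sheafD(1)[OF sheaf T fraction_regular[OF q(1) p(1)]])
      fix y assume "y \<in> ?T"
      then have y: "y \<in> points X" "p (c y) \<noteq> 0" by auto
      then show "q (c y) / p (c y) = (f \<circ> \<theta>) y"
        using PQ(4)[OF maps[OF y(1)]] p(2)[OF y(1)] q(2)[OF y(1)] by (simp add: field_simps)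
    qed
    moreover have "x \<in> ?T" using x(1) PQ(3) p(2) by auto
    moreover have "?T \<subseteq> ?W"
    proof
      fix y assume "y \<in> ?T"
      then have y: "y \<in> points X" "P (c (\<theta> y)) \<noteq> 0" using p(2) by auto
      then show "y \<in> ?W" using PQ(5)[OF maps[OF y(1)]] by auto
    qed
    ultimately show "\<exists>T. openin (Top X) T \<and> x \<in> T \<and> T \<subseteq> ?W \<and> f \<circ> \<theta> \<in> Reg X T" using T by blast
  qed
qed

end

section \<open>Non-rigidity\<close>

locale affine_slice = affine_chart_variety X n Z c + slice_algebra "points X" "affine_chart_variety.regular_functions X n c" act z a d n c
  for X :: "('a, 'k::{alg_closed_field, field_char_0}) fspace" and n Z c act z a d
begin

lemma tensor_of_expansion:
  fixes e :: "nat \<Rightarrow> 'a \<Rightarrow> 'k"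
  assumes "\<And>j. j \<le> m \<Longrightarrow> e j \<in> R"
  shows "(\<lambda>(s, x). \<Sum>j<Suc m. s ^ j * e j x) \<in> tensor_funs Ga_variety X (points Ga_variety) (points X)"
  unfolding tensor_funs_def
proof (intro CollectI, rule exI[of _ "Suc m"], rule exI[of _ "\<lambda>j s. s ^ j"], rule exI[of _ e], intro conjI allI impI)
  fix j assume "j < Suc m"
  then show "e j \<in> Reg X (points X)" using assms regular_in_Reg by simp
  show "(\<lambda>s::'k. s ^ j) \<in> Reg Ga_variety (points Ga_variety)"
    unfolding points_Ga unfolding Ga_variety_def
  proof (rule Reg_zariski_fraction[of "\<lambda>s. s ^ j" _ "\<lambda>_. 1"])
    show "(\<lambda>s::'k. s ^ j) \<in> range poly" by (rule range_eqI[of _ _ "monom 1 j"]) (simp add: fun_eq_iff poly_monom)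
    show "(\<lambda>_::'k. 1 :: 'k) \<in> range poly" by (rule range_eqI[of _ _ 1]) auto
    have "openin (Top (zariski_fspace UNIV (range (poly :: 'k poly \<Rightarrow> _)))) (points (zariski_fspace UNIV (range poly)))"
      by (rule openin_topspace)
    then show "zariski_open UNIV (range (poly :: 'k poly \<Rightarrow> _)) UNIV"
      by (simp only: openin_zariski[OF function_algebra_range_poly] points_zariski[OF function_algebra_range_poly])
  qed simp
qed simp

lemma flow_bij: "bij_betw (flow s) (points X) (points X)"
  by (rule bij_betw_byWitness[where f' = "flow (- s)"]) (auto simp: flow_add flow_zero flow_in)

lemma flow_Bij: "restrict (flow s) (points X) \<in> Bij (points X)"
  using flow_bij bij_betw_cong[of "points X" "restrict (flow s) (points X)" "flow s"] by (simp add: Bij_def)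

text \<open>
  Restricting the flow to the point set makes its members extensional, as elements of \<open>Bij\<close> have to be.
\<close>

theorem not_rigid: "\<not> rigid X"
proof -
  let ?\<psi> = "\<lambda>s. restrict (flow s) (points X)"
  have comp: "compose (points X) (?\<psi> s) (?\<psi> t) = ?\<psi> (s + t)" for s t
    by (auto simp: compose_def fun_eq_iff flow_in flow_add)
  have "group (Ga_group :: 'k monoid)"
  proof (rule groupI)
    show "\<exists>y\<in>carrier Ga_group. y \<otimes>\<^bsub>Ga_group\<^esub> x = \<one>\<^bsub>Ga_group\<^esub>" for x :: 'k
      by (rule bexI[of _ "- x"]) (simp_all add: Ga_group_def)
  qed (simp_all add: Ga_group_def add.assoc)
  moreover have "?\<psi> \<in> hom Ga_group (BijGroup (points X))"
    by (rule homI) (simp_all add: Ga_group_def BijGroup_def flow_Bij comp)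
  ultimately have "group_action Ga_group (points X) ?\<psi>"
    using group_BijGroup unfolding group_action_def group_hom_def group_hom_axioms_def by blast
  moreover have "morphism (prod_fspace Ga_variety X) X (\<lambda>(s, x). ?\<psi> s x)"
  proof (rule morphism_on_product[OF sheaf_Ga])
    show "(case (s, x) of (s, x) \<Rightarrow> ?\<psi> s x) \<in> points X" if "x \<in> points X" for s x
      using flow_in that by simp
    fix p :: "(nat \<Rightarrow> 'k) \<Rightarrow> 'k" assume p: "p \<in> poly_funs n"
    have pR: "(\<lambda>x. p (c x)) \<in> R" by (rule regularI[OF p]) (rule refl)
    obtain m e where e: "\<And>j. e j \<in> R" "\<And>s x. x \<in> points X \<Longrightarrow> p (c (flow s x)) = (\<Sum>j\<le>(m::nat). s ^ j * e j x)"
      by (rule flow_expansion[OF pR]) (rule that)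
    show "\<exists>g\<in>tensor_funs Ga_variety X (points Ga_variety) (points X).
        \<forall>s\<in>points Ga_variety. \<forall>x\<in>points X. p (c (case (s, x) of (s, x) \<Rightarrow> ?\<psi> s x)) = g (s, x)"
      by (rule bexI[OF _ tensor_of_expansion[of m e, OF e(1)]]) (simp add: e(2) lessThan_Suc_atMost del: sum.lessThan_Suc)
  qed
  ultimately have "regular_action Ga_group Ga_variety X ?\<psi>" by (simp add: regular_action_def)
  moreover obtain x where "x \<in> points X" "?\<psi> 1 x \<noteq> x" using flow_moves by auto
  ultimately show ?thesis unfolding rigid_def by blast
qed

lemma flow_automorphism: "restrict (flow s) (points X) \<in> carrier (Aut_group X)"
proof -
  let ?\<theta> = "restrict (flow s) (points X)"
  have mor: "morphism X X \<theta>" if "\<And>x. x \<in> points X \<Longrightarrow> \<theta> x = flow r x" for \<theta> r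
  proof (rule endomorphism_in_coordinates)
    show "\<theta> x \<in> points X" if "x \<in> points X" for x using that \<open>\<And>x. x \<in> points X \<Longrightarrow> \<theta> x = flow r x\<close> flow_in by simp
    fix p :: "(nat \<Rightarrow> 'k) \<Rightarrow> 'k" assume p: "p \<in> poly_funs n"
    have "(\<lambda>x. p (c x)) \<in> R" by (rule regularI[OF p]) (rule refl)
    from flow_pullback[OF this] show "(\<lambda>x. p (c (\<theta> x))) \<in> R"
      by (rule R_cong) (simp add: \<open>\<And>x. x \<in> points X \<Longrightarrow> \<theta> x = flow r x\<close>)
  qed
  have bij: "bij_betw ?\<theta> (points X) (points X)" using flow_Bij by (simp add: Bij_def)
  have "inv_into (points X) ?\<theta> x = flow (- s) x" if "x \<in> points X" for x
    by (rule inv_into_f_eq[OF bij_betw_imp_inj_on[OF bij]]) (simp_all add: flow_in flow_add flow_zero that)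
  then have "isomorphism X X ?\<theta>" unfolding isomorphism_def using bij mor by simp
  then show ?thesis using flow_Bij by (simp add: Aut_group_def)
qed

end

section \<open>The automorphism group\<close>

lemma tensor_funs_open_subspace:
  assumes V: "function_sheaf V" and U: "openin (Top V) U" and U': "openin (Top V) U'"
    and t: "t \<in> tensor_funs V X U' W"
  shows "t \<in> tensor_funs (open_subspace V U) X (U' \<inter> U) W"
proof -
  obtain m :: nat and a b where t': "t = (\<lambda>(x, y). \<Sum>i<m. a i x * b i y)"
    "\<forall>i<m. a i \<in> Reg V U' \<and> b i \<in> Reg X W" using t unfolding tensor_funs_def by blast
  have "\<forall>i<m. a i \<in> Reg (open_subspace V U) (U' \<inter> U) \<and> b i \<in> Reg X W"
    using t'(2) function_sheaf_restrict(1)[OF V U' U] by (simp add: open_subspace_def)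
  then show ?thesis unfolding tensor_funs_def t'(1) by blast
qed

context affine_slice
begin

text \<open>
  The function \<open>(\<theta>, x) \<mapsto> z (\<theta> x)\<close> is regular on \<open>U \<times> X\<close>, so it is a finite sum of products of functions of \<open>\<theta>\<close> and
  functions of \<open>x\<close>. The latter span a space that contains \<open>z \<circ> \<theta>\<close> for all \<open>\<theta>\<close> in \<open>U\<close>.
\<close>

lemma finite_dimensional_on_affine_piece:
  assumes V: "function_sheaf V" and mor: "morphism (prod_fspace V X) X (\<lambda>(\<theta>, x). \<theta> x)"
    and U: "openin (Top V) U" "affine_fspace (open_subspace V U)"
  shows "\<exists>(k::nat) y. \<forall>\<theta>\<in>U. \<exists>\<kappa>. \<forall>x\<in>points X. z (\<theta> x) = (\<Sum>i<k. \<kappa> i * y i x)"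
proof -
  let ?Y = "open_subspace V U"
  have UV: "U \<subseteq> points V" using U(1) by (rule openin_subset)
  have pts: "points ?Y = U" using UV by (auto simp: open_subspace_def)
  obtain m Z' e where Y: "function_sheaf ?Y" "algebraic_set m Z'" "isomorphism ?Y (zariski_fspace Z' (poly_funs m)) e"
    using U(2) unfolding affine_fspace_def by blast
  have chY: "chart_off ?Y m e (\<lambda>_. 1)" by (rule affine_chart(2)[OF Y(3,1,2)])
  have loc: "\<exists>U' W g h. openin (Top ?Y) U' \<and> openin (Top X) W \<and> g \<in> tensor_funs ?Y X U' W \<and>
      h \<in> tensor_funs ?Y X U' W \<and> p \<in> nonvanishing (U' \<times> W) h \<and>
      (\<forall>p'\<in>nonvanishing (U' \<times> W) h. z (case p' of (\<theta>, x) \<Rightarrow> \<theta> x) = g p' / h p')"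
    if p: "p \<in> points ?Y \<times> points X" for p
  proof -
    have "p \<in> points V \<times> points X" using p pts UV by auto
    from regular_along_morphism[OF V mor zA this] obtain U' W g h where
      1: "openin (Top V) U'" "openin (Top X) W" "g \<in> tensor_funs V X U' W" "h \<in> tensor_funs V X U' W"
        "p \<in> nonvanishing (U' \<times> W) h"
        "\<forall>p'\<in>nonvanishing (U' \<times> W) h. z (case p' of (\<theta>, x) \<Rightarrow> \<theta> x) = g p' / h p'" by (elim exE conjE)
    have "openin (Top ?Y) (U' \<inter> U)" using 1(1) by (auto simp: open_subspace_def openin_subtopology)
    moreover have "p \<in> nonvanishing ((U' \<inter> U) \<times> W) h" using 1(5) p pts by (auto simp: nonvanishing_def)
    moreover have "\<forall>p'\<in>nonvanishing ((U' \<inter> U) \<times> W) h. z (case p' of (\<theta>, x) \<Rightarrow> \<theta> x) = g p' / h p'"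
    proof
      fix p' assume "p' \<in> nonvanishing ((U' \<inter> U) \<times> W) h"
      then have "p' \<in> nonvanishing (U' \<times> W) h" by (auto simp: nonvanishing_def)
      then show "z (case p' of (\<theta>, x) \<Rightarrow> \<theta> x) = g p' / h p'" using 1(6) by blast
    qed
    ultimately show ?thesis
      using 1(2) tensor_funs_open_subspace[OF V U(1) 1(1) 1(3)] tensor_funs_open_subspace[OF V U(1) 1(1) 1(4)]
      by (intro exI conjI)
  qed
  obtain N and k :: nat and \<alpha> y where "\<And>j. j < k \<Longrightarrow> \<alpha> j \<in> poly_funs m" "\<And>j. j < k \<Longrightarrow> y j \<in> R"
    and exp: "\<And>\<theta> x. \<theta> \<in> points ?Y \<Longrightarrow> x \<in> points X \<Longrightarrow>
       1 ^ N * z (case (\<theta>, x) of (\<theta>, x) \<Rightarrow> \<theta> x) = (\<Sum>j<k. \<alpha> j (e \<theta>) * y j x)"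
    by (rule regular_family_expansion[OF Y(1) chY loc]) (assumption, rule that)
  show ?thesis
  proof (rule exI[of _ k], rule exI[of _ y], intro ballI)
    fix \<theta> assume "\<theta> \<in> U"
    then show "\<exists>\<kappa>. \<forall>x\<in>points X. z (\<theta> x) = (\<Sum>i<k. \<kappa> i * y i x)"
      using exp[of \<theta>] pts by (intro exI[of _ "\<lambda>i. \<alpha> i (e \<theta>)"]) simp
  qed
qed

text \<open>
  The time-one map of the flow that belongs to \<open>a b\<close>.
\<close>

lemma replica_automorphism:
  assumes b: "b \<in> homog 0" "\<not> vanishes b"
  obtains \<theta> where "\<theta> \<in> carrier (Aut_group X)" "\<And>x. x \<in> points X \<Longrightarrow> z (\<theta> x) = z x + a x * b x"
proof -
  interpret rep: slice_algebra "points X" R act z "\<lambda>x. a x * b x" d n c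
    by (rule slice_algebra_rescale[OF b])
  interpret rep: affine_slice X n Z c act z "\<lambda>x. a x * b x" d ..
  show ?thesis
    by (rule that[OF rep.flow_automorphism[of 1]]) (simp add: rep.flow_slice)
qed

text \<open>
  If \<open>b\<close> is not constant, there are infinitely many indices \<open>k\<close> but only finitely many affine pieces of the group, so one piece
  contains the replicas that belong to \<open>b\<^sup>k\<close> for infinitely many \<open>k\<close>.
\<close>

lemma weight_zero_constant:
  assumes Aut: "Aut_is_algebraic_group X" and b: "b \<in> homog 0"
  shows "\<exists>r. \<forall>x\<in>points X. b x = r"
proof (rule ccontr)
  assume "\<not> ?thesis"
  then have nc: "\<And>r. \<exists>x\<in>points X. b x \<noteq> r" by blast
  have nb: "\<not> vanishes b" using nc[of 0] by (auto simp: vanishes_def)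
  obtain V where V: "algebraic_variety V" "points V = carrier (Aut_group X)"
    and mor: "morphism (prod_fspace V X) X (\<lambda>(\<theta>, x). \<theta> x)"
    using Aut unfolding Aut_is_algebraic_group_def algebraic_group_def by (elim exE conjE) (rule that)
  have shV: "function_sheaf V" using V(1) by (simp add: algebraic_variety_def)
  obtain \<U> where \<U>: "finite \<U>" "\<Union>\<U> = points V"
    "\<forall>U\<in>\<U>. openin (Top V) U \<and> affine_fspace (open_subspace V U)"
    using V(1) unfolding algebraic_variety_def by (elim exE conjE) (rule that)
  have "\<exists>\<theta>. \<theta> \<in> points V \<and> (\<forall>x\<in>points X. z (\<theta> x) = z x + a x * b x ^ k)" for k
  proof -
    have "(\<lambda>x. b x ^ k) \<in> homog 0" "\<not> vanishes (\<lambda>x. b x ^ k)"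
      using homog_power0[OF b] vanishes_power[OF homogD(1)[OF b]] nb by blast+
    then obtain \<theta> where "\<theta> \<in> carrier (Aut_group X)"
      "\<And>x. x \<in> points X \<Longrightarrow> z (\<theta> x) = z x + a x * b x ^ k"
      by (rule replica_automorphism) (rule that)
    then show ?thesis unfolding V(2) by blast
  qed
  then have "\<forall>k. \<exists>\<theta>. \<theta> \<in> points V \<and> (\<forall>x\<in>points X. z (\<theta> x) = z x + a x * b x ^ k)" by blast
  from choice[OF this] obtain \<theta> where \<theta>: "\<And>k. \<theta> k \<in> points V"
    "\<And>k x. x \<in> points X \<Longrightarrow> z (\<theta> k x) = z x + a x * b x ^ k" by blast
  have "(\<Union>U\<in>\<U>. {k. \<theta> k \<in> U}) = (UNIV :: nat set)" using \<theta>(1) \<U>(2) by auto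
  then have "infinite (\<Union>U\<in>\<U>. {k. \<theta> k \<in> U})" using infinite_UNIV_nat by simp
  then obtain U where U: "U \<in> \<U>" "infinite {k. \<theta> k \<in> U}" using \<U>(1) by auto
  obtain k :: nat and y where y: "\<forall>\<theta>\<in>U. \<exists>\<kappa>. \<forall>x\<in>points X. z (\<theta> x) = (\<Sum>i<k. \<kappa> i * y i x)"
    using finite_dimensional_on_affine_piece[OF shV mor conjunct1[OF bspec[OF \<U>(3) U(1)]] conjunct2[OF bspec[OF \<U>(3) U(1)]]]
    by (elim exE)
  show False
  proof (rule translates_not_finite_dimensional[OF b nc U(2)])
    fix j assume "j \<in> {k. \<theta> k \<in> U}"
    then obtain \<kappa> where "\<forall>x\<in>points X. z (\<theta> j x) = (\<Sum>i<k. \<kappa> i * y i x)" using y by blast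
    then show "\<exists>\<kappa>. \<forall>x\<in>points X. z x + a x * b x ^ j = (\<Sum>i<k. \<kappa> i * y i x)" using \<theta>(2) by auto
  qed
qed

text \<open>
  All regular functions are polynomials in \<open>z\<close>. On a proper irreducible closed subset some nonzero polynomial in \<open>z\<close> vanishes, so \<open>z\<close> and
  with it every regular function is constant there, and the subset is a point.
\<close>

lemma dimension_le_1:
  assumes const0: "\<And>b. b \<in> homog 0 \<Longrightarrow> \<exists>r. \<forall>x\<in>points X. b x = r"
  shows "\<not> irreducible_closed_chain (Top X) m C \<or> m \<le> 1"
proof (rule ccontr)
  assume "\<not> ?thesis"
  then have ch: "irreducible_closed_chain (Top X) m C" and m: "m \<ge> 2" by auto
  have cl: "closedin (Top X) (C 1)" and irr: "irreducible_in (Top X) (C 1)"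
    and sub: "C 0 \<subset> C 1" "C 1 \<subset> C 2" "C 0 \<noteq> {}" "C 2 \<subseteq> points X"
  proof -
    show "closedin (Top X) (C 1)" "irreducible_in (Top X) (C 1)"
      using ch m by (auto simp: irreducible_closed_chain_def)
    have "C 0 \<subset> C (Suc 0)" "C 1 \<subset> C (Suc 1)" using ch m unfolding irreducible_closed_chain_def by auto
    then show "C 0 \<subset> C 1" "C 1 \<subset> C 2" by (simp_all add: numeral_2_eq_2)
    have "irreducible_in (Top X) (C 0)" "irreducible_in (Top X) (C 2)"
      using ch m by (auto simp: irreducible_closed_chain_def)
    then show "C 0 \<noteq> {}" "C 2 \<subseteq> points X" by (auto simp: irreducible_in_def)
  qed
  obtain x0 where x0: "x0 \<in> points X" "x0 \<notin> C 1" using sub by blast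
  obtain p where p: "p \<in> poly_funs n" "p (c x0) \<noteq> 0" "\<And>y. y \<in> C 1 \<Longrightarrow> p (c y) = 0"
    by (rule closed_separate[OF cl x0]) (rule that)
  have "(\<lambda>x. p (c x)) \<in> R" by (rule regularI[OF p(1)]) (rule refl)
  from polynomial_in_slice[OF const0 this] obtain P where P: "\<forall>x\<in>points X. p (c x) = poly P (z x)" by blast
  have P0: "P \<noteq> 0" using P x0(1) p(2) by auto
  have C1: "C 1 \<subseteq> points X" "C 1 \<noteq> {}" using sub by blast+
  have "\<exists>r. \<forall>x\<in>C 1. z x = r"
  proof (rule constant_if_algebraic[OF zA P0 _ C1(2)])
    show "poly P (z x) = 0" if "x \<in> C 1" for x using P p(3)[OF that] that C1(1) by auto
  qed (rule prime_on_irreducible[OF irr])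
  then obtain r where r: "\<forall>x\<in>C 1. z x = r" by blast
  have "x = y" if "x \<in> C 1" "y \<in> C 1" for x y
  proof (rule separates)
    fix f assume "f \<in> R"
    from polynomial_in_slice[OF const0 this] obtain Q where "\<forall>x\<in>points X. f x = poly Q (z x)" by blast
    then show "f x = f y" using r that C1(1) by (metis subsetD)
  qed (use that C1(1) in auto)
  then show False using sub(1,3) by blast
qed

theorem Aut_not_algebraic:
  assumes dim: "dimension X \<ge> 2"
  shows "\<not> Aut_is_algebraic_group X"
proof
  assume Aut: "Aut_is_algebraic_group X"
  have "dimension X \<le> 1"
    unfolding dimension_def
  proof (rule Sup_least)
    fix l assume "l \<in> {enat m |m C. irreducible_closed_chain (Top X) m C}"
    then obtain m C where m: "l = enat m" "irreducible_closed_chain (Top X) m C" by blast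
    then have "m \<le> 1" using dimension_le_1[OF weight_zero_constant[OF Aut]] by blast
    then show "l \<le> 1" using m(1) by (simp add: one_enat_def)
  qed
  then have "(2 :: enat) \<le> 1" using dim by (rule order.trans[rotated])
  then show False by (simp add: one_enat_def numeral_eq_enat)
qed

end

theorem corollary2:
  fixes X :: "('a, 'k::{alg_closed_field, field_char_0}) fspace"
    and \<phi> :: "'k \<Rightarrow> 'a \<Rightarrow> 'a"
    and D :: "'a set"
  assumes "affine_variety X"
    and "normal_variety X"
    and "regular_action Gm_group Gm_variety X \<phi>"
    and "faithful_action Gm_group (points X) \<phi>"
    and "prime_divisor X D"
    and "\<forall>t\<in>carrier Gm_group. \<forall>x\<in>D. \<phi> t x = x"
  shows "\<not> rigid X \<and> (dimension X \<ge> 2 \<longrightarrow> \<not> Aut_is_algebraic_group X)"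
proof -
  obtain n Z c where var: "affine_chart_variety X n Z c"
    using assms(1) unfolding affine_variety_def affine_fspace_def affine_chart_variety_def by blast
  then interpret affine_chart_variety X n Z c .
  obtain act z a d where "slice_algebra (points X) R act z a d n c"
    using slice_exists[OF assms(2-6)] by blast
  with var have "affine_slice X n Z c act z a d" unfolding affine_slice_def ..
  then interpret affine_slice X n Z c act z a d .
  show ?thesis using not_rigid Aut_not_algebraic by blast
qed

end
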